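(* Given a directed acyclic graph $G$ with $n$ vertices and $m$ edges, its vertices can be output in topologically sorted order in $O(m+n)$ time using $m+3n+o(n+m)$ bits of working space. The algorithm can also detect if $G$ is not acyclic.
   Context: A topological ordering of a directed acyclic graph is a linear ordering of its vertices such that for every directed edge $(u,v)$, $u$ comes before $v$. Model: the input graph is stored in read-only memory as a standard adjacency list, output goes to write-only memory, and only the additional random-access workspace is counted, in bits; the workspace is a word RAM with words of $\Omega(\lg n)$ bits.
   Formalization: The word length, besides being Ω(lg n), is assumed to be o(n); otherwise a single workspace word (e.g. of n² bits) would already exceed m+3n+o(n+m) bits. *)

theory Defs
  imports Complex_Main "HOL-Library.Landau_Symbols"
begin

section \<open>A word RAM with read-only input and write-only output\<close>

text \<open>
  The machine has word length \<open>w\<close>. Words are natural numbers below \<open>2 ^ w\<close>, and arithmetic is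
  modulo \<open>2 ^ w\<close>. A program is a structured program over finitely many registers, a random-access
  workspace of \<open>k\<close> cells of one word each, a read-only input (a list of words) and a write-only
  output stream, to which words can only be appended. Every instruction costs one time unit.
\<close>

type_synonym reg = nat

datatype binop = Plus | Minus | Times | Div | BitAnd | BitOr | BitXor | ShiftL | ShiftR | Less | Equal

fun word_op :: "nat \<Rightarrow> binop \<Rightarrow> nat \<Rightarrow> nat \<Rightarrow> nat" where
  "word_op w Plus a b = take_bit w (a + b)"
| "word_op w Minus a b = take_bit w (a + 2 ^ w - b)"
| "word_op w Times a b = take_bit w (a * b)"
| "word_op w Div a b = a div b"
| "word_op w BitAnd a b = and a b"
| "word_op w BitOr a b = or a b"
| "word_op w BitXor a b = xor a b"
| "word_op w ShiftL a b = take_bit w (push_bit b a)"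
| "word_op w ShiftR a b = drop_bit b a"
| "word_op w Less a b = take_bit w (of_bool (a < b))"
| "word_op w Equal a b = take_bit w (of_bool (a = b))"

datatype com =
    Skip
  | Const reg nat
  | WordLength reg
  | Op binop reg reg reg
  | Load reg reg
  | Store reg reg
  | Input reg reg
  | Output reg
  | Seq com com
  | If reg com com
  | While reg com

fun registers :: "com \<Rightarrow> reg set" where
  "registers Skip = {}"
| "registers (Const x c) = {x}"
| "registers (WordLength x) = {x}"
| "registers (Op f x y z) = {x, y, z}"
| "registers (Load x y) = {x, y}"
| "registers (Store x y) = {x, y}"
| "registers (Input x y) = {x, y}"
| "registers (Output x) = {x}"
| "registers (Seq c d) = registers c \<union> registers d"
| "registers (If x c d) = {x} \<union> registers c \<union> registers d"
| "registers (While x c) = {x} \<union> registers c"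

record state =
  regs :: "reg \<Rightarrow> nat"
  mem :: "nat \<Rightarrow> nat"
  out :: "nat list"

text \<open>
  \<open>exec w k R c s t s'\<close>: on a machine with word length \<open>w\<close>, \<open>k\<close> workspace cells and read-only
  input \<open>R\<close>, the program \<open>c\<close> started in \<open>s\<close> halts in \<open>s'\<close> after \<open>t\<close> time units. Accessing a
  workspace cell with address at least \<open>k\<close>, or reading beyond the end of the input, is a fault:
  the execution is stuck and the relation does not hold.
\<close>

inductive exec :: "nat \<Rightarrow> nat \<Rightarrow> nat list \<Rightarrow> com \<Rightarrow> state \<Rightarrow> nat \<Rightarrow> state \<Rightarrow> bool"
  for w k :: nat and R :: "nat list"
where
  Skip: "exec w k R Skip s 1 s"
| Const: "exec w k R (Const x c) s 1 (s\<lparr>regs := (regs s)(x := take_bit w c)\<rparr>)"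
| WordLength: "exec w k R (WordLength x) s 1 (s\<lparr>regs := (regs s)(x := w)\<rparr>)"
| Op: "exec w k R (Op f x y z) s 1
         (s\<lparr>regs := (regs s)(x := word_op w f (regs s y) (regs s z))\<rparr>)"
| Load: "regs s y < k \<Longrightarrow>
         exec w k R (Load x y) s 1 (s\<lparr>regs := (regs s)(x := mem s (regs s y))\<rparr>)"
| Store: "regs s x < k \<Longrightarrow>
         exec w k R (Store x y) s 1 (s\<lparr>mem := (mem s)(regs s x := regs s y)\<rparr>)"
| Input: "regs s y < length R \<Longrightarrow>
         exec w k R (Input x y) s 1 (s\<lparr>regs := (regs s)(x := R ! regs s y)\<rparr>)"
| Output: "exec w k R (Output x) s 1 (s\<lparr>out := out s @ [regs s x]\<rparr>)"
| Seq: "exec w k R c s t s' \<Longrightarrow> exec w k R d s' t' s'' \<Longrightarrow>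
         exec w k R (Seq c d) s (t + t') s''"
| IfTrue: "regs s x \<noteq> 0 \<Longrightarrow> exec w k R c s t s' \<Longrightarrow> exec w k R (If x c d) s (Suc t) s'"
| IfFalse: "regs s x = 0 \<Longrightarrow> exec w k R d s t s' \<Longrightarrow> exec w k R (If x c d) s (Suc t) s'"
| WhileTrue: "regs s x \<noteq> 0 \<Longrightarrow> exec w k R c s t s' \<Longrightarrow> exec w k R (While x c) s' t' s'' \<Longrightarrow>
         exec w k R (While x c) s (Suc (t + t')) s''"
| WhileFalse: "regs s x = 0 \<Longrightarrow> exec w k R (While x c) s 1 s"

inductive_cases exec_SkipE: "exec w k R Skip s t s'"
inductive_cases exec_ConstE: "exec w k R (Const x c) s t s'"
inductive_cases exec_WordLengthE: "exec w k R (WordLength x) s t s'"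
inductive_cases exec_OpE: "exec w k R (Op f x y z) s t s'"
inductive_cases exec_LoadE: "exec w k R (Load x y) s t s'"
inductive_cases exec_StoreE: "exec w k R (Store x y) s t s'"
inductive_cases exec_InputE: "exec w k R (Input x y) s t s'"
inductive_cases exec_OutputE: "exec w k R (Output x) s t s'"
inductive_cases exec_SeqE: "exec w k R (Seq c d) s t s'"
inductive_cases exec_IfE: "exec w k R (If x c d) s t s'"
inductive_cases exec_WhileE: "exec w k R (While x c) s t s'"

lemma exec_deterministic:
  "exec w k R c s t s' \<Longrightarrow> exec w k R c s u s'' \<Longrightarrow> u = t \<and> s'' = s'"
proof (induction arbitrary: u s'' rule: exec.induct)
  case (Seq c s t s' d t' s1)
  from Seq.prems show ?case by (rule exec_SeqE) (use Seq.IH in blast)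
next
  case (IfTrue s x c t s' d)
  from IfTrue.prems IfTrue.hyps show ?case by (auto elim!: exec_IfE dest: IfTrue.IH)
next
  case (IfFalse s x d t s' c)
  from IfFalse.prems IfFalse.hyps show ?case by (auto elim!: exec_IfE dest: IfFalse.IH)
next
  case (WhileTrue s x c t s' t' s1)
  from WhileTrue.prems show ?case
    by (rule exec_WhileE) (use WhileTrue.hyps WhileTrue.IH in blast)+
next
  case (WhileFalse s x c)
  from WhileFalse.prems WhileFalse.hyps show ?case by (auto elim: exec_WhileE)
qed (auto elim: exec_SkipE exec_ConstE exec_WordLengthE exec_OpE exec_LoadE exec_StoreE
       exec_InputE exec_OutputE)

text \<open>The workspace is not initialised: registers and cells start with arbitrary words.\<close>

definition initial_state :: "nat \<Rightarrow> state \<Rightarrow> bool" where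
  "initial_state w s \<longleftrightarrow> (\<forall>x. regs s x < 2 ^ w) \<and> (\<forall>a. mem s a < 2 ^ w) \<and> out s = []"

text \<open>Registers are workspace as well and are charged one word each.\<close>

definition workspace_bits :: "nat \<Rightarrow> nat \<Rightarrow> com \<Rightarrow> nat" where
  "workspace_bits w k c = w * (card (registers c) + k)"

section \<open>Directed graphs and their adjacency lists\<close>

text \<open>A directed graph with vertices \<open>0, \<dots>, n - 1\<close> is given by its set of edges.\<close>

definition digraph_on :: "nat \<Rightarrow> (nat \<times> nat) set \<Rightarrow> bool" where
  "digraph_on n E \<longleftrightarrow> E \<subseteq> {..<n} \<times> {..<n}"

definition topological_ordering :: "nat \<Rightarrow> (nat \<times> nat) set \<Rightarrow> nat list \<Rightarrow> bool" where
  "topological_ordering n E xs \<longleftrightarrow> distinct xs \<and> set xs = {..<n} \<and>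
     (\<forall>i<length xs. \<forall>j<length xs. (xs ! i, xs ! j) \<in> E \<longrightarrow> i < j)"

text \<open>
  \<open>linked_list R p xs\<close>: the linked list in \<open>R\<close> whose first node has address \<open>p\<close> has contents \<open>xs\<close>.
  A node is a pair of consecutive cells, the item and the address of the next node. Address 0
  never holds a node (see below) and serves as the null pointer.
\<close>

fun linked_list :: "nat list \<Rightarrow> nat \<Rightarrow> nat list \<Rightarrow> bool" where
  "linked_list R p [] \<longleftrightarrow> p = 0"
| "linked_list R p (x # xs) \<longleftrightarrow>
     p \<noteq> 0 \<and> Suc p < length R \<and> R ! p = x \<and> linked_list R (R ! Suc p) xs"

text \<open>
  Cell 0 holds the number of vertices, cell \<open>v + 1\<close> the address of the list of out-neighbours of \<open>v\<close>
  (in arbitrary order), and the remaining \<open>2 m\<close> cells are available for the nodes, in any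
  arrangement. Neither in-neighbours nor degrees are stored.
\<close>

definition adjacency_list :: "nat \<Rightarrow> (nat \<times> nat) set \<Rightarrow> nat list \<Rightarrow> bool" where
  "adjacency_list n E R \<longleftrightarrow> length R = 1 + n + 2 * card E \<and> R ! 0 = n \<and>
     (\<forall>v<n. \<exists>xs. linked_list R (R ! Suc v) xs \<and> distinct xs \<and> set xs = {u. (v, u) \<in> E})"

text \<open>All addresses and all entries of the input are words.\<close>

definition fits_in_words :: "nat \<Rightarrow> nat list \<Rightarrow> bool" where
  "fits_in_words w R \<longleftrightarrow> length R \<le> 2 ^ w \<and> (\<forall>x\<in>set R. x < 2 ^ w)"

text \<open>Asymptotics in pairs \<open>(n, m)\<close> are for \<open>n + m\<close> tending to infinity.\<close>

definition graph_size_at_top :: "(nat \<times> nat) filter" where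
  "graph_size_at_top = filtercomap (\<lambda>(n, m). n + m) at_top"

end

theory Submission
  imports Defs
begin

text \<open>
  Kahn's algorithm: count in-degrees, then repeatedly output a vertex whose counter is zero and
  decrement the counters of its out-neighbours. The point is to store counters whose sum is \<open>m\<close>
  in \<open>m + n + o(n)\<close> bits with constant-time access, although the in-degrees are unknown in advance.
  A first pass over the edges computes, for each block of \<open>l = \<Theta>(log n / (log log n)\<^sup>2)\<close> vertices, the
  sum of its in-degrees, saturated at a polylogarithmic bound; this takes \<open>o(n)\<close> bits. A block
  with saturated sum \<open>s\<close> then receives \<open>s + l\<close> bits. If \<open>s + l\<close> is below roughly \<open>log n\<close>, the counters
  of the block are kept in unary, and the position of the field of a vertex is found in a table of
  \<open>o(n)\<close> bits. Otherwise \<open>s\<close> is so large that fields of fixed width \<open>O(log log n)\<close>, or \<open>O(log n)\<close> for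
  saturated blocks, fit into \<open>s\<close> bits. Blocks are located by absolute offsets of groups of blocks
  and short offsets within a group. The set of ready vertices takes \<open>2 n + o(n)\<close> bits: a bit vector
  and a stack of the nonempty chunks of that vector, where the table doubles as a search for the
  first set bit of a chunk. All fields may straddle words, so the bounds do not depend on the word
  length. For \<open>n\<close> below a constant one word per vertex is affordable.
\<close>

section \<open>A program logic with running time\<close>

datatype expr = V reg | C nat | WL | Bin binop expr expr

abbreviation ex_add (infixl "\<oplus>" 65) where "a \<oplus> b \<equiv> Bin Plus a b"
abbreviation ex_sub (infixl "\<ominus>" 65) where "a \<ominus> b \<equiv> Bin Minus a b"
abbreviation ex_mul (infixl "\<otimes>" 70) where "a \<otimes> b \<equiv> Bin Times a b"
abbreviation ex_div (infixl "\<oslash>" 70) where "a \<oslash> b \<equiv> Bin Div a b"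
abbreviation ex_less (infix "\<prec>" 60) where "a \<prec> b \<equiv> Bin Less a b"

fun eval :: "nat \<Rightarrow> (reg \<Rightarrow> nat) \<Rightarrow> expr \<Rightarrow> nat" where
  "eval w r (V x) = r x"
| "eval w r (C c) = take_bit w c"
| "eval w r WL = w"
| "eval w r (Bin f a b) = word_op w f (eval w r a) (eval w r b)"

text \<open>Registers from 100 on hold intermediate results of expressions and are invisible to the logic.\<close>

fun visible :: "expr \<Rightarrow> bool" where
  "visible (V x) \<longleftrightarrow> x < 100"
| "visible (Bin f a b) \<longleftrightarrow> visible a \<and> visible b"
| "visible _ \<longleftrightarrow> True"

fun cost :: "expr \<Rightarrow> nat" where
  "cost (Bin f a b) = cost a + cost b + 1"
| "cost _ = 1"

declare word_op.simps(1-3,8,10,11) [simp del]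

fun comp :: "reg \<Rightarrow> expr \<Rightarrow> com" where
  "comp d (V x) = Op BitAnd d x x"
| "comp d (C c) = Const d c"
| "comp d WL = WordLength d"
| "comp d (Bin f a b) = Seq (comp d a) (Seq (comp (Suc d) b) (Op f d d (Suc d)))"

lemma eval_cong:
  "visible e \<Longrightarrow> (\<And>x. x < 100 \<Longrightarrow> r x = r' x) \<Longrightarrow> eval w r e = eval w r' e"
  by (induction e) auto

lemma exec_comp:
  assumes "visible e" "100 \<le> d"
  shows "\<exists>s'. exec w k R (comp d e) s (cost e) s' \<and> regs s' d = eval w (regs s) e \<and>
    (\<forall>x<d. regs s' x = regs s x) \<and> mem s' = mem s \<and> out s' = out s"
  using assms
proof (induction e arbitrary: d s)
  case (V x)
  show ?case unfolding comp.simps cost.simps by (rule exI, rule conjI, rule exec.Op) auto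
next
  case (C c)
  show ?case unfolding comp.simps cost.simps by (rule exI, rule conjI, rule exec.Const) auto
next
  case WL
  show ?case unfolding comp.simps cost.simps by (rule exI, rule conjI, rule exec.WordLength) auto
next
  case (Bin f a b)
  from Bin.IH(1)[of d s] Bin.prems obtain s1 where 1: "exec w k R (comp d a) s (cost a) s1"
    "regs s1 d = eval w (regs s) a" "\<forall>x<d. regs s1 x = regs s x" "mem s1 = mem s" "out s1 = out s"
    by auto
  from Bin.IH(2)[of "Suc d" s1] Bin.prems obtain s2 where 2: "exec w k R (comp (Suc d) b) s1 (cost b) s2"
    "regs s2 (Suc d) = eval w (regs s1) b" "\<forall>x<Suc d. regs s2 x = regs s1 x"
    "mem s2 = mem s1" "out s2 = out s1"
    by auto
  have b: "eval w (regs s1) b = eval w (regs s) b"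
    using Bin.prems 1(3) by (intro eval_cong) auto
  have "exec w k R (comp d (Bin f a b)) s (cost a + (cost b + 1))
    (s2\<lparr>regs := (regs s2)(d := word_op w f (regs s2 d) (regs s2 (Suc d)))\<rparr>)"
    unfolding comp.simps by (rule exec.Seq[OF 1(1) exec.Seq[OF 2(1) exec.Op]])
  then show ?case unfolding cost.simps add.assoc by (rule_tac exI, rule_tac conjI) (assumption, use 1 2 b in auto)
qed

definition Assign :: "reg \<Rightarrow> expr \<Rightarrow> com" (infix "\<leftarrow>" 57) where
  "(x \<leftarrow> e) = Seq (comp 100 e) (Op BitAnd x 100 100)"

definition LoadE :: "reg \<Rightarrow> expr \<Rightarrow> com" where
  "LoadE x e = Seq (comp 100 e) (Load x 100)"

definition InputE :: "reg \<Rightarrow> expr \<Rightarrow> com" where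
  "InputE x e = Seq (comp 100 e) (Input x 100)"

definition StoreE :: "expr \<Rightarrow> expr \<Rightarrow> com" where
  "StoreE a e = Seq (comp 100 a) (Seq (comp 101 e) (Store 100 101))"

definition IfE :: "expr \<Rightarrow> com \<Rightarrow> com \<Rightarrow> com" where
  "IfE e c d = Seq (comp 100 e) (If 100 c d)"

definition WhileE :: "expr \<Rightarrow> com \<Rightarrow> com" where
  "WhileE e c = Seq (comp 100 e) (While 100 (Seq c (comp 100 e)))"

abbreviation seq (infixr ";;" 55) where "c ;; d \<equiv> Seq c d"

locale ram =
  fixes w k :: nat and R :: "nat list"
begin

text \<open>The time stamp passed to the postcondition includes the start time \<open>\<tau>\<close>.\<close>

definition wp :: "com \<Rightarrow> (nat \<Rightarrow> (reg \<Rightarrow> nat) \<Rightarrow> (nat \<Rightarrow> nat) \<Rightarrow> nat list \<Rightarrow> bool) \<Rightarrow>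
    nat \<Rightarrow> (reg \<Rightarrow> nat) \<Rightarrow> (nat \<Rightarrow> nat) \<Rightarrow> nat list \<Rightarrow> bool" where
  "wp c Q \<tau> r m o' \<longleftrightarrow> (\<forall>s. (\<forall>x<100. regs s x = r x) \<and> mem s = m \<and> out s = o' \<longrightarrow>
     (\<exists>t s' r'. exec w k R c s t s' \<and> (\<forall>x<100. regs s' x = r' x) \<and>
        Q (\<tau> + t) r' (mem s') (out s')))"

abbreviation ev where "ev \<equiv> eval w"

lemma wpI:
  fixes Q :: "nat \<Rightarrow> (reg \<Rightarrow> nat) \<Rightarrow> (nat \<Rightarrow> nat) \<Rightarrow> nat list \<Rightarrow> bool"
  assumes "\<And>s :: state. (\<And>x. x < 100 \<Longrightarrow> regs s x = r x) \<Longrightarrow> mem s = m \<Longrightarrow> out s = o' \<Longrightarrow>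
     \<exists>t s' r'. exec w k R c s t s' \<and> (\<forall>x<100. regs s' x = r' x) \<and>
        Q (\<tau> + t) r' (mem s') (out s')"
  shows "wp c Q \<tau> r m o'"
  using assms unfolding wp_def by blast

lemma wpE:
  fixes s :: state
  assumes "wp c Q \<tau> r m o'" "\<And>x. x < 100 \<Longrightarrow> regs s x = r x" "mem s = m" "out s = o'"
  obtains t s' r' where "exec w k R c s t s'" "\<And>x::nat. x < 100 \<Longrightarrow> regs s' x = r' x"
    "Q (\<tau> + t) r' (mem s') (out s')"
  using assms unfolding wp_def by blast

lemma wp_conseq:
  assumes "wp c Q' \<tau> r m o'" "\<And>\<tau>' r' m' o'. \<tau> \<le> \<tau>' \<Longrightarrow> Q' \<tau>' r' m' o' \<Longrightarrow> Q \<tau>' r' m' o'"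
  shows "wp c Q \<tau> r m o'"
proof (rule wpI)
  fix s :: state assume s: "\<And>x. x < 100 \<Longrightarrow> regs s x = r x" "mem s = m" "out s = o'"
  obtain t s' r' where 1: "exec w k R c s t s'" "\<And>x. x < 100 \<Longrightarrow> regs s' x = r' x"
    "Q' (\<tau> + t) r' (mem s') (out s')"
    using wpE[OF assms(1) s] by blast
  have "Q (\<tau> + t) r' (mem s') (out s')" by (rule assms(2)[OF le_add1 1(3)])
  then show "\<exists>t s' r'. exec w k R c s t s' \<and> (\<forall>x<100. regs s' x = r' x) \<and> Q (\<tau> + t) r' (mem s') (out s')"
    using 1 by blast
qed

lemma wp_seq:
  assumes "wp c (wp d Q) \<tau> r m o'"
  shows "wp (c ;; d) Q \<tau> r m o'"
proof (rule wpI)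
  fix s :: state assume s: "\<And>x. x < 100 \<Longrightarrow> regs s x = r x" "mem s = m" "out s = o'"
  obtain t s1 r1 where 1: "exec w k R c s t s1" "\<And>x. x < 100 \<Longrightarrow> regs s1 x = r1 x"
    "wp d Q (\<tau> + t) r1 (mem s1) (out s1)"
    using wpE[OF assms s] by blast
  obtain t2 s2 r2 where 2: "exec w k R d s1 t2 s2" "\<And>x. x < 100 \<Longrightarrow> regs s2 x = r2 x"
    "Q (\<tau> + t + t2) r2 (mem s2) (out s2)"
    using wpE[OF 1(3,2) refl refl] by blast
  show "\<exists>t s' r'. exec w k R (c;; d) s t s' \<and> (\<forall>x<100. regs s' x = r' x) \<and> Q (\<tau> + t) r' (mem s') (out s')"
    using exec.Seq[OF 1(1) 2(1)] 2 by (metis add.assoc)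
qed

lemma wp_skip: "Q (\<tau> + 1) r m o' \<Longrightarrow> wp Skip Q \<tau> r m o'"
  by (rule wpI) (metis exec.Skip)

lemma comp_run:
  fixes s :: state
  assumes "visible e" "\<And>x. x < 100 \<Longrightarrow> regs s x = r x"
  obtains s' where "exec w k R (comp 100 e) s (cost e) s'" "regs s' 100 = ev r e"
    "\<And>x. x < 100 \<Longrightarrow> regs s' x = r x" "mem s' = mem s" "out s' = out s"
proof -
  have "ev (regs s) e = ev r e" using assms by (intro eval_cong) auto
  then show ?thesis using exec_comp[OF assms(1), of 100 w k R s] assms(2) that by auto
qed

lemma wp_assign:
  assumes "visible e" "Q (\<tau> + (cost e + 1)) (r(x := ev r e)) m o'"
  shows "wp (x \<leftarrow> e) Q \<tau> r m o'"
proof (rule wpI)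
  fix s :: state assume s: "\<And>x. x < 100 \<Longrightarrow> regs s x = r x" "mem s = m" "out s = o'"
  obtain s1 where 1: "exec w k R (comp 100 e) s (cost e) s1" "regs s1 100 = ev r e"
    "\<And>x. x < 100 \<Longrightarrow> regs s1 x = r x" "mem s1 = mem s" "out s1 = out s"
    using comp_run assms(1) s(1) by blast
  show "\<exists>t s' r'. exec w k R (x \<leftarrow> e) s t s' \<and> (\<forall>x<100. regs s' x = r' x) \<and> Q (\<tau> + t) r' (mem s') (out s')"
    unfolding Assign_def
    by (rule exI, rule exI, rule exI[of _ "r(x := ev r e)"], rule conjI, rule exec.Seq[OF 1(1) exec.Op])
      (use assms(2) 1 s in auto)
qed

lemma wp_load:
  assumes "visible e" "ev r e < k" "Q (\<tau> + (cost e + 1)) (r(x := m (ev r e))) m o'"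
  shows "wp (LoadE x e) Q \<tau> r m o'"
proof (rule wpI)
  fix s :: state assume s: "\<And>x. x < 100 \<Longrightarrow> regs s x = r x" "mem s = m" "out s = o'"
  obtain s1 where 1: "exec w k R (comp 100 e) s (cost e) s1" "regs s1 100 = ev r e"
    "\<And>x. x < 100 \<Longrightarrow> regs s1 x = r x" "mem s1 = mem s" "out s1 = out s"
    using comp_run assms(1) s(1) by blast
  have "regs s1 100 < k" using 1 assms by simp
  show "\<exists>t s' r'. exec w k R (LoadE x e) s t s' \<and> (\<forall>x<100. regs s' x = r' x) \<and> Q (\<tau> + t) r' (mem s') (out s')"
    unfolding LoadE_def
    by (rule exI, rule exI, rule exI[of _ "r(x := m (ev r e))"], rule conjI, rule exec.Seq[OF 1(1) exec.Load])
      (use assms 1 s in auto)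
qed

lemma wp_input:
  assumes "visible e" "ev r e < length R" "Q (\<tau> + (cost e + 1)) (r(x := R ! ev r e)) m o'"
  shows "wp (InputE x e) Q \<tau> r m o'"
proof (rule wpI)
  fix s :: state assume s: "\<And>x. x < 100 \<Longrightarrow> regs s x = r x" "mem s = m" "out s = o'"
  obtain s1 where 1: "exec w k R (comp 100 e) s (cost e) s1" "regs s1 100 = ev r e"
    "\<And>x. x < 100 \<Longrightarrow> regs s1 x = r x" "mem s1 = mem s" "out s1 = out s"
    using comp_run assms(1) s(1) by blast
  show "\<exists>t s' r'. exec w k R (InputE x e) s t s' \<and> (\<forall>x<100. regs s' x = r' x) \<and> Q (\<tau> + t) r' (mem s') (out s')"
    unfolding InputE_def
    by (rule exI, rule exI, rule exI[of _ "r(x := R ! ev r e)"], rule conjI, rule exec.Seq[OF 1(1) exec.Input])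
      (use assms 1 s in auto)
qed

lemma wp_store:
  assumes "visible a" "visible e" "ev r a < k" "Q (\<tau> + (cost a + cost e + 1)) r (m(ev r a := ev r e)) o'"
  shows "wp (StoreE a e) Q \<tau> r m o'"
proof (rule wpI)
  fix s :: state assume s: "\<And>x. x < 100 \<Longrightarrow> regs s x = r x" "mem s = m" "out s = o'"
  obtain s1 where 1: "exec w k R (comp 100 a) s (cost a) s1" "regs s1 100 = ev r a"
    "\<And>x. x < 100 \<Longrightarrow> regs s1 x = r x" "mem s1 = mem s" "out s1 = out s"
    using comp_run assms(1) s(1) by blast
  have e: "ev (regs s1) e = ev r e" using assms 1 by (intro eval_cong) auto
  obtain s2 where 2: "exec w k R (comp 101 e) s1 (cost e) s2" "regs s2 101 = ev r e"
    "\<forall>x<101. regs s2 x = regs s1 x" "mem s2 = mem s1" "out s2 = out s1"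
    using exec_comp[OF assms(2), of 101 w k R s1] e by auto
  have "exec w k R (StoreE a e) s (cost a + (cost e + 1)) (s2\<lparr>mem := (mem s2)(regs s2 100 := regs s2 101)\<rparr>)"
    unfolding StoreE_def
    by (rule exec.Seq[OF 1(1) exec.Seq[OF 2(1) exec.Store]]) (use 1 2 assms in auto)
  then show "\<exists>t s' r'. exec w k R (StoreE a e) s t s' \<and> (\<forall>x<100. regs s' x = r' x) \<and> Q (\<tau> + t) r' (mem s') (out s')"
    using assms 1 2 s by (intro exI[of _ r] exI conjI) (auto simp: add.assoc)
qed

lemma wp_output:
  assumes "x < 100" "Q (\<tau> + 1) r m (o' @ [r x])"
  shows "wp (Output x) Q \<tau> r m o'"
  by (rule wpI, rule exI, rule exI, rule exI[of _ r], rule conjI, rule exec.Output) (use assms in auto)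

lemma wp_if:
  assumes "visible e" "ev r e \<noteq> 0 \<Longrightarrow> wp c Q (\<tau> + (cost e + 1)) r m o'"
    "ev r e = 0 \<Longrightarrow> wp d Q (\<tau> + (cost e + 1)) r m o'"
  shows "wp (IfE e c d) Q \<tau> r m o'"
proof (rule wpI)
  fix s :: state assume s: "\<And>x. x < 100 \<Longrightarrow> regs s x = r x" "mem s = m" "out s = o'"
  obtain s1 where 1: "exec w k R (comp 100 e) s (cost e) s1" "regs s1 100 = ev r e"
    "\<And>x. x < 100 \<Longrightarrow> regs s1 x = r x" "mem s1 = mem s" "out s1 = out s"
    using comp_run assms(1) s(1) by blast
  show "\<exists>t s' r'. exec w k R (IfE e c d) s t s' \<and> (\<forall>x<100. regs s' x = r' x) \<and> Q (\<tau> + t) r' (mem s') (out s')"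
  proof (cases "ev r e = 0")
    case True
    obtain t s2 r2 where 2: "exec w k R d s1 t s2" "\<And>x. x < 100 \<Longrightarrow> regs s2 x = r2 x"
      "Q (\<tau> + (cost e + 1) + t) r2 (mem s2) (out s2)"
      using wpE[OF assms(3)[OF True] 1(3)] 1(4,5) s(2,3) by metis
    then have "exec w k R (IfE e c d) s (cost e + Suc t) s2"
      unfolding IfE_def using 1 True by (intro exec.Seq exec.IfFalse) auto
    then show ?thesis using 2 by (intro exI[of _ r2] exI conjI) (auto simp: add.assoc)
  next
    case False
    obtain t s2 r2 where 2: "exec w k R c s1 t s2" "\<And>x. x < 100 \<Longrightarrow> regs s2 x = r2 x"
      "Q (\<tau> + (cost e + 1) + t) r2 (mem s2) (out s2)"
      using wpE[OF assms(2)[OF False] 1(3)] 1(4,5) s(2,3) by metis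
    then have "exec w k R (IfE e c d) s (cost e + Suc t) s2"
      unfolding IfE_def using 1 False by (intro exec.Seq exec.IfTrue) auto
    then show ?thesis using 2 by (intro exI[of _ r2] exI conjI) (auto simp: add.assoc)
  qed
qed

lemma wp_while:
  assumes e: "visible e"
    and inv: "I p r m o'"
    and step: "\<And>p r m o' \<tau>. I p r m o' \<Longrightarrow> ev r e \<noteq> 0 \<Longrightarrow>
      wp c (\<lambda>\<tau>' r' m' o'. \<exists>p'. I p' r' m' o' \<and> \<tau>' + p' + cost e + 1 \<le> \<tau> + p) \<tau> r m o'"
    and post: "\<And>p' r' m' o' \<tau>'. I p' r' m' o' \<Longrightarrow> ev r' e = 0 \<Longrightarrow>
      \<tau>' + p' \<le> \<tau> + p + cost e + 1 \<Longrightarrow> Q \<tau>' r' m' o'"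
  shows "wp (WhileE e c) Q \<tau> r m o'"
proof (rule wpI)
  fix s :: state assume s: "\<And>x. x < 100 \<Longrightarrow> regs s x = r x" "mem s = m" "out s = o'"
  have loop: "\<exists>t s' r' p'. exec w k R (While 100 (c ;; comp 100 e)) s1 t s' \<and>
     (\<forall>x<100. regs s' x = r' x) \<and> I p' r' (mem s') (out s') \<and> ev r' e = 0 \<and> t + p' \<le> p1 + 1"
    if "I p1 r1 (mem s1) (out s1)" "regs s1 100 = ev r1 e" "\<And>x. x < 100 \<Longrightarrow> regs s1 x = r1 x" for p1 r1 s1
    using that
  proof (induction p1 arbitrary: r1 s1 rule: less_induct)
    case (less p1)
    show ?case
    proof (cases "ev r1 e = 0")
      case True
      then show ?thesis using less.prems
        by (intro exI[of _ 1] exI[of _ s1] exI[of _ r1] exI[of _ p1] conjI exec.WhileFalse) auto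
    next
      case False
      obtain t2 s2 r2 p2 where 2: "exec w k R c s1 t2 s2" "\<And>x. x < 100 \<Longrightarrow> regs s2 x = r2 x"
        "I p2 r2 (mem s2) (out s2)" "t2 + p2 + cost e + 1 \<le> p1"
      proof -
        obtain t2 s2 r2 where a: "exec w k R c s1 t2 s2" "\<And>x. x < 100 \<Longrightarrow> regs s2 x = r2 x"
          "\<exists>p'. I p' r2 (mem s2) (out s2) \<and> 0 + t2 + p' + cost e + 1 \<le> 0 + p1"
          using wpE[OF step[OF less.prems(1) False, of 0] less.prems(3) refl refl] by blast
        then show ?thesis using that[OF a(1,2)] by auto
      qed
      obtain s3 where 3: "exec w k R (comp 100 e) s2 (cost e) s3" "regs s3 100 = ev r2 e"
        "\<And>x. x < 100 \<Longrightarrow> regs s3 x = r2 x" "mem s3 = mem s2" "out s3 = out s2"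
        using comp_run e 2(2) by blast
      have "p2 < p1" using 2 by simp
      from less.IH[OF this, of r2 s3] 2 3
      obtain t4 s4 r4 p4 where 4: "exec w k R (While 100 (c ;; comp 100 e)) s3 t4 s4"
        "\<forall>x<100. regs s4 x = r4 x" "I p4 r4 (mem s4) (out s4)" "ev r4 e = 0" "t4 + p4 \<le> p2 + 1"
        by auto
      have "exec w k R (While 100 (c ;; comp 100 e)) s1 (Suc ((t2 + cost e) + t4)) s4"
        by (rule exec.WhileTrue[OF _ exec.Seq[OF 2(1) 3(1)] 4(1)]) (use less.prems False in auto)
      then show ?thesis using 4 2(4)
        by (intro exI[of _ "Suc ((t2 + cost e) + t4)"] exI[of _ s4] exI[of _ r4] exI[of _ p4] conjI) auto
    qed
  qed
  obtain s1 where 1: "exec w k R (comp 100 e) s (cost e) s1" "regs s1 100 = ev r e"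
    "\<And>x. x < 100 \<Longrightarrow> regs s1 x = r x" "mem s1 = mem s" "out s1 = out s"
    using comp_run e s(1) by blast
  obtain t s' r' p' where 2: "exec w k R (While 100 (c ;; comp 100 e)) s1 t s'"
     "\<forall>x<100. regs s' x = r' x" "I p' r' (mem s') (out s')" "ev r' e = 0" "t + p' \<le> p + 1"
    using loop[of p r s1] 1 inv s by auto
  have "exec w k R (WhileE e c) s (cost e + t) s'"
    unfolding WhileE_def by (rule exec.Seq[OF 1(1) 2(1)])
  moreover have "Q (\<tau> + (cost e + t)) r' (mem s') (out s')"
    by (rule post[OF 2(3,4)]) (use 2(5) in auto)
  ultimately show "\<exists>t s' r'. exec w k R (WhileE e c) s t s' \<and> (\<forall>x<100. regs s' x = r' x) \<and>
      Q (\<tau> + t) r' (mem s') (out s')"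
    using 2 by blast
qed

end

lemma word_op_Plus: "a + b < 2 ^ w \<Longrightarrow> word_op w Plus a b = a + b"
  by (simp add: take_bit_nat_eq_self word_op.simps)

lemma word_op_Times: "a * b < 2 ^ w \<Longrightarrow> word_op w Times a b = a * b"
  by (simp add: take_bit_nat_eq_self word_op.simps)

lemma word_op_Minus: "b \<le> a \<Longrightarrow> a - b < 2 ^ w \<Longrightarrow> word_op w Minus a b = a - b"
proof -
  assume a: "b \<le> a" "a - b < 2 ^ w"
  then have "a + 2 ^ w - b = (a - b) + 2 ^ w" by simp
  then have "word_op w Minus a b = (a - b + 2 ^ w) mod 2 ^ w" by (simp only: word_op.simps take_bit_eq_mod)
  then show ?thesis using a(2) by simp
qed

lemma word_op_Less: "0 < w \<Longrightarrow> word_op w Less a b = of_bool (a < b)"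
  by (simp add: take_bit_nat_eq_self word_op.simps)

lemma word_op_Equal: "0 < w \<Longrightarrow> word_op w Equal a b = of_bool (a = b)"
  by (simp add: take_bit_nat_eq_self word_op.simps)

lemma take_bit_small: "a < 2 ^ w \<Longrightarrow> take_bit w a = (a::nat)"
  by (simp add: take_bit_nat_eq_self word_op.simps)

lemma take_bit_one: "0 < w \<Longrightarrow> take_bit w (Suc 0) = Suc 0"
  by (cases w) auto

lemmas word_simps = word_op_Plus word_op_Times word_op_Minus word_op_Less word_op_Equal
  take_bit_small take_bit_one

section \<open>Kahn's algorithm over abstract counters and an abstract ready set\<close>

definition keep :: "nat \<Rightarrow> (reg \<Rightarrow> nat) \<Rightarrow> (reg \<Rightarrow> nat) \<Rightarrow> bool" where
  "keep a r r' \<longleftrightarrow> (\<forall>x. a \<le> x \<and> x < 100 \<longrightarrow> r' x = r x)"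

lemma keep_refl [simp]: "keep a r r"
  by (simp add: keep_def)

lemma keep_upd [simp]: "x < a \<Longrightarrow> keep a r (r'(x := y)) \<longleftrightarrow> keep a r r'"
  by (auto simp: keep_def)

lemma keep_trans: "keep a r r' \<Longrightarrow> keep a r' r'' \<Longrightarrow> keep a r r''"
  by (auto simp: keep_def)

lemma keep_upd_left: "x < a \<Longrightarrow> keep a (r(x := y)) r' \<longleftrightarrow> keep a r r'"
  by (auto simp: keep_def)

lemma keep_mono: "keep a r r' \<Longrightarrow> a \<le> b \<Longrightarrow> keep b r r'"
  by (auto simp: keep_def)

lemma keepD: "keep a r r' \<Longrightarrow> a \<le> x \<Longrightarrow> x < 100 \<Longrightarrow> r' x = r x"
  by (auto simp: keep_def)

definition keep_loop :: "(reg \<Rightarrow> nat) \<Rightarrow> (reg \<Rightarrow> nat) \<Rightarrow> bool" where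
  "keep_loop r r' \<longleftrightarrow> (\<forall>x<100. x \<notin> {30, 40, 42} \<longrightarrow> r' x = r x)"

lemma keep_loop_upd [simp]: "keep_loop r r" "x \<in> {30, 40, 42} \<Longrightarrow> keep_loop r (r'(x := y)) \<longleftrightarrow> keep_loop r r'"
  unfolding keep_loop_def by (blast, metis fun_upd_apply)

lemma keep_loopD: "keep_loop r r' \<Longrightarrow> x < 100 \<Longrightarrow> x \<notin> {30, 40, 42} \<Longrightarrow> r' x = r x"
  by (auto simp: keep_loop_def)

definition for_list :: "com \<Rightarrow> com" where
  "for_list c = WhileE (V 42) (InputE 30 (V 42) ;; c ;; InputE 42 (V 42 \<oplus> C 1))"

definition for_edges :: "com \<Rightarrow> com" where
  "for_edges c = (40 \<leftarrow> C 0) ;;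
     WhileE (V 40 \<prec> V 50) (InputE 42 (V 40 \<oplus> C 1) ;; for_list c ;; (40 \<leftarrow> V 40 \<oplus> C 1))"

definition kahn :: "com \<Rightarrow> com \<Rightarrow> com \<Rightarrow> com \<Rightarrow> com \<Rightarrow> com" where
  "kahn INC DEC TEST PUSH POP =
     for_edges INC ;;
     ((40 \<leftarrow> C 0) ;; WhileE (V 40 \<prec> V 50)
       ((30 \<leftarrow> V 40) ;; (TEST ;; IfE (V 31) PUSH Skip) ;; (40 \<leftarrow> V 40 \<oplus> C 1))) ;;
     (90 \<leftarrow> C 0) ;;
     POP ;;
     WhileE (V 31)
       (Output 30 ;; (90 \<leftarrow> V 90 \<oplus> C 1) ;; InputE 42 (V 30 \<oplus> C 1) ;;
        for_list (DEC ;; TEST ;; IfE (V 31) PUSH Skip) ;; POP) ;;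
     (0 \<leftarrow> V 90 \<prec> V 50)"

locale graph_input = ram +
  fixes n :: nat and E :: "(nat \<times> nat) set"
  assumes digraph: "digraph_on n E"
    and adjacency: "adjacency_list n E R"
    and length_R: "length R \<le> 2 ^ w"
begin

lemma finite_E: "finite E"
  using digraph finite_subset unfolding digraph_on_def by blast

lemma E_bound: "(u, v) \<in> E \<Longrightarrow> u < n \<and> v < n"
  using digraph unfolding digraph_on_def by auto

definition adj :: "nat \<Rightarrow> nat list" where
  "adj v = (SOME xs. linked_list R (R ! Suc v) xs \<and> distinct xs \<and> set xs = {u. (v, u) \<in> E})"

lemma adj:
  assumes "v < n"
  shows "linked_list R (R ! Suc v) (adj v)" "distinct (adj v)" "set (adj v) = {u. (v, u) \<in> E}"
proof -
  have "\<exists>xs. linked_list R (R ! Suc v) xs \<and> distinct xs \<and> set xs = {u. (v, u) \<in> E}"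
    using adjacency assms unfolding adjacency_list_def by blast
  from someI_ex[OF this]
  show "linked_list R (R ! Suc v) (adj v)" "distinct (adj v)" "set (adj v) = {u. (v, u) \<in> E}"
    unfolding adj_def by auto
qed

lemma count_list_distinct: "distinct xs \<Longrightarrow> count_list xs v = of_bool (v \<in> set xs)"
  by (induction xs) auto

definition targets :: "nat \<Rightarrow> nat list" where
  "targets v = concat (map adj [0..<v])"

lemma targets_Suc: "targets (Suc v) = targets v @ adj v"
  by (simp add: targets_def)

definition indeg :: "nat \<Rightarrow> nat" where
  "indeg v = card {u. (u, v) \<in> E}"

lemma count_targets: "i \<le> n \<Longrightarrow> count_list (targets i) v = card {u. u < i \<and> (u, v) \<in> E}"
proof (induction i)
  case 0
  then show ?case by (simp add: targets_def)
next
  case (Suc i)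
  have c: "count_list (adj i) v = of_bool ((i, v) \<in> E)"
    using adj(2,3)[of i] Suc.prems by (simp add: count_list_distinct)
  have "{u. u < Suc i \<and> (u, v) \<in> E} = (if (i, v) \<in> E then insert i {u. u < i \<and> (u, v) \<in> E}
      else {u. u < i \<and> (u, v) \<in> E})"
    by (auto simp: less_Suc_eq)
  then show ?case using Suc c by (simp add: targets_Suc)
qed

lemma count_targets_n: "count_list (targets n) v = indeg v"
proof -
  have "{u. u < n \<and> (u, v) \<in> E} = {u. (u, v) \<in> E}" using E_bound by auto
  then show ?thesis using count_targets[of n v] by (simp add: indeg_def)
qed

lemma length_targets: "length (targets n) = card E"
proof -
  have "length (targets i) = card {(u, v) \<in> E. u < i}" if "i \<le> n" for i
    using that
  proof (induction i)
    case 0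
    then show ?case by (simp add: targets_def)
  next
    case (Suc i)
    have "{(u, v) \<in> E. u < Suc i} = {(u, v) \<in> E. u < i} \<union> Pair i ` {v. (i, v) \<in> E}"
      by (auto simp: less_Suc_eq)
    moreover have "card (\<dots>) = card {(u, v) \<in> E. u < i} + card (Pair i ` {v. (i, v) \<in> E})"
      by (intro card_Un_disjoint finite_subset[OF _ finite_E]) auto
    moreover have "card (Pair i ` {v. (i, v) \<in> E}) = length (adj i)"
      using adj[of i] Suc.prems by (metis Suc_le_lessD card_image distinct_card inj_on_def prod.inject)
    ultimately show ?case using Suc by (simp add: targets_Suc)
  qed
  from this[of n] show ?thesis using E_bound by (auto intro!: arg_cong[where f = card])
qed

lemma size_bound: "Suc (n + 2 * card E) \<le> 2 ^ w"
  using adjacency length_R by (simp add: adjacency_list_def)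

lemma len_R: "length R = Suc (n + 2 * card E)"
  using adjacency by (simp add: adjacency_list_def)

lemma wp_for_list:
  assumes xs: "linked_list R (r 42) xs" and w: "0 < w"
    and P: "P [] r m o'"
    and cong: "\<And>ys r r' m o'. P ys r m o' \<Longrightarrow> keep_loop r r' \<Longrightarrow> P ys r' m o'"
    and body: "\<And>ys v zs r m o' \<tau>. xs = ys @ v # zs \<Longrightarrow> P ys r m o' \<Longrightarrow> r 30 = v \<Longrightarrow>
      wp c (\<lambda>\<tau>' r' m' o'. \<tau>' \<le> \<tau> + T \<and> r' 42 = r 42 \<and> r' 40 = r 40 \<and> P (ys @ [v]) r' m' o') \<tau> r m o'"
    and post: "\<And>\<tau>' r' m' o'. P xs r' m' o' \<Longrightarrow> \<tau>' \<le> \<tau> + length xs * (T + 8) + 2 \<Longrightarrow> r' 40 = r 40 \<Longrightarrow>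
      Q \<tau>' r' m' o'"
  shows "wp (for_list c) Q \<tau> r m o'"
  unfolding for_list_def
proof (rule wp_while[where I = "\<lambda>p r' m o'. \<exists>ys zs. xs = ys @ zs \<and> linked_list R (r' 42) zs \<and> P ys r' m o' \<and>
    r' 40 = r 40 \<and> p = length zs * (T + 8)" and p = "length xs * (T + 8)"], goal_cases)
  case 1
  show ?case by simp
next
  case 2
  show ?case using xs P by auto
next
  case (3 p r1 m1 o1 \<tau>1)
  then obtain ys zs where *: "xs = ys @ zs" "linked_list R (r1 42) zs" "P ys r1 m1 o1"
    "p = length zs * (T + 8)" "r1 40 = r 40" "r1 42 \<noteq> 0"
    by auto
  then obtain v zs' where zs: "zs = v # zs'" by (cases zs) auto
  have l: "Suc (r1 42) < length R" "R ! r1 42 = v" "linked_list R (R ! Suc (r1 42)) zs'"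
    using * zs by auto
  show ?case
    apply (rule wp_seq, rule wp_input)
    subgoal by simp
    subgoal using l by simp
    apply (rule wp_seq)
    apply (rule wp_conseq[OF body[where ys = ys and v = v and zs = zs']])
    subgoal using * zs by simp
    subgoal using * by (intro cong[OF *(3)]) simp
    subgoal using l by simp
    apply (rule wp_input)
    subgoal by simp
    subgoal using l length_R w by (auto simp: take_bit_small take_bit_one word_op_Plus)
    subgoal for \<tau>2 r2 m2 o2
      apply (rule exI[of _ "length zs' * (T + 8)"], rule conjI, rule exI[of _ "ys @ [v]"], rule exI[of _ zs'])
      using l length_R w * zs
      by (auto simp: take_bit_small take_bit_one word_op_Plus intro: cong)
    done
next
  case (4 p r1 m1 o1 \<tau>1)
  then obtain ys zs where *: "xs = ys @ zs" "linked_list R (r1 42) zs" "P ys r1 m1 o1"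
    "r1 42 = 0" "r1 40 = r 40" by auto
  then have "zs = []" by (cases zs) auto
  then show ?case using * 4 by (intro post) auto
qed

lemma wp_for_edges:
  assumes n: "r 50 = n" and w: "0 < w"
    and P: "P [] r m o'"
    and cong: "\<And>ys r r' m o'. P ys r m o' \<Longrightarrow> keep_loop r r' \<Longrightarrow> P ys r' m o'"
    and body: "\<And>ys v zs r m o' \<tau>. targets n = ys @ v # zs \<Longrightarrow> P ys r m o' \<Longrightarrow> r 30 = v \<Longrightarrow> r 50 = n \<Longrightarrow>
      wp c (\<lambda>\<tau>' r' m' o'. \<tau>' \<le> \<tau> + T \<and> r' 42 = r 42 \<and> r' 40 = r 40 \<and> r' 50 = n \<and> P (ys @ [v]) r' m' o') \<tau> r m o'"
    and post: "\<And>\<tau>' r' m' o'. P (targets n) r' m' o' \<Longrightarrow> r' 50 = n \<Longrightarrow>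
      \<tau>' \<le> \<tau> + (card E * (T + 8) + n * 14 + 6) \<Longrightarrow> Q \<tau>' r' m' o'"
  shows "wp (for_edges c) Q \<tau> r m o'"
  unfolding for_edges_def
proof (rule wp_seq, rule wp_assign, goal_cases)
  case 1
  show ?case by simp
next
  case 2
  define pot where "pot i = (\<Sum>v\<in>{i..<n}. length (adj v) * (T + 8) + 14)" for i
  have pot0: "pot 0 = card E * (T + 8) + n * 14"
    unfolding pot_def length_targets[symmetric] targets_def
    by (simp add: sum.distrib length_concat comp_def sum_list_distinct_conv_sum_set sum_distrib_right
        atLeast0LessThan[symmetric])
  have potS: "pot i = length (adj i) * (T + 8) + 14 + pot (Suc i)" if "i < n" for i
    unfolding pot_def using that by (simp add: sum.atLeast_Suc_lessThan)
  have nw: "n < 2 ^ w" using size_bound by simp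
  show ?case
  proof (rule wp_while[where I = "\<lambda>p r m o'. r 40 \<le> n \<and> r 50 = n \<and> P (targets (r 40)) r m o' \<and> p = pot (r 40)"
      and p = "pot 0"], goal_cases)
    case 1
    show ?case by simp
  next
    case 2
    show ?case using n cong[OF P] by (auto simp: targets_def)
  next
    case (3 p r1 m1 o1 \<tau>1)
    then have *: "r1 40 < n" "r1 50 = n" "P (targets (r1 40)) r1 m1 o1" "p = pot (r1 40)"
      using w by (auto simp: word_op_Less)
    have split: "targets n = targets (r1 40) @ adj (r1 40) @ concat (map adj [Suc (r1 40)..<n])"
    proof -
      have "[0..<n] = [0..<Suc (r1 40)] @ [Suc (r1 40)..<n]"
        using *(1) upt_add_eq_append[of 0 "Suc (r1 40)" "n - Suc (r1 40)"] by simp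
      then show ?thesis by (simp add: targets_def)
    qed
    have e: "ev r1 (V 40 \<oplus> C 1) = Suc (r1 40)"
      using * nw w by (simp add: take_bit_small take_bit_one word_op_Plus)
    show ?case
      apply (rule wp_seq, rule wp_input)
      subgoal by simp
      subgoal using e *(1) len_R by simp
      apply (rule wp_seq)
      apply (rule wp_for_list[where xs = "adj (r1 40)" and T = T
          and P = "\<lambda>ys r m o'. r 50 = n \<and> P (targets (r1 40) @ ys) r m o'"])
      subgoal using e adj(1)[OF *(1)] by simp
      subgoal using w by simp
      subgoal using * by (auto intro: cong)
      subgoal for ys r r' m o' by (auto intro: cong simp: keep_loopD)
      subgoal for ys v zs r2 m2 o2 \<tau>2
        apply (rule wp_conseq[OF body[where ys = "targets (r1 40) @ ys" and zs = "zs @ concat (map adj [Suc (r1 40)..<n])"]])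
        using split by auto
      apply (rule wp_assign)
      subgoal by simp
      subgoal for \<tau>2 r2 m2 o2
        using * nw w potS[of "r1 40"]
        by (auto simp: take_bit_small take_bit_one word_op_Plus targets_Suc intro: cong)
      done
  next
    case (4 p r1 m1 o1 \<tau>1)
    then have *: "r1 40 = n" "r1 50 = n" "P (targets (r1 40)) r1 m1 o1"
      using w by (auto simp: word_op_Less)
    then show ?case using 4(3) pot0 by (intro post) auto
  qed
qed

definition rem :: "nat set \<Rightarrow> nat \<Rightarrow> nat" where
  "rem D v = card {u. (u, v) \<in> E \<and> u \<notin> D}"

lemma finite_pred: "finite {u. (u, v) \<in> E \<and> Q u}"
  by (rule finite_subset[of _ "{..<n}"]) (use E_bound in auto)

lemma rem_insert: "v \<notin> D \<Longrightarrow> rem D x = rem (insert v D) x + of_bool ((v, x) \<in> E)"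
proof -
  assume v: "v \<notin> D"
  have "{u. (u, x) \<in> E \<and> u \<notin> D} = (if (v, x) \<in> E then insert v {u. (u, x) \<in> E \<and> u \<notin> insert v D}
      else {u. (u, x) \<in> E \<and> u \<notin> insert v D})" using v by auto
  then show ?thesis unfolding rem_def by (auto simp: finite_pred)
qed

lemma rem_eq_0: "rem D v = 0 \<longleftrightarrow> (\<forall>u. (u, v) \<in> E \<longrightarrow> u \<in> D)"
  unfolding rem_def by (auto simp: finite_pred)

lemma rem_empty: "rem {} v = indeg v"
  by (simp add: rem_def indeg_def)

definition closed_order :: "nat list \<Rightarrow> bool" where
  "closed_order xs \<longleftrightarrow> (\<forall>i<length xs. \<forall>u. (u, xs ! i) \<in> E \<longrightarrow> u \<in> set (take i xs))"

lemma closed_order_snoc: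
  assumes "closed_order xs" "rem (set xs) v = 0"
  shows "closed_order (xs @ [v])"
  using assms unfolding closed_order_def rem_eq_0 by (auto simp: nth_append less_Suc_eq)

lemma closed_order_less:
  assumes "closed_order xs" "distinct xs" "(xs ! i, xs ! j) \<in> E" "i < length xs" "j < length xs"
  shows "i < j"
proof -
  have "xs ! i \<in> set (take j xs)" using assms unfolding closed_order_def by blast
  then obtain k where "k < j" "xs ! k = xs ! i" "k < length xs" by (auto simp: in_set_conv_nth)
  then show ?thesis using assms by (auto simp: nth_eq_iff_index_eq)
qed

lemma closed_order_topological:
  assumes "closed_order xs" "distinct xs" "set xs = {..<n}"
  shows "topological_ordering n E xs" "acyclic E"
proof -
  show "topological_ordering n E xs"
    using assms closed_order_less unfolding topological_ordering_def by blast
  have *: "(x, y) \<in> E\<^sup>+ \<Longrightarrow> j < length xs \<Longrightarrow> i < length xs \<Longrightarrow> x = xs ! i \<Longrightarrow> y = xs ! j \<Longrightarrow> i < j" for x y i j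
  proof (induction y arbitrary: j rule: trancl_induct)
    case (base y)
    then show ?case using closed_order_less[OF assms(1,2)] by blast
  next
    case (step y z)
    then obtain l where "l < length xs" "y = xs ! l"
      using E_bound[of y z] assms(3) by (metis in_set_conv_nth lessThan_iff)
    then show ?case using step closed_order_less[OF assms(1,2), of l j] by fastforce
  qed
  show "acyclic E"
  proof (rule acyclicI, intro allI notI)
    fix x assume x: "(x, x) \<in> E\<^sup>+"
    then have "x < n" using E_bound by (meson tranclE)
    then obtain i where "i < length xs" "x = xs ! i" using assms(3) by (metis in_set_conv_nth lessThan_iff)
    then show False using *[of x x i i] x by simp
  qed
qed

lemma exhausted:
  assumes "acyclic E" "set xs \<subseteq> {..<n}" "\<And>v. v < n \<Longrightarrow> v \<notin> set xs \<Longrightarrow> rem (set xs) v \<noteq> 0"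
  shows "set xs = {..<n}"
proof (rule ccontr)
  assume "set xs \<noteq> {..<n}"
  then obtain v0 where v0: "v0 \<in> {..<n} - set xs" using assms(2) by auto
  have "wf E" using finite_acyclic_wf finite_E assms(1) by blast
  then obtain z where "z \<in> {..<n} - set xs" "\<And>y. (y, z) \<in> E \<Longrightarrow> y \<notin> {..<n} - set xs"
    using wfE_min[OF _ v0] by metis
  then show False using assms(3)[of z] E_bound unfolding rem_eq_0 by auto
qed

end

text \<open>
  \<open>rep r m c A D\<close>: the counters are \<open>c\<close>, the ready set is \<open>A\<close>, and the vertices in \<open>D\<close> have been
  removed from the ready set. A counter is only incremented up to the in-degree of its vertex, since
  that is the space it can rely on.
\<close>

locale kahn_ops = graph_input +
  fixes INC DEC TEST PUSH POP :: com and T :: nat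
    and rep :: "(reg \<Rightarrow> nat) \<Rightarrow> (nat \<Rightarrow> nat) \<Rightarrow> (nat \<Rightarrow> nat) \<Rightarrow> nat set \<Rightarrow> nat set \<Rightarrow> bool"
  assumes pos_w: "0 < w"
    and rep_cong: "rep r m c A D \<Longrightarrow> (\<And>x. x = 32 \<or> 50 \<le> x \<and> x < 90 \<Longrightarrow> r' x = r x) \<Longrightarrow> rep r' m c A D"
    and INC: "rep r m c {} {} \<Longrightarrow> r 30 < n \<Longrightarrow> c (r 30) < indeg (r 30) \<Longrightarrow>
      wp INC (\<lambda>\<tau>' r' m' o'. \<tau>' \<le> \<tau> + T \<and> keep 40 r r' \<and> o' = out0 \<and>
        rep r' m' (c(r 30 := Suc (c (r 30)))) {} {}) \<tau> r m out0"
    and DEC: "rep r m c A D \<Longrightarrow> r 30 < n \<Longrightarrow> 0 < c (r 30) \<Longrightarrow> r 30 \<notin> A \<Longrightarrow> r 30 \<notin> D \<Longrightarrow>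
      wp DEC (\<lambda>\<tau>' r' m' o'. \<tau>' \<le> \<tau> + T \<and> keep 40 r r' \<and> r' 30 = r 30 \<and> o' = out0 \<and>
        rep r' m' (c(r 30 := c (r 30) - 1)) A D) \<tau> r m out0"
    and TEST: "rep r m c A D \<Longrightarrow> r 30 < n \<Longrightarrow> r 30 \<notin> A \<Longrightarrow> r 30 \<notin> D \<Longrightarrow>
      wp TEST (\<lambda>\<tau>' r' m' o'. \<tau>' \<le> \<tau> + T \<and> keep 40 r r' \<and> r' 30 = r 30 \<and> o' = out0 \<and>
        (r' 31 \<noteq> 0 \<longleftrightarrow> c (r 30) = 0) \<and> rep r' m' c A D) \<tau> r m out0"
    and PUSH: "rep r m c A D \<Longrightarrow> r 30 < n \<Longrightarrow> c (r 30) = 0 \<Longrightarrow> r 30 \<notin> A \<Longrightarrow> r 30 \<notin> D \<Longrightarrow>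
      wp PUSH (\<lambda>\<tau>' r' m' o'. \<tau>' \<le> \<tau> + T \<and> keep 40 r r' \<and> o' = out0 \<and>
        rep r' m' c (insert (r 30) A) D) \<tau> r m out0"
    and POP: "rep r m c A D \<Longrightarrow> A = {v. v < n \<and> v \<notin> D \<and> c v = 0} \<Longrightarrow>
      wp POP (\<lambda>\<tau>' r' m' o'. \<tau>' \<le> \<tau> + T \<and> keep 40 r r' \<and> o' = out0 \<and>
        (if r' 31 = 0 then A = {} else r' 30 \<in> A \<and> rep r' m' c (A - {r' 30}) (insert (r' 30) D))) \<tau> r m out0"
begin

lemma rep_keep: "rep r m c A D \<Longrightarrow> keep_loop r r' \<Longrightarrow> rep r' m c A D"
  by (erule rep_cong) (auto simp: keep_loop_def)

lemma n_word: "n < 2 ^ w"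
  using size_bound by simp

lemma test_push:
  assumes "rep r m c A D" "r 30 < n" "r 30 \<notin> A" "r 30 \<notin> D"
  shows "wp (TEST ;; IfE (V 31) PUSH Skip) (\<lambda>\<tau>' r' m' o'. \<tau>' \<le> \<tau> + (2 * T + 3) \<and> keep 40 r r' \<and> o' = out0 \<and>
     rep r' m' c (if c (r 30) = 0 then insert (r 30) A else A) D) \<tau> r m out0"
  apply (rule wp_seq, rule wp_conseq, rule TEST[OF assms])
  apply (rule wp_if)
  subgoal by simp
  subgoal for \<tau>1 r1 m1 o1
    apply (rule wp_conseq, rule PUSH[where A = A and D = D and c = c])
    using assms by (auto intro: keep_trans)
  subgoal by (auto intro: wp_skip)
  done

lemma wp_inc_all:
  assumes r: "rep r m (\<lambda>_. 0) {} {}" and n: "r 50 = n"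
    and post: "\<And>\<tau>' r' m'. rep r' m' indeg {} {} \<Longrightarrow> r' 50 = n \<Longrightarrow>
       \<tau>' \<le> \<tau> + (card E * (T + 8) + n * 14 + 6) \<Longrightarrow> Q \<tau>' r' m' out0"
  shows "wp (for_edges INC) Q \<tau> r m out0"
proof (rule wp_for_edges[where T = T and P = "\<lambda>ys r m o'. rep r m (count_list ys) {} {} \<and> o' = out0"],
    rule n, rule pos_w, goal_cases)
  case 1
  then show ?case using r by (simp add: count_list.simps(1)[abs_def])
next
  case (2 ys r r' m o')
  then show ?case using rep_keep by blast
next
  case (3 ys v zs r1 m1 o1 \<tau>1)
  have v: "v \<in> set (targets n)" using 3(1) by simp
  then have vn: "v < n" using adj(3) E_bound by (auto simp: targets_def)
  have c: "count_list ys v < indeg v" using 3(1) count_targets_n[of v] by simp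
  have e: "count_list (ys @ [v]) = (count_list ys)(v := Suc (count_list ys v))" by auto
  show ?case
    apply (rule wp_conseq, rule INC[of r1 m1 "count_list ys"])
    using 3 vn c e by (auto simp: keepD)
next
  case (4 \<tau>1 r1 m1 o1)
  then show ?case by (auto intro!: post simp: count_targets_n[abs_def])
qed

lemma wp_init:
  assumes r: "rep r m c {} {}" and n: "r 50 = n"
    and post: "\<And>\<tau>' r' m'. rep r' m' c {v. v < n \<and> c v = 0} {} \<Longrightarrow> r' 50 = n \<Longrightarrow>
       \<tau>' \<le> \<tau> + (n * (2 * T + 13) + 6) \<Longrightarrow> Q \<tau>' r' m' out0"
  shows "wp ((40 \<leftarrow> C 0) ;; WhileE (V 40 \<prec> V 50)
     ((30 \<leftarrow> V 40) ;; (TEST ;; IfE (V 31) PUSH Skip) ;; (40 \<leftarrow> V 40 \<oplus> C 1))) Q \<tau> r m out0"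
  apply (rule wp_seq, rule wp_assign)
  subgoal by simp
  apply (rule wp_while[where I = "\<lambda>p r m o'. r 40 \<le> n \<and> r 50 = n \<and> o' = out0 \<and>
    rep r m c {v. v < r 40 \<and> c v = 0} {} \<and> p = (n - r 40) * (2 * T + 13)" and p = "n * (2 * T + 13)"])
  subgoal by simp
  subgoal using n by (auto intro: rep_keep[OF r])
  subgoal for p r1 m1 o1 \<tau>1
    apply (rule wp_seq, rule wp_assign)
    subgoal by simp
    apply (rule wp_seq, rule wp_conseq, rule test_push[where A = "{v. v < r1 40 \<and> c v = 0}" and c = c and D = "{}"])
    subgoal by (auto intro: rep_keep)
    subgoal using pos_w by (auto simp: word_op_Less)
    subgoal by simp
    subgoal by simp
    apply (rule wp_assign)
    subgoal by simp
    subgoal for \<tau>2 r2 m2 o2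
    proof goal_cases
      case 1
      have lt: "r1 40 < n" using 1 pos_w by (auto simp: word_op_Less)
      have k: "r2 40 = r1 40" "r2 50 = n" using 1 by (auto simp: keepD keep_upd_left)
      have e: "ev r2 (V 40 \<oplus> C 1) = Suc (r1 40)"
        using k lt n_word pos_w by (simp add: take_bit_small take_bit_one word_op_Plus)
      have A: "{v. v < Suc (r1 40) \<and> c v = 0} = (if c (r1 40) = 0 then insert (r1 40) {v. v < r1 40 \<and> c v = 0}
         else {v. v < r1 40 \<and> c v = 0})" by (auto simp: less_Suc_eq)
      have d: "n - r1 40 = Suc (n - Suc (r1 40))" using lt by simp
      have rep: "rep (r2(40 := Suc (r1 40))) m2 c {v. v < Suc (r1 40) \<and> c v = 0} {}"
      proof -
        have "rep r2 m2 c (if c (r1 40) = 0 then insert (r1 40) {v. v < r1 40 \<and> c v = 0}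
         else {v. v < r1 40 \<and> c v = 0}) {}" using 1 by auto
        then show ?thesis unfolding A by (rule rep_keep) simp
      qed
      show ?case
        unfolding e using 1 k rep lt d
        by (intro exI[of _ "(n - Suc (r1 40)) * (2 * T + 13)"]) auto
    qed
    done
  subgoal for p r1 m1 o1 \<tau>1
  proof goal_cases
    case 1
    then have "r1 40 = n" using pos_w by (auto simp: word_op_Less)
    then have "Q \<tau>1 r1 m1 out0" using 1 by (intro post) auto
    then show ?case using 1 by auto
  qed
  done

lemma wp_main:
  assumes r: "rep r m indeg {v. v < n \<and> indeg v = 0} {}" and n: "r 50 = n"
  shows "wp ((90 \<leftarrow> C 0) ;; POP ;;
     WhileE (V 31)
       (Output 30 ;; (90 \<leftarrow> V 90 \<oplus> C 1) ;; InputE 42 (V 30 \<oplus> C 1) ;;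
        for_list (DEC ;; TEST ;; IfE (V 31) PUSH Skip) ;; POP) ;;
     (0 \<leftarrow> V 90 \<prec> V 50)) (\<lambda>\<tau>' r' m' o'. \<tau>' \<le> \<tau> + (n * (T + 13) + card E * (3 * T + 11) + T + 8) \<and>
        (acyclic E \<longrightarrow> r' 0 = 0 \<and> topological_ordering n E o') \<and> (\<not> acyclic E \<longrightarrow> r' 0 \<noteq> 0)) \<tau> r m []"
proof -
  define pot where "pot D = (\<Sum>v\<in>{..<n} - D. T + 13 + length (adj v) * (3 * T + 11))" for D
  define ready where "ready D = {v. v < n \<and> v \<notin> D \<and> rem D v = 0}" for D
  define I where "I p r m o' \<longleftrightarrow> r 50 = n \<and> r 90 = length o' \<and> distinct o' \<and> set o' \<subseteq> {..<n} \<and>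
    closed_order o' \<and> p = pot (set o') \<and>
    (if r 31 = 0 then ready (set o') = {} else
     \<exists>c. (\<forall>v<n. c v = rem (set o') v) \<and> r 30 \<in> ready (set o') \<and>
       rep r m c (ready (set o') - {r 30}) (insert (r 30) (set o')))" for p r m o'
  have pot0: "pot {} = n * (T + 13) + card E * (3 * T + 11)"
    unfolding pot_def length_targets[symmetric] targets_def
    by (simp add: sum.distrib length_concat comp_def sum_list_distinct_conv_sum_set sum_distrib_right
        atLeast0LessThan[symmetric])
  have potS: "pot D = T + 13 + length (adj v) * (3 * T + 11) + pot (insert v D)" if "v < n" "v \<notin> D" for v D
  proof -
    have e: "{..<n} - D = insert v ({..<n} - insert v D)" using that by auto
    show ?thesis unfolding pot_def e by (subst sum.insert) auto
  qed
  have pop: "wp POP (\<lambda>\<tau>' r' m' o'. \<tau>' \<le> \<tau> + T \<and> I (pot (set o')) r' m' o' \<and> o' = out0) \<tau> r m out0"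
    if "rep r m c (ready (set out0)) (set out0)" "\<forall>v<n. c v = rem (set out0) v" "r 50 = n" "r 90 = length out0"
      "distinct out0" "set out0 \<subseteq> {..<n}" "closed_order out0" for r m c out0 \<tau>
    apply (rule wp_conseq, rule POP, rule that(1))
    using that apply (force simp: ready_def)
    using that unfolding I_def by (auto simp: keepD split: if_splits)
  show ?thesis
    apply (rule wp_seq, rule wp_assign)
    subgoal by simp
    apply (rule wp_seq, rule wp_conseq, rule pop[where c = indeg])
    subgoal using r by (auto simp: ready_def rem_empty intro: rep_cong)
    subgoal by (simp add: rem_empty)
    subgoal using n by simp
    subgoal by simp
    subgoal by simp
    subgoal by simp
    subgoal by (simp add: closed_order_def)
    apply (rule wp_seq)
    subgoal for \<tau>1 r1 m1 o1
    proof (rule wp_while[where I = I and p = "pot {}"], goal_cases)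
      case 1
      show ?case by simp
    next
      case 2
      then show ?case by (metis list.set(1))
    next
      case (3 p r2 m2 o2 \<tau>2)
      define v where "v = r2 30"
      obtain c where I: "r2 50 = n" "r2 90 = length o2" "distinct o2" "set o2 \<subseteq> {..<n}"
        "closed_order o2" "p = pot (set o2)" "\<forall>x<n. c x = rem (set o2) x" "v \<in> ready (set o2)"
        "rep r2 m2 c (ready (set o2) - {v}) (insert v (set o2))"
        using 3 unfolding I_def v_def by auto
      let ?D = "insert v (set o2)"
      have v: "v < n" "v \<notin> set o2" "rem (set o2) v = 0" using I(8) by (auto simp: ready_def)
      have len: "Suc (length o2) \<le> n"
        using card_mono[of "{..<n}" ?D] I(3,4) v by (auto simp: distinct_card)
      have e1: "ev r2 (V 90 \<oplus> C 1) = Suc (length o2)"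
        using I(2) len n_word pos_w by (simp add: take_bit_small take_bit_one word_op_Plus)
      have e2: "ev (r2(90 := x)) (V 30 \<oplus> C 1) = Suc v" for x
        using v n_word pos_w by (simp add: take_bit_small take_bit_one word_op_Plus v_def)
      have co: "closed_order (o2 @ [v])" using closed_order_snoc I(5) v(3) by blast
      have pre_D: "u \<in> ?D" if "(u, x) \<in> E" "x \<in> ?D" for u x
      proof (cases "x = v")
        case True
        then show ?thesis using that v(3) by (auto simp: rem_eq_0)
      next
        case False
        then have "x \<in> set o2" using that by simp
        then obtain i where "i < length o2" "x = o2 ! i" by (auto simp: in_set_conv_nth)
        then show ?thesis using I(5) that unfolding closed_order_def by (meson in_set_takeD insertCI)
      qed
      define cnt where "cnt c ys \<longleftrightarrow> (\<forall>x<n. c x = rem ?D x + of_bool (x \<in> set (adj v) - set ys))"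
        for c ys
      define new where "new c = {x. x < n \<and> x \<notin> ?D \<and> c x = 0}" for c :: "nat \<Rightarrow> nat"
      define P where "P ys r m o' \<longleftrightarrow> o' = o2 @ [v] \<and> r 50 = n \<and> r 90 = Suc (length o2) \<and>
        (\<exists>c. cnt c ys \<and> rep r m c (new c) ?D)" for ys r m o'
      show ?case
        apply (rule wp_seq, rule wp_output, simp)
        apply (rule wp_seq, rule wp_assign, simp)
        apply (rule wp_seq, rule wp_input, simp)
        subgoal unfolding e2 using v len_R by simp
        unfolding e1 e2
        apply (rule wp_seq)
        apply (rule wp_for_list[where xs = "adj v" and T = "3 * T + 3" and P = P])
        subgoal using adj(1)[OF v(1)] by simp
        subgoal by (rule pos_w)
        subgoal
        proof -
          have c: "cnt c []"
            using I(7) adj(3)[OF v(1)] rem_insert[OF v(2)] by (simp add: cnt_def)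
          have A: "ready (set o2) - {v} = new c"
            using I(7) by (auto simp: ready_def new_def)
          have "rep (r2(90 := Suc (length o2), 42 := R ! Suc v)) m2 c (new c) ?D"
            by (rule rep_cong[OF I(9)[unfolded A]]) auto
          then show ?thesis unfolding P_def using c I(1) v_def by auto
        qed
        subgoal for ys r r' m o' unfolding P_def using rep_keep by (auto simp: keep_loopD)
        subgoal for ys x zs r3 m3 o3 \<tau>3
        proof goal_cases
          case 1
          then obtain c where P: "o3 = o2 @ [v]" "r3 50 = n" "r3 90 = Suc (length o2)"
            "cnt c ys" "rep r3 m3 c (new c) ?D"
            unfolding P_def by blast
          have x: "x < n" "x \<notin> set ys" "(v, x) \<in> E"
            using 1(1) adj[OF v(1)] E_bound[of v x] by auto
          have xD: "x \<notin> ?D" using pre_D[OF x(3)] v x(3) rem_eq_0[of "set o2" v] closed_order_less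
            using I(5) unfolding closed_order_def
            by (metis in_set_conv_nth in_set_takeD insertE)
          have cx: "c x = Suc (rem ?D x)" using P(4) x 1(1) by (auto simp: cnt_def)
          let ?c = "c(x := c x - 1)"
          have c': "cnt ?c (ys @ [x])"
            using P(4) cx by (auto simp: cnt_def)
          have A: "new ?c = (if ?c x = 0 then insert x (new c) else new c)"
            using x xD cx by (auto simp: new_def)
          have xn: "x \<notin> new c" using cx by (simp add: new_def)
          have r3: "r3 30 = x" using 1 by simp
          show ?case
            apply (rule wp_seq, rule wp_conseq, rule DEC[OF P(5)])
            subgoal using x r3 by simp
            subgoal using cx r3 by simp
            subgoal using xn r3 by simp
            subgoal using xD r3 by simp
            apply (rule wp_conseq, rule test_push[where c = ?c and A = "new c" and D = ?D])
            subgoal using r3 by auto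
            subgoal using x r3 by simp
            subgoal using xn r3 by simp
            subgoal using xD r3 by simp
            subgoal for \<tau>4 r4 m4 o4 \<tau>5 r5 m5 o5
            proof goal_cases
              case 1
              have "rep r5 m5 ?c (new ?c) ?D" unfolding A using 1 r3 by (auto split: if_splits)
              then show ?case unfolding P_def using 1 P c' by (auto simp: keepD)
            qed
            done
        qed
        subgoal for \<tau>3 r3 m3 o3
        proof goal_cases
          case 1
          then obtain c where P: "o3 = o2 @ [v]" "r3 50 = n" "r3 90 = Suc (length o2)"
            "\<And>x. x < n \<Longrightarrow> c x = rem ?D x" "rep r3 m3 c (new c) ?D"
            unfolding P_def cnt_def by auto
          have S: "set (o2 @ [v]) = ?D" by auto
          have A: "new c = ready ?D" using P(4) by (auto simp: ready_def new_def)
          show ?case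
            apply (rule wp_conseq, rule pop[where c = c])
            unfolding P(1) S
            using P I v co 1 potS[OF v(1,2)]
            by (auto simp: A S[simplified] algebra_simps intro!: exI[of _ "pot ?D"])
        qed
        done
    next
      case (4 p r2 m2 o2 \<tau>2)
      have I: "r2 50 = n" "r2 90 = length o2" "distinct o2" "set o2 \<subseteq> {..<n}"
        "closed_order o2" "ready (set o2) = {}"
        using 4 unfolding I_def by auto
      have le: "length o2 \<le> n" using card_mono[of "{..<n}" "set o2"] I(3,4) by (simp add: distinct_card)
      have full: "set o2 = {..<n} \<longleftrightarrow> \<not> length o2 < n"
        using I(3,4) le card_subset_eq[of "{..<n}" "set o2"] distinct_card[of o2] by (metis card_lessThan finite_lessThan le_neq_implies_less less_irrefl)
      have ac: "set o2 = {..<n}" if "acyclic E"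
        using exhausted[OF that I(4)] I(6) by (auto simp: ready_def)
      show ?case
        apply (rule wp_assign)
        subgoal by simp
        subgoal
        proof -
          have e: "ev r2 (V 90 \<prec> V 50) = of_bool (length o2 < n)"
            using I(1,2) pos_w by (simp add: word_op_Less)
          have "acyclic E \<longrightarrow> \<not> length o2 < n \<and> topological_ordering n E o2"
            using ac full closed_order_topological(1)[OF I(5,3)] by blast
          moreover have "\<not> acyclic E \<longrightarrow> length o2 < n"
            using full closed_order_topological(2)[OF I(5,3)] by blast
          moreover have "\<tau>2 + (cost (V 90 \<prec> V 50) + 1) \<le> \<tau> + (n * (T + 13) + card E * (3 * T + 11) + T + 8)"
            using 4 by (simp add: pot0)
          ultimately show ?thesis unfolding e by simp
        qed
        done
    qed
    done
qed

theorem wp_kahn: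
  assumes r: "rep r m (\<lambda>_. 0) {} {}" and n: "r 50 = n"
  shows "wp (kahn INC DEC TEST PUSH POP) (\<lambda>\<tau>' r' m' o'. \<tau>' \<le> \<tau> + (4 * T + 60) * (n + card E + 1) \<and>
        (acyclic E \<longrightarrow> r' 0 = 0 \<and> topological_ordering n E o') \<and> (\<not> acyclic E \<longrightarrow> r' 0 \<noteq> 0)) \<tau> r m []"
  unfolding kahn_def
  apply (rule wp_seq, rule wp_inc_all[OF r n])
  apply (rule wp_seq, rule wp_init, assumption, assumption)
  apply (rule wp_conseq, rule wp_main, assumption, assumption)
  by (auto simp: algebra_simps)

end

section \<open>One word per vertex\<close>

definition naive_inc :: com where
  "naive_inc = LoadE 5 (V 30) ;; StoreE (V 30) (V 5 \<oplus> C 1)"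

definition naive_dec :: com where
  "naive_dec = LoadE 5 (V 30) ;; StoreE (V 30) (V 5 \<ominus> C 1)"

definition naive_test :: com where
  "naive_test = LoadE 5 (V 30) ;; (31 \<leftarrow> Bin Equal (V 5) (C 0))"

definition naive_pop :: com where
  "naive_pop = (5 \<leftarrow> C 0) ;; (31 \<leftarrow> C 0) ;; WhileE (V 5 \<prec> V 50)
     (LoadE 6 (V 5) ;; IfE (V 6) (5 \<leftarrow> V 5 \<oplus> C 1)
       ((30 \<leftarrow> V 5) ;; StoreE (V 5) (C 0 \<ominus> C 1) ;; (31 \<leftarrow> C 1) ;; (5 \<leftarrow> V 50)))"

definition naive_kahn :: com where
  "naive_kahn = (5 \<leftarrow> C 0) ;; WhileE (V 5 \<prec> V 50) (StoreE (V 5) (C 0) ;; (5 \<leftarrow> V 5 \<oplus> C 1)) ;;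
     kahn naive_inc naive_dec naive_test Skip naive_pop"

context graph_input
begin

lemma indeg_le: "indeg v \<le> card E"
proof -
  have "indeg v = card ((\<lambda>u. (u, v)) ` {u. (u, v) \<in> E})"
    unfolding indeg_def by (subst card_image) (auto simp: inj_on_def)
  also have "\<dots> \<le> card E" by (intro card_mono finite_E) auto
  finally show ?thesis .
qed

lemma sum_indeg: "finite S \<Longrightarrow> (\<Sum>v\<in>S. indeg v) = card {(u, v) \<in> E. v \<in> S}"
proof (induction S rule: finite_induct)
  case (insert x S)
  have "{(u, v) \<in> E. v \<in> insert x S} = (\<lambda>u. (u, x)) ` {u. (u, x) \<in> E} \<union> {(u, v) \<in> E. v \<in> S}" by auto
  moreover have "card \<dots> = card ((\<lambda>u. (u, x)) ` {u. (u, x) \<in> E}) + card {(u, v) \<in> E. v \<in> S}"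
    using insert by (intro card_Un_disjoint finite_subset[OF _ finite_E]) auto
  moreover have "card ((\<lambda>u. (u, x)) ` {u. (u, x) \<in> E}) = indeg x"
    unfolding indeg_def by (subst card_image) (auto simp: inj_on_def)
  ultimately show ?case using insert by simp
qed simp

lemma indeg_le_n: "indeg v \<le> n"
  unfolding indeg_def using card_mono[of "{..<n}" "{u. (u, v) \<in> E}"] E_bound by auto

end

text \<open>
  A removed vertex is marked by the largest word, which no counter ever reaches, so the ready set
  is the set of zero cells.
\<close>

locale naive = graph_input +
  assumes n_pos: "0 < n" and k: "n \<le> k"
begin

definition nrep :: "(reg \<Rightarrow> nat) \<Rightarrow> (nat \<Rightarrow> nat) \<Rightarrow> (nat \<Rightarrow> nat) \<Rightarrow> nat set \<Rightarrow> nat set \<Rightarrow> bool" where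
  "nrep r m c A D \<longleftrightarrow> r 50 = n \<and> (\<forall>v<n. m v = (if v \<in> D then 2 ^ w - 1 else c v) \<and> c v \<le> indeg v)"

lemma w_pos: "0 < w"
proof (rule ccontr)
  assume "\<not> 0 < w"
  then show False using size_bound n_pos by simp
qed

lemma card_E_word: "Suc (card E) < 2 ^ w"
  using size_bound n_pos by simp

lemma naive_ops: "kahn_ops w k R n E naive_inc naive_dec naive_test Skip naive_pop (20 * n + 20) nrep"
proof unfold_locales
  show "0 < w" by (rule w_pos)
  have ind: "Suc (indeg v) < 2 ^ w" for v using indeg_le[of v] card_E_word by simp
  have nw: "n < 2 ^ w" using size_bound by simp
  note simps = word_simps w_pos
  have one: "take_bit w (Suc 0) = Suc 0" using w_pos by (simp add: take_bit_small)
  show "nrep r m c A D \<Longrightarrow> (\<And>x. x = 32 \<or> 50 \<le> x \<and> x < 90 \<Longrightarrow> r' x = r x) \<Longrightarrow> nrep r' m c A D" for r r' m c A D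
    by (auto simp: nrep_def)
  show "wp naive_inc (\<lambda>\<tau>' r' m' o'. \<tau>' \<le> \<tau> + (20 * n + 20) \<and> keep 40 r r' \<and> o' = out0 \<and>
        nrep r' m' (c(r 30 := Suc (c (r 30)))) {} {}) \<tau> r m out0"
    if "nrep r m c {} {}" "r 30 < n" "c (r 30) < indeg (r 30)" for r m c \<tau> out0
  proof -
    have m: "m (r 30) = c (r 30)" using that by (simp add: nrep_def)
    have e: "ev (r(5 := c (r 30))) (V 5 \<oplus> C 1) = Suc (c (r 30))"
      using that ind[of "r 30"] by (simp add: simps one)
    show ?thesis
      unfolding naive_inc_def
      apply (rule wp_seq, rule wp_load, simp)
      subgoal using that k by simp
      apply (rule wp_store, simp, simp)
      subgoal using that k by simp
      subgoal using that e m by (auto simp: nrep_def)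
      done
  qed
  show "wp naive_dec (\<lambda>\<tau>' r' m' o'. \<tau>' \<le> \<tau> + (20 * n + 20) \<and> keep 40 r r' \<and> r' 30 = r 30 \<and> o' = out0 \<and>
        nrep r' m' (c(r 30 := c (r 30) - 1)) A D) \<tau> r m out0"
    if "nrep r m c A D" "r 30 < n" "0 < c (r 30)" "r 30 \<notin> D" for r m c A D \<tau> out0
  proof -
    have m: "m (r 30) = c (r 30)" "c (r 30) \<le> indeg (r 30)" using that by (simp_all add: nrep_def)
    have e: "ev (r(5 := c (r 30))) (V 5 \<ominus> C 1) = c (r 30) - 1"
      using that m ind[of "r 30"] by (simp add: simps one)
    show ?thesis
      unfolding naive_dec_def
      apply (rule wp_seq, rule wp_load, simp)
      subgoal using that k by simp
      apply (rule wp_store, simp, simp)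
      subgoal using that k by simp
      subgoal using that e m by (auto simp: nrep_def)
      done
  qed
  show "wp naive_test (\<lambda>\<tau>' r' m' o'. \<tau>' \<le> \<tau> + (20 * n + 20) \<and> keep 40 r r' \<and> r' 30 = r 30 \<and> o' = out0 \<and>
        (r' 31 \<noteq> 0 \<longleftrightarrow> c (r 30) = 0) \<and> nrep r' m' c A D) \<tau> r m out0"
    if "nrep r m c A D" "r 30 < n" "r 30 \<notin> D" for r m c A D \<tau> out0
  proof -
    have m: "m (r 30) = c (r 30)" using that by (simp add: nrep_def)
    show ?thesis
      unfolding naive_test_def
      apply (rule wp_seq, rule wp_load, simp)
      subgoal using that k by simp
      apply (rule wp_assign, simp)
      subgoal using that m by (auto simp: nrep_def simps)
      done
  qed
  show "wp Skip (\<lambda>\<tau>' r' m' o'. \<tau>' \<le> \<tau> + (20 * n + 20) \<and> keep 40 r r' \<and> o' = out0 \<and>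
        nrep r' m' c (insert (r 30) A) D) \<tau> r m out0" if "nrep r m c A D" for r m c A D \<tau> out0
    by (rule wp_skip) (use that in \<open>auto simp: nrep_def\<close>)
  show "wp naive_pop (\<lambda>\<tau>' r' m' o'. \<tau>' \<le> \<tau> + (20 * n + 20) \<and> keep 40 r r' \<and> o' = out0 \<and>
        (if r' 31 = 0 then A = {} else r' 30 \<in> A \<and> nrep r' m' c (A - {r' 30}) (insert (r' 30) D))) \<tau> r m out0"
    if "nrep r m c A D" "A = {v. v < n \<and> v \<notin> D \<and> c v = 0}" for r m c A D \<tau> out0
    unfolding naive_pop_def
    apply (rule wp_seq, rule wp_assign, simp)
    apply (rule wp_seq, rule wp_assign, simp)
    apply (rule wp_while[where p = "20 * n" and I = "\<lambda>p r' m' o'. keep 40 r r' \<and> o' = out0 \<and> r' 5 \<le> n \<and>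
       p = (n - r' 5) * 20 \<and>
       (if r' 31 = 0 then m' = m \<and> (\<forall>v<r' 5. v \<notin> A)
        else r' 5 = n \<and> r' 30 \<in> A \<and> nrep r' m' c (A - {r' 30}) (insert (r' 30) D))"], simp)
    subgoal by simp
    subgoal for p r1 m1 o1 \<tau>1
    proof goal_cases
      case 1
      then have lt: "r1 5 < n" using that by (auto simp: nrep_def simps keepD split: if_splits)
      with 1 have I: "keep 40 r r1" "o1 = out0" "p = (n - r1 5) * 20" "m1 = m" "\<forall>v<r1 5. v \<notin> A" "r1 31 = 0"
        by (auto split: if_splits)
      have d: "n - r1 5 = Suc (n - Suc (r1 5))" using lt by simp
      have mm: "m (r1 5) = (if r1 5 \<in> D then 2 ^ w - 1 else c (r1 5))" using that lt by (simp add: nrep_def)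
      have big: "2 ^ w - Suc 0 \<noteq> 0" using card_E_word by linarith
      have iff: "m (r1 5) = 0 \<longleftrightarrow> r1 5 \<in> A" using that(2) mm big lt by auto
      have e: "word_op w Plus (r1 5) (Suc 0) = Suc (r1 5)" using lt nw by (simp add: simps)
      have mx: "word_op w Minus 0 (Suc 0) = 2 ^ w - 1" by (simp add: take_bit_small word_op.simps)
      have e50: "r1 50 = n" using I(1) that by (simp add: nrep_def keepD)
      show ?case
        apply (rule wp_seq, rule wp_load, simp)
        subgoal using lt k by simp
        apply (rule wp_if, simp)
        subgoal
          apply (rule wp_assign, simp)
          subgoal using I lt iff
            by (intro exI[of _ "(n - Suc (r1 5)) * 20"])
               (auto simp: one e d less_Suc_eq w_pos)
          done
        subgoal
          apply (rule wp_seq, rule wp_assign, simp)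
          apply (rule wp_seq, rule wp_store, simp, simp)
          subgoal using lt k by simp
          apply (rule wp_seq, rule wp_assign, simp)
          apply (rule wp_assign, simp)
          subgoal using I lt iff that
            by (intro exI[of _ 0]) (auto simp: one mx w_pos e50 d nrep_def keepD)
          done
        done
    qed
    subgoal for p r1 m1 o1 \<tau>1
    proof goal_cases
      case 1
      then have "r1 5 = n" using that by (auto simp: nrep_def simps keepD)
      then show ?case using 1 that by (auto split: if_splits)
    qed
    done
qed

theorem wp_naive_kahn:
  assumes "r 50 = n"
  shows "wp naive_kahn (\<lambda>\<tau>' r' m' o'. \<tau>' \<le> \<tau> + ((4 * (20 * n + 20) + 60) * (n + card E + 1) + (12 * n + 6)) \<and>
        (acyclic E \<longrightarrow> r' 0 = 0 \<and> topological_ordering n E o') \<and> (\<not> acyclic E \<longrightarrow> r' 0 \<noteq> 0)) \<tau> r m []"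
proof -
  interpret kahn_ops w k R n E naive_inc naive_dec naive_test Skip naive_pop "20 * n + 20" nrep
    by (rule naive_ops)
  note simps = word_simps w_pos
  show ?thesis
    unfolding naive_kahn_def
    apply (rule wp_seq, rule wp_assign, simp)
    apply (rule wp_seq, rule wp_while[where p = "12 * n" and I = "\<lambda>p r m o'. r 50 = n \<and> o' = [] \<and> r 5 \<le> n \<and>
       (\<forall>v<r 5. m v = 0) \<and> p = (n - r 5) * 12"], simp)
    subgoal using assms by simp
    subgoal for p r1 m1 o1 \<tau>1
    proof goal_cases
      case 1
      then have lt: "r1 5 < n" by (auto simp: simps)
      have e: "word_op w Plus (r1 5) (Suc 0) = Suc (r1 5)"
        using lt n_word w_pos by (simp add: simps)
      have d: "n - r1 5 = Suc (n - Suc (r1 5))" using lt by simp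
      show ?case
        apply (rule wp_seq, rule wp_store, simp, simp)
        subgoal using lt k by simp
        apply (rule wp_assign, simp)
        subgoal using 1 lt
          by (intro exI[of _ "(n - Suc (r1 5)) * 12"]) (auto simp: e d less_Suc_eq w_pos)
        done
    qed
    subgoal for p r1 m1 o1 \<tau>1
    proof goal_cases
      case 1
      then have eq: "r1 5 = n" by (auto simp: simps)
      have o1: "o1 = []" using 1 by simp
      show ?case
        unfolding o1
        apply (rule wp_conseq, rule wp_kahn)
        using 1 eq by (auto simp: nrep_def)
    qed
    done
qed

end

section \<open>Bit fields that may straddle words\<close>

definition bitat :: "nat \<Rightarrow> (nat \<Rightarrow> nat) \<Rightarrow> nat \<Rightarrow> bool" where
  "bitat w m P \<longleftrightarrow> bit (m (P div w)) (P mod w)"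

definition fld :: "nat \<Rightarrow> (nat \<Rightarrow> nat) \<Rightarrow> nat \<Rightarrow> nat \<Rightarrow> nat" where
  "fld w m P b = horner_sum of_bool 2 (map (\<lambda>i. bitat w m (P + i)) [0..<b])"

definition written :: "nat \<Rightarrow> (nat \<Rightarrow> nat) \<Rightarrow> (nat \<Rightarrow> nat) \<Rightarrow> nat \<Rightarrow> nat \<Rightarrow> nat \<Rightarrow> bool" where
  "written w m m' P b v \<longleftrightarrow>
     (\<forall>P'. bitat w m' P' = (if P \<le> P' \<and> P' < P + b then bit v (P' - P) else bitat w m P'))"

lemma bit_fld: "bit (fld w m P b) i \<longleftrightarrow> i < b \<and> bitat w m (P + i)"
  by (auto simp: fld_def bit_horner_sum_bit_iff)

lemma fld_cong: "(\<And>i. P \<le> i \<Longrightarrow> i < P + b \<Longrightarrow> bitat w m i = bitat w m' i) \<Longrightarrow> fld w m P b = fld w m' P b"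
  by (rule bit_eqI) (auto simp: bit_fld)

lemma written_same: "written w m m' P b v \<Longrightarrow> v < 2 ^ b \<Longrightarrow> fld w m' P b = v"
  by (rule bit_eqI)
    (auto simp: bit_fld written_def, metis bit_take_bit_iff take_bit_nat_eq_self)

lemma written_other:
  "written w m m' P b v \<Longrightarrow> P' + b' \<le> P \<or> P + b \<le> P' \<Longrightarrow> fld w m' P' b' = fld w m P' b'"
  by (rule fld_cong) (auto simp: written_def)

abbreviation mask_ex :: "expr \<Rightarrow> expr" where
  "mask_ex e \<equiv> Bin ShiftL (C 1) e \<ominus> C 1"

definition get_code :: com where
  "get_code =
     (6 \<leftarrow> V 2 \<oplus> V 3 \<oslash> WL) ;; (7 \<leftarrow> V 3 \<ominus> (V 3 \<oslash> WL) \<otimes> WL) ;;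
     LoadE 5 (V 6) ;; (5 \<leftarrow> Bin ShiftR (V 5) (V 7)) ;;
     IfE (WL \<prec> V 7 \<oplus> V 4)
       (LoadE 8 (V 6 \<oplus> C 1) ;; (5 \<leftarrow> Bin BitOr (V 5) (Bin ShiftL (V 8) (WL \<ominus> V 7)))) Skip ;;
     (5 \<leftarrow> Bin BitAnd (V 5) (mask_ex (V 4)))"

definition put_code :: com where
  "put_code =
     (6 \<leftarrow> V 2 \<oplus> V 3 \<oslash> WL) ;; (7 \<leftarrow> V 3 \<ominus> (V 3 \<oslash> WL) \<otimes> WL) ;; (8 \<leftarrow> mask_ex (V 4)) ;;
     LoadE 9 (V 6) ;;
     (9 \<leftarrow> Bin BitOr (Bin BitXor (V 9) (Bin BitAnd (V 9) (Bin ShiftL (V 8) (V 7)))) (Bin ShiftL (V 5) (V 7))) ;;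
     StoreE (V 6) (V 9) ;;
     IfE (WL \<prec> V 7 \<oplus> V 4)
       ((7 \<leftarrow> WL \<ominus> V 7) ;; LoadE 9 (V 6 \<oplus> C 1) ;;
        (9 \<leftarrow> Bin BitOr (Bin BitXor (V 9) (Bin BitAnd (V 9) (Bin ShiftR (V 8) (V 7)))) (Bin ShiftR (V 5) (V 7))) ;;
        StoreE (V 6 \<oplus> C 1) (V 9)) Skip"

fun high :: "expr \<Rightarrow> bool" where
  "high (V x) \<longleftrightarrow> 10 \<le> x \<and> x < 100"
| "high (Bin f a b) \<longleftrightarrow> high a \<and> high b"
| "high _ \<longleftrightarrow> True"

lemma high_visible: "high e \<Longrightarrow> visible e"
  by (induction e) auto

lemma high_upd: "high e \<Longrightarrow> x < 10 \<Longrightarrow> eval w (r(x := y)) e = eval w r e"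
  by (induction e) auto

definition Get :: "reg \<Rightarrow> expr \<Rightarrow> expr \<Rightarrow> expr \<Rightarrow> com" where
  "Get x a p b = (2 \<leftarrow> a) ;; (3 \<leftarrow> p) ;; (4 \<leftarrow> b) ;; get_code ;; (x \<leftarrow> V 5)"

definition Put :: "expr \<Rightarrow> expr \<Rightarrow> expr \<Rightarrow> expr \<Rightarrow> com" where
  "Put a p b v = (2 \<leftarrow> a) ;; (3 \<leftarrow> p) ;; (4 \<leftarrow> b) ;; (5 \<leftarrow> v) ;; put_code"

lemma bitat_split:
  assumes "f < w" "b \<le> w" "i < w"
  shows "W * w + f \<le> a * w + i \<and> a * w + i < W * w + f + b \<longleftrightarrow>
    (a = W \<and> f \<le> i \<and> i < f + b) \<or> (a = Suc W \<and> w + i < f + b)"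
proof -
  consider "a < W" | "a = W" | "a = Suc W" | "Suc (Suc W) \<le> a" by linarith
  then show ?thesis
  proof cases
    case 1
    then have "Suc a * w \<le> W * w" by (intro mult_le_mono1) simp
    then show ?thesis using 1 assms by simp
  next
    case 4
    then have "Suc (Suc W) * w \<le> a * w" by (intro mult_le_mono1)
    then show ?thesis using 4 assms by simp
  qed (use assms in auto)
qed

text \<open>Registers below 10 are scratch space of the field operations.\<close>

definition junk :: "(reg \<Rightarrow> nat) \<Rightarrow> (reg \<Rightarrow> nat) \<Rightarrow> reg \<Rightarrow> nat" where
  "junk j r x = (if x < 10 then j x else r x)"

lemma junk_simps [simp]:
  "10 \<le> x \<Longrightarrow> junk j r x = r x"
  "10 \<le> x \<Longrightarrow> (junk j r)(x := y) = junk j (r(x := y))"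
  "junk j (junk j' r) = junk j r"
  "10 \<le> a \<Longrightarrow> keep a r (junk j r') \<longleftrightarrow> keep a r r'"
  by (auto simp: junk_def keep_def fun_eq_iff)

lemma junkI: "(\<And>x. 10 \<le> x \<Longrightarrow> r' x = r x) \<Longrightarrow> r' = junk r' r"
  by (auto simp: junk_def)

locale bit_ram = ram +
  assumes w_pos [simp]: "0 < w" and w_large: "2 * w < 2 ^ w" and k_word: "k \<le> 2 ^ w"
begin

abbreviation words where "words m \<equiv> \<forall>a. m a < 2 ^ w"

lemma mask_eval: "b \<le> w \<Longrightarrow> word_op w Minus (take_bit w (2 ^ b)) (Suc 0) = 2 ^ b - 1"
proof -
  assume b: "b \<le> w"
  have le: "2 ^ b \<le> (2 ^ w :: nat)" using b by (simp add: power_increasing)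
  show ?thesis
  proof (cases "b = w")
    case True
    then show ?thesis by (simp add: word_op.simps take_bit_small)
  next
    case False
    then have "take_bit w (2 ^ b) = (2 ^ b :: nat)" using b by (intro take_bit_small) simp
    moreover have "2 ^ b - Suc 0 < 2 ^ w" by (rule less_le_trans[OF _ le]) simp
    moreover have "Suc 0 \<le> 2 ^ b" by (simp add: Suc_le_eq)
    ultimately show ?thesis by (simp only: word_op_Minus)
  qed
qed

lemma address:
  assumes "r3 < 2 ^ w" "(r2 * w + r3) < k * w"
  shows "word_op w Plus r2 (r3 div w) = (r2 * w + r3) div w" "(r2 * w + r3) div w < k"
    "word_op w Minus r3 (word_op w Times (r3 div w) w) = (r2 * w + r3) mod w"
proof -
  show lt: "(r2 * w + r3) div w < k" using assms(2) by (rule less_mult_imp_div_less)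
  have e: "(r2 * w + r3) div w = r2 + r3 div w" by (simp add: div_add1_eq)
  show "word_op w Plus r2 (r3 div w) = (r2 * w + r3) div w"
    using lt k_word unfolding e by (intro word_op_Plus) simp
  have le: "r3 div w * w \<le> r3" by (simp add: div_times_less_eq_dividend)
  then have "word_op w Times (r3 div w) w = r3 div w * w"
    using assms(1) by (intro word_op_Times) linarith
  moreover have "word_op w Minus r3 (r3 div w * w) = r3 - r3 div w * w"
    using assms(1) le by (intro word_op_Minus) auto
  ultimately show "word_op w Minus r3 (word_op w Times (r3 div w) w) = (r2 * w + r3) mod w"
    by (simp add: minus_div_mult_eq_mod)
qed

lemma get_bits:
  assumes "b \<le> w" "f < w" "words m"
  shows "and (if w < f + b then or (drop_bit f (m W)) (take_bit w (push_bit (w - f) (m (Suc W)))) else drop_bit f (m W))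
     (2 ^ b - Suc 0) = fld w m (W * w + f) b"
proof (rule bit_eqI)
  fix i
  have m: "\<not> bit (m W) j" if "w \<le> j" for j
    using assms(3) that by (metis bit_take_bit_iff linorder_not_less take_bit_nat_eq_self)
  have d1: "(W * w + f + i) div w = W \<and> (W * w + f + i) mod w = f + i" if "f + i < w"
  proof -
    have e: "W * w + f + i = (f + i) + W * w" by simp
    show ?thesis unfolding e by (subst div_mult_self1, simp, subst mod_mult_self1) (use that in auto)
  qed
  have d2: "(W * w + f + i) div w = Suc W \<and> (W * w + f + i) mod w = f + i - w" if "w \<le> f + i" "f + i < w + w"
  proof -
    have e: "W * w + f + i = (f + i - w) + Suc W * w" using that by simp
    have "f + i - w < w" using that by simp
    then show ?thesis unfolding e by (subst div_mult_self1, simp, subst mod_mult_self1) auto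
  qed
  have mask: "bit (2 ^ b - Suc 0 :: nat) i \<longleftrightarrow> i < b"
    by (metis bit_mask_iff mask_eq_exp_minus_1 One_nat_def possible_bit_nat)
  show "bit (and (if w < f + b then or (drop_bit f (m W)) (take_bit w (push_bit (w - f) (m (Suc W)))) else drop_bit f (m W))
     (2 ^ b - Suc 0)) i = bit (fld w m (W * w + f) b) i"
  proof (cases "i < b")
    case True
    show ?thesis
    proof (cases "f + i < w")
      case lt: True
      have "\<not> bit (take_bit w (push_bit (w - f) (m (Suc W)))) i"
        using lt by (auto simp: bit_take_bit_iff bit_push_bit_iff)
      then show ?thesis using True d1[OF lt]
        by (auto simp: bit_and_iff mask bit_fld bitat_def bit_or_iff bit_drop_bit_eq)
    next
      case ge: False
      then have "w < f + b" "f + i < w + w" using True assms by auto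
      moreover have "i + f - w = f + i - w" by simp
      ultimately show ?thesis using True d2 ge m[of "f + i"] assms
        by (auto simp: bit_and_iff mask bit_fld bitat_def bit_or_iff bit_drop_bit_eq bit_take_bit_iff bit_push_bit_iff)
    qed
  qed (auto simp: bit_and_iff mask bit_fld)
qed

lemma wp_get_code:
  assumes "r 3 < 2 ^ w" "r 2 * w + r 3 + r 4 \<le> k * w" "0 < r 4" "r 4 \<le> w" "words m"
    and Q: "\<And>\<tau>' r'. \<tau>' \<le> \<tau> + 60 \<Longrightarrow> (\<And>x. 10 \<le> x \<Longrightarrow> r' x = r x) \<Longrightarrow> r' 5 = fld w m (r 2 * w + r 3) (r 4) \<Longrightarrow> Q \<tau>' r' m o'"
  shows "wp get_code Q \<tau> r m o'"
proof -
  define P where "P = r 2 * w + r 3"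
  define W where "W = P div w"
  define f where "f = P mod w"
  have Pk: "r 2 * w + r 3 < k * w" using assms by simp
  have f: "f < w" by (simp add: f_def)
  have P: "W * w + f = P" by (simp add: W_def f_def)
  note adr = address[OF assms(1) Pk, folded P_def, folded W_def f_def]
  have W1: "Suc W < k" if "w < f + r 4"
  proof -
    have "Suc W * w < k * w" using that assms P unfolding P_def by simp
    then show ?thesis by (metis mult_less_cancel2)
  qed
  have fb: "word_op w Plus f (r 4) = f + r 4" using f assms w_large by (intro word_op_Plus) linarith
  have wf: "word_op w Minus w f = w - f" using f w_large by (intro word_op_Minus) auto
  have W1e: "word_op w Plus W (Suc 0) = Suc W" if "w < f + r 4"
    using W1[OF that] k_word by (simp add: word_op_Plus)
  have mk: "word_op w Minus (word_op w ShiftL (Suc 0) (r 4)) (Suc 0) = 2 ^ r 4 - Suc 0"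
    using mask_eval[OF assms(4)] by (simp add: word_op.simps(8) push_bit_eq_mult)
  have sl: "word_op w ShiftL (m a) y = take_bit w (push_bit y (m a))" for a y by (simp add: word_op.simps)
  note gb = get_bits[OF assms(4) f assms(5), of W, unfolded P P_def]
  show ?thesis
    unfolding get_code_def
    apply (rule wp_seq, rule wp_assign, simp)
    apply (rule wp_seq, rule wp_assign, simp)
    apply (rule wp_seq, rule wp_load, simp)
    subgoal using adr by simp
    apply (rule wp_seq, rule wp_assign, simp)
    apply (rule wp_seq, rule wp_if, simp)
    subgoal
      apply (rule wp_seq, rule wp_load, simp)
      subgoal using W1 by (simp add: adr fb W1e word_op_Less take_bit_one)
      apply (rule wp_assign, simp)
      apply (rule wp_assign, simp)
      subgoal using gb by (intro Q) (simp_all add: adr fb W1e word_op_Less take_bit_one wf sl mk)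
      done
    subgoal
      apply (rule wp_skip)
      apply (rule wp_assign, simp)
      subgoal using gb by (intro Q) (simp_all add: adr fb word_op_Less take_bit_one wf sl mk)
      done
    done
qed

lemma wp_Get:
  assumes "high a" "high p" "high b" "10 \<le> x"
    and "ev r p < 2 ^ w" "ev r a * w + ev r p + ev r b \<le> k * w" "0 < ev r b" "ev r b \<le> w" "words m"
    and Q: "\<And>\<tau>' j. \<tau>' \<le> \<tau> + (70 + cost a + cost p + cost b) \<Longrightarrow>
      Q \<tau>' (junk j (r(x := fld w m (ev r a * w + ev r p) (ev r b)))) m o'"
  shows "wp (Get x a p b) Q \<tau> r m o'"
  unfolding Get_def
  apply (rule wp_seq, rule wp_assign, simp add: assms high_visible)
  apply (rule wp_seq, rule wp_assign, simp add: assms high_visible)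
  apply (rule wp_seq, rule wp_assign, simp add: assms high_visible)
  apply (rule wp_seq, rule wp_get_code)
  subgoal using assms by (simp add: high_upd)
  subgoal using assms by (simp add: high_upd)
  subgoal using assms by (simp add: high_upd)
  subgoal using assms by (simp add: high_upd)
  subgoal using assms by simp
  apply (rule wp_assign, simp)
  subgoal for \<tau>' r'
    by (subst junkI[where r = "r(x := fld w m (ev r a * w + ev r p) (ev r b))"])
      (use assms(1-4) in \<open>auto simp: high_upd intro!: Q\<close>)
  done

lemma put_bits:
  assumes "b \<le> w" "f < w" "words m" "v < 2 ^ b"
    and m': "m' = (let m1 = m(W := or (xor (m W) (and (m W) (take_bit w (push_bit f (2 ^ b - Suc 0))))) (take_bit w (push_bit f v)))
       in if w < f + b then m1(Suc W := or (xor (m (Suc W)) (and (m (Suc W)) (drop_bit (w - f) (2 ^ b - Suc 0)))) (drop_bit (w - f) v))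
          else m1)"
  shows "written w m m' (W * w + f) b v" "words m'"
proof -
  have mask: "bit (2 ^ b - Suc 0 :: nat) i \<longleftrightarrow> i < b" for i
    by (metis bit_mask_iff mask_eq_exp_minus_1 One_nat_def possible_bit_nat)
  have v: "bit v i \<Longrightarrow> i < b" for i
    using assms(4) by (metis bit_take_bit_iff take_bit_nat_eq_self)
  have mb: "bit (m a) i \<Longrightarrow> i < w" for a i
    using assms(3) by (metis bit_take_bit_iff take_bit_nat_eq_self)
  have b1: "bit (m' a) i = (if (a = W \<and> f \<le> i \<and> i < f + b) \<or> (a = Suc W \<and> w + i < f + b)
      then bit v (a * w + i - (W * w + f)) else bit (m a) i)" if "i < w" for a i
    using that assms(1,2) v[of "i - f"] v[of "i + (w - f)"] unfolding m'
    by (auto simp: Let_def bit_or_iff bit_xor_iff bit_and_iff bit_take_bit_iff bit_push_bit_iff bit_drop_bit_eq mask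
      algebra_simps)
  show "written w m m' (W * w + f) b v"
    unfolding written_def
  proof
    fix P'
    have i: "P' mod w < w" by simp
    have P: "P' div w * w + P' mod w = P'" by simp
    show "bitat w m' P' = (if W * w + f \<le> P' \<and> P' < W * w + f + b then bit v (P' - (W * w + f)) else bitat w m P')"
      using b1[OF i, of "P' div w"] bitat_split[OF assms(2,1) i, of W "P' div w"] unfolding bitat_def P by simp
  qed
  show "words m'"
  proof
    fix a
    have "\<not> bit (m' a) i" if "w \<le> i" for i
      using that mb[of a i] mb[of "Suc W" i] v[of "w + i - f"] assms(1,2) unfolding m'
      by (auto simp: Let_def bit_or_iff bit_xor_iff bit_and_iff bit_take_bit_iff bit_push_bit_iff bit_drop_bit_eq mask
        add.commute[of i w] split: if_splits)
    then have "take_bit w (m' a) = m' a" by (intro bit_eqI) (auto simp: bit_take_bit_iff not_less[symmetric])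
    then show "m' a < 2 ^ w" by (metis take_bit_nat_less_exp)
  qed
qed

lemma wp_put_code:
  assumes "r 3 < 2 ^ w" "r 2 * w + r 3 + r 4 \<le> k * w" "0 < r 4" "r 4 \<le> w" "words m" "r 5 < 2 ^ r 4"
    and Q: "\<And>\<tau>' r' m'. \<tau>' \<le> \<tau> + 80 \<Longrightarrow> (\<And>x. 10 \<le> x \<Longrightarrow> r' x = r x) \<Longrightarrow> words m' \<Longrightarrow>
       written w m m' (r 2 * w + r 3) (r 4) (r 5) \<Longrightarrow> Q \<tau>' r' m' o'"
  shows "wp put_code Q \<tau> r m o'"
proof -
  define P where "P = r 2 * w + r 3"
  define W where "W = P div w"
  define f where "f = P mod w"
  have Pk: "r 2 * w + r 3 < k * w" using assms by simp
  have f: "f < w" by (simp add: f_def)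
  have P: "W * w + f = P" by (simp add: W_def f_def)
  note adr = address[OF assms(1) Pk, folded P_def, folded W_def f_def]
  have W1: "Suc W < k" if "w < f + r 4"
  proof -
    have "Suc W * w < k * w" using that assms P unfolding P_def by simp
    then show ?thesis by (metis mult_less_cancel2)
  qed
  have fb: "word_op w Plus f (r 4) = f + r 4" using f assms w_large by (intro word_op_Plus) linarith
  have wf: "word_op w Minus w f = w - f" using f w_large by (intro word_op_Minus) auto
  have W1e: "word_op w Plus W (Suc 0) = Suc W" if "w < f + r 4"
    using W1[OF that] k_word by (simp add: word_op_Plus)
  have mk: "word_op w Minus (word_op w ShiftL (Suc 0) (r 4)) (Suc 0) = 2 ^ r 4 - Suc 0"
    using mask_eval[OF assms(4)] by (simp add: word_op.simps(8) push_bit_eq_mult)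
  have sl: "word_op w ShiftL (2 ^ r 4 - Suc 0) f = take_bit w (push_bit f (2 ^ r 4 - Suc 0))"
    "word_op w ShiftL (r 5) f = take_bit w (push_bit f (r 5))" by (simp_all add: word_op.simps)
  define m' where "m' = (let m1 = m(W := or (xor (m W) (and (m W) (take_bit w (push_bit f (2 ^ r 4 - Suc 0))))) (take_bit w (push_bit f (r 5))))
       in if w < f + r 4 then m1(Suc W := or (xor (m (Suc W)) (and (m (Suc W)) (drop_bit (w - f) (2 ^ r 4 - Suc 0)))) (drop_bit (w - f) (r 5)))
          else m1)"
  note pb = put_bits[OF assms(4) f assms(5,6) m'_def, unfolded P P_def]
  show ?thesis
    unfolding put_code_def
    apply (rule wp_seq, rule wp_assign, simp)
    apply (rule wp_seq, rule wp_assign, simp)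
    apply (rule wp_seq, rule wp_assign, simp)
    apply (rule wp_seq, rule wp_load, simp)
    subgoal using adr by simp
    apply (rule wp_seq, rule wp_assign, simp)
    apply (rule wp_seq, rule wp_store, simp, simp)
    subgoal using adr by simp
    apply (rule wp_if, simp)
    subgoal
      apply (rule wp_seq, rule wp_assign, simp)
      apply (rule wp_seq, rule wp_load, simp)
      subgoal using W1 by (simp add: adr fb W1e word_op_Less take_bit_one)
      apply (rule wp_seq, rule wp_assign, simp)
      apply (rule wp_store, simp, simp)
      subgoal using W1 by (simp add: adr fb W1e word_op_Less take_bit_one)
      apply (rule Q)
      subgoal by simp
      subgoal by simp
      subgoal
        apply (rule back_subst[where P = "\<lambda>m. words m", OF pb(2)])
        unfolding m'_def by (simp add: adr fb W1e word_op_Less take_bit_one wf sl mk Let_def)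
      subgoal
        apply (rule back_subst[where P = "\<lambda>m''. written w m m'' (r 2 * w + r 3) (r 4) (r 5)", OF pb(1)])
        unfolding m'_def by (simp add: adr fb W1e word_op_Less take_bit_one wf sl mk Let_def)
      done
    subgoal
      apply (rule wp_skip)
      apply (rule Q)
      subgoal by simp
      subgoal by simp
      subgoal
        apply (rule back_subst[where P = "\<lambda>m. words m", OF pb(2)])
        unfolding m'_def by (simp add: adr fb W1e word_op_Less take_bit_one wf sl mk Let_def)
      subgoal
        apply (rule back_subst[where P = "\<lambda>m''. written w m m'' (r 2 * w + r 3) (r 4) (r 5)", OF pb(1)])
        unfolding m'_def by (simp add: adr fb W1e word_op_Less take_bit_one wf sl mk Let_def)
      done
    done
qed

lemma wp_Put:
  assumes "high a" "high p" "high b" "high v"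
    and "ev r p < 2 ^ w" "ev r a * w + ev r p + ev r b \<le> k * w" "0 < ev r b" "ev r b \<le> w" "words m"
    and "ev r v < 2 ^ ev r b"
    and Q: "\<And>\<tau>' j m'. \<tau>' \<le> \<tau> + (85 + cost a + cost p + cost b + cost v) \<Longrightarrow> words m' \<Longrightarrow>
      written w m m' (ev r a * w + ev r p) (ev r b) (ev r v) \<Longrightarrow> Q \<tau>' (junk j r) m' o'"
  shows "wp (Put a p b v) Q \<tau> r m o'"
  unfolding Put_def
  apply (rule wp_seq, rule wp_assign, simp add: assms high_visible)
  apply (rule wp_seq, rule wp_assign, simp add: assms high_visible)
  apply (rule wp_seq, rule wp_assign, simp add: assms high_visible)
  apply (rule wp_seq, rule wp_assign, simp add: assms high_visible)
  apply (rule wp_put_code)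
  subgoal using assms by (simp add: high_upd)
  subgoal using assms by (simp add: high_upd)
  subgoal using assms by (simp add: high_upd)
  subgoal using assms by (simp add: high_upd)
  subgoal using assms by simp
  subgoal using assms by (simp add: high_upd)
  subgoal for \<tau>' r' m'
    by (subst junkI[where r = r]) (use assms(1-4) in \<open>auto simp: high_upd intro!: Q\<close>)
  done

end

section \<open>Unary codes of blocks of counters\<close>

text \<open>
  The code of \<open>d # ds\<close> is the bit string that consists, from the least significant bit on, of \<open>d\<close>
  ones, a zero and the code of \<open>ds\<close>; \<open>sel x j\<close> is the position of the zero with index \<open>j\<close> in \<open>x\<close>.
\<close>

fun enc :: "nat list \<Rightarrow> nat" where
  "enc [] = 0"
| "enc (d # ds) = (2 ^ d - 1) + 2 ^ Suc d * enc ds"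

function sel :: "nat \<Rightarrow> nat \<Rightarrow> nat" where
  "sel x j = (if even x then (if j = 0 then 0 else Suc (sel (x div 2) (j - 1))) else Suc (sel (x div 2) j))"
  by auto
termination
  by (relation "measure (\<lambda>(x, j). x + j)") (auto elim!: oddE)

declare sel.simps [simp del]

lemma sel_block:
  "sel ((2 ^ d - 1) + 2 ^ Suc d * y) 0 = d"
  "sel ((2 ^ d - 1) + 2 ^ Suc d * y) (Suc j) = Suc (d + sel y j)"
proof -
  have "sel ((2 ^ d - 1) + 2 ^ Suc d * y) 0 = d \<and> sel ((2 ^ d - 1) + 2 ^ Suc d * y) (Suc j) = Suc (d + sel y j)"
  proof (induction d)
    case 0
    show ?case by (auto simp: sel.simps[of "2 * y"])
  next
    case (Suc d)
    obtain q where q: "(2::nat) ^ d = Suc q" by (cases "(2::nat) ^ d") auto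
    have e: "(2 ^ Suc d - 1) + 2 ^ Suc (Suc d) * y = Suc (2 * ((2 ^ d - 1) + 2 ^ Suc d * y))"
      by (simp add: q algebra_simps)
    show ?case unfolding e using Suc by (simp add: sel.simps[of "Suc (2 * z)" for z])
  qed
  then show "sel ((2 ^ d - 1) + 2 ^ Suc d * y) 0 = d"
    "sel ((2 ^ d - 1) + 2 ^ Suc d * y) (Suc j) = Suc (d + sel y j)" by auto
qed

lemma sel_enc_Cons: "sel (enc (d # ds)) 0 = d" "sel (enc (d # ds)) (Suc j) = Suc (d + sel (enc ds) j)"
  using sel_block[of d "enc ds"] by simp_all

lemma block_div:
  "((2 ^ d - 1) + 2 ^ Suc d * y) div 2 ^ d = 2 * (y :: nat)"
  "((2 ^ d - 1) + 2 ^ Suc d * y) div 2 ^ Suc (d + p) = y div 2 ^ p"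
proof -
  have lt: "2 ^ d - 1 < (2 :: nat) ^ d" by simp
  have "((2 ^ d - 1) + 2 ^ Suc d * y) div 2 ^ d = ((2 ^ d - 1) + (2 * y) * 2 ^ d) div 2 ^ d"
    by (simp add: mult_ac)
  also have "\<dots> = 2 * y + (2 ^ d - 1) div 2 ^ d" by (rule div_mult_self1) simp
  finally show "((2 ^ d - 1) + 2 ^ Suc d * y) div 2 ^ d = 2 * y" using lt by simp
  have lt2: "2 ^ d - 1 < (2 :: nat) ^ Suc d" using lt unfolding power_Suc by linarith
  have "((2 ^ d - 1) + 2 ^ Suc d * y) div 2 ^ Suc d = ((2 ^ d - 1) + y * 2 ^ Suc d) div 2 ^ Suc d"
    by (simp add: mult_ac)
  also have "\<dots> = y + (2 ^ d - 1) div 2 ^ Suc d" by (rule div_mult_self1) simp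
  finally have "((2 ^ d - 1) + 2 ^ Suc d * y) div 2 ^ Suc d = y" using lt2 by simp
  moreover have "(2 :: nat) ^ Suc (d + p) = 2 ^ Suc d * 2 ^ p" by (simp add: power_add)
  ultimately show "((2 ^ d - 1) + 2 ^ Suc d * y) div 2 ^ Suc (d + p) = y div 2 ^ p"
    by (metis div_mult2_eq)
qed

lemma enc_inc:
  "j < length ds \<Longrightarrow> enc (ds[j := Suc (ds ! j)]) =
     enc ds + Suc (enc ds div 2 ^ sel (enc ds) j) * 2 ^ sel (enc ds) j"
proof (induction ds arbitrary: j)
  case (Cons d ds)
  show ?case
  proof (cases j)
    case 0
    have d: "enc (d # ds) div 2 ^ d = 2 * enc ds" using block_div(1)[of d "enc ds"] by simp
    obtain q where q: "(2::nat) ^ d = Suc q" by (cases "(2::nat) ^ d") auto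
    have "enc (Suc d # ds) = enc (d # ds) + Suc (2 * enc ds) * 2 ^ d"
      by (simp add: q algebra_simps)
    then show ?thesis unfolding 0 sel_enc_Cons d by simp
  next
    case (Suc i)
    have d: "enc (d # ds) div 2 ^ Suc (d + p) = enc ds div 2 ^ p" for p
      using block_div(2)[of d "enc ds" p] by simp
    have "enc (ds[i := Suc (ds ! i)]) = enc ds + Suc (enc ds div 2 ^ sel (enc ds) i) * 2 ^ sel (enc ds) i"
      using Cons Suc by simp
    moreover obtain q where q: "(2::nat) ^ d = Suc q" by (cases "(2::nat) ^ d") auto
    ultimately show ?thesis unfolding Suc sel_enc_Cons d by (simp add: q algebra_simps power_add)
  qed
qed simp

lemma enc_dec:
  "j < length ds \<Longrightarrow> 0 < ds ! j \<Longrightarrow> 0 < sel (enc ds) j \<and> enc ds =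
     enc (ds[j := ds ! j - 1]) + Suc (enc ds div 2 ^ sel (enc ds) j) * 2 ^ (sel (enc ds) j - 1)"
proof (induction ds arbitrary: j)
  case (Cons d ds)
  show ?case
  proof (cases j)
    case 0
    have d: "enc (d # ds) div 2 ^ d = 2 * enc ds" using block_div(1)[of d "enc ds"] by simp
    obtain d' where d': "d = Suc d'" using Cons.prems 0 by (cases d) auto
    obtain q where q: "(2::nat) ^ d' = Suc q" by (cases "(2::nat) ^ d'") auto
    have "enc (d # ds) = enc (d' # ds) + Suc (2 * enc ds) * 2 ^ d'"
      unfolding d' by (simp add: q algebra_simps)
    then show ?thesis unfolding 0 sel_enc_Cons d by (simp add: d')
  next
    case (Suc i)
    have d: "enc (d # ds) div 2 ^ Suc (d + p) = enc ds div 2 ^ p" for p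
      using block_div(2)[of d "enc ds" p] by simp
    let ?p = "sel (enc ds) i"
    have IH: "0 < ?p" "enc ds = enc (ds[i := ds ! i - 1]) + Suc (enc ds div 2 ^ ?p) * 2 ^ (?p - 1)"
      using Cons.IH[of i] Cons.prems Suc by simp_all
    have "enc (d # ds) = (2 ^ d - 1) + 2 ^ Suc d * enc (ds[i := ds ! i - 1]) +
        Suc (enc ds div 2 ^ ?p) * 2 ^ (Suc d + (?p - 1))"
      by (subst enc.simps, subst IH(2)) (simp only: algebra_simps power_add)
    moreover have "Suc d + (?p - 1) = d + ?p" using IH(1) by simp
    ultimately show ?thesis unfolding Suc sel_enc_Cons d by simp
  qed
qed simp

lemma enc_zero: "j < length ds \<Longrightarrow> even ((2 * enc ds) div 2 ^ sel (enc ds) j) \<longleftrightarrow> ds ! j = 0"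
proof (induction ds arbitrary: j)
  case (Cons d ds)
  show ?case
  proof (cases j)
    case 0
    show ?thesis
    proof (cases d)
      case (Suc d')
      obtain q where q: "(2::nat) ^ d' = Suc q" by (cases "(2::nat) ^ d'") auto
      have "2 * enc (d # ds) = (2 ^ d - 2) + (1 + 2 * (2 * enc ds)) * 2 ^ d"
        unfolding Suc by (simp add: q algebra_simps)
      then have "2 * enc (d # ds) div 2 ^ d = (1 + 2 * (2 * enc ds)) + (2 ^ d - 2) div 2 ^ d"
        by (simp only: div_mult_self1 power_not_zero zero_neq_numeral not_False_eq_True)
      moreover have "(2 ^ d - 2) div 2 ^ d = (0::nat)" by simp
      ultimately show ?thesis unfolding 0 sel_enc_Cons using Suc by simp
    qed (unfold 0 sel_enc_Cons, simp)
  next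
    case (Suc i)
    let ?p = "sel (enc ds) i"
    obtain q where q: "(2::nat) ^ d = Suc q" by (cases "(2::nat) ^ d") auto
    have "2 * enc (d # ds) = 2 * (2 ^ d - 1) + (2 * enc ds) * 2 ^ Suc d" by (simp add: q algebra_simps)
    then have "2 * enc (d # ds) div 2 ^ Suc d = 2 * enc ds + 2 * (2 ^ d - 1) div 2 ^ Suc d"
      by (simp only: div_mult_self1 power_not_zero zero_neq_numeral not_False_eq_True)
    moreover have "2 * (2 ^ d - 1) div 2 ^ Suc d = (0::nat)" by simp
    ultimately have "2 * enc (d # ds) div 2 ^ Suc d = 2 * enc ds" by simp
    then have "2 * enc (d # ds) div (2 ^ Suc d * 2 ^ ?p) = 2 * enc ds div 2 ^ ?p"
      by (simp only: div_mult2_eq)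
    moreover have "(2 :: nat) ^ Suc (d + ?p) = 2 ^ Suc d * 2 ^ ?p" by (simp add: power_add)
    ultimately have "2 * enc (d # ds) div 2 ^ Suc (d + ?p) = 2 * enc ds div 2 ^ ?p" by simp
    then show ?thesis unfolding Suc sel_enc_Cons using Cons Suc by simp
  qed
qed simp

lemma enc_less: "enc ds < 2 ^ (sum_list ds + length ds)"
proof (induction ds)
  case (Cons d ds)
  let ?N = "sum_list ds + length ds"
  have "2 ^ Suc d * Suc (enc ds) \<le> 2 ^ Suc d * 2 ^ ?N" using Cons by (intro mult_le_mono2) simp
  moreover have "(2 :: nat) ^ Suc d * 2 ^ ?N = 2 ^ (sum_list (d # ds) + length (d # ds))" by (simp add: power_add)
  moreover have "enc (d # ds) < 2 ^ Suc d * Suc (enc ds)"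
  proof -
    have "2 ^ d - 1 < (2 :: nat) ^ Suc d" by (simp add: less_imp_diff_less)
    then show ?thesis by simp
  qed
  ultimately show ?case by linarith
qed simp

lemma sel_less: "x < 2 ^ h \<Longrightarrow> sel x j \<le> h + j"
proof (induction x j arbitrary: h rule: sel.induct)
  case (1 x j)
  have half: "x div 2 < 2 ^ (h - 1)" if "0 < h" using 1(3) that by (cases h) auto
  show ?case
  proof (cases "even x")
    case True
    show ?thesis
    proof (cases "j = 0")
      case False
      have "sel (x div 2) (j - 1) \<le> h + (j - 1)"
        using 1(1)[OF True False, of h] 1(3) by (simp add: div_less_dividend order_le_less_trans[OF div_le_dividend])
      then show ?thesis using True False by (subst sel.simps) simp
    qed (use True in \<open>simp add: sel.simps[of x]\<close>)
  next
    case False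
    then have "0 < h" using 1(3) by (cases h) auto
    then show ?thesis using 1(2)[OF False half] False by (subst sel.simps) simp
  qed
qed

lemma sel_first_zero: "\<not> bit x (sel x 0) \<and> (\<forall>i. \<not> bit x i \<longrightarrow> sel x 0 \<le> i)"
proof (induction x rule: less_induct)
  case (less x)
  show ?case
  proof (cases "even x")
    case True
    then show ?thesis by (simp add: sel.simps[of x] bit_0)
  next
    case False
    then have "x div 2 < x" by (cases x) auto
    note IH = less[OF this]
    have s: "sel x 0 = Suc (sel (x div 2) 0)" using False by (subst sel.simps) simp
    show ?thesis unfolding s
    proof (intro conjI allI impI)
      show "\<not> bit x (Suc (sel (x div 2) 0))" using IH by (simp add: bit_Suc)
      fix i assume i: "\<not> bit x i"
      then obtain i' where "i = Suc i'" using False by (cases i) (auto simp: bit_0)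
      then show "Suc (sel (x div 2) 0) \<le> i" using i IH by (simp add: bit_Suc)
    qed
  qed
qed

fun bitlen :: "nat \<Rightarrow> nat" where
  "bitlen x = (if x = 0 then 0 else Suc (bitlen (x div 2)))"

declare bitlen.simps [simp del]

lemma less_bitlen: "x < 2 ^ bitlen x"
proof (induction x rule: bitlen.induct)
  case (1 x)
  show ?case
  proof (cases "x = 0")
    case False
    then have "x < 2 * 2 ^ bitlen (x div 2)" using 1 by linarith
    then show ?thesis using False by (subst bitlen.simps) simp
  qed (simp add: bitlen.simps)
qed

lemma bitlen_le: "x < 2 ^ b \<Longrightarrow> bitlen x \<le> b"
proof (induction x arbitrary: b rule: bitlen.induct)
  case (1 x)
  show ?case
  proof (cases "x = 0")
    case False
    then obtain b' where b: "b = Suc b'" using 1 by (cases b) auto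
    then have "bitlen (x div 2) \<le> b'" using 1(1)[OF False, of b'] 1(2) by auto
    then show ?thesis using False b by (subst bitlen.simps) simp
  qed (simp add: bitlen.simps)
qed

lemma bitlen_pos: "0 < x \<Longrightarrow> 0 < bitlen x"
  by (subst bitlen.simps) simp

lemma bitlen_ge: "0 < x \<Longrightarrow> 2 ^ (bitlen x - 1) \<le> x"
proof (rule ccontr)
  assume "0 < x" "\<not> 2 ^ (bitlen x - 1) \<le> x"
  then have "bitlen x \<le> bitlen x - 1" by (intro bitlen_le) simp
  then show False using bitlen_pos[OF \<open>0 < x\<close>] by simp
qed

section \<open>The compressed counters\<close>

definition beta :: "nat \<Rightarrow> nat" where
  "beta n = 4 * bitlen (bitlen n)"

definition ell :: "nat \<Rightarrow> nat" where
  "ell n = bitlen n div (beta n * beta n)"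

definition chunk :: "nat \<Rightarrow> nat" where
  "chunk n = bitlen n + 3 - bitlen (bitlen n)"

definition large :: "nat \<Rightarrow> bool" where
  "large n \<longleftrightarrow> 20 \<le> bitlen n \<and> 2 * beta n \<le> bitlen n \<and> chunk n \<le> bitlen n \<and> 0 < ell n \<and>
     ell n * beta n + ell n \<le> chunk n \<and> ell n * bitlen n < 2 ^ beta n \<and>
     chunk n + ell n < 2 ^ beta n \<and> bitlen n * (2 ^ beta n + ell n) \<le> 2 ^ (2 * beta n) \<and>
     2 ^ chunk n * ell n * beta n \<le> n \<and>
     (n div ell n + 1) * (2 * beta n) \<le> n \<and>
     (n div ell n div bitlen n + 1) * (2 * bitlen n) \<le> n \<and>
     n div chunk n < 2 ^ chunk n"

definition addr_S :: "nat \<Rightarrow> nat \<Rightarrow> nat \<Rightarrow> nat" where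
  "addr_S w n m = 2 ^ chunk n * ell n * beta n div w + 1"

definition addr_REL :: "nat \<Rightarrow> nat \<Rightarrow> nat \<Rightarrow> nat" where
  "addr_REL w n m = addr_S w n m + ((n div ell n + 1) * beta n div w + 1)"

definition addr_ABS :: "nat \<Rightarrow> nat \<Rightarrow> nat \<Rightarrow> nat" where
  "addr_ABS w n m = addr_REL w n m + ((n div ell n + 1) * (2 * beta n) div w + 1)"

definition addr_BMP :: "nat \<Rightarrow> nat \<Rightarrow> nat \<Rightarrow> nat" where
  "addr_BMP w n m = addr_ABS w n m + ((n div ell n div bitlen n + 1) * bitlen (n + m) div w + 1)"

definition addr_STK :: "nat \<Rightarrow> nat \<Rightarrow> nat \<Rightarrow> nat" where
  "addr_STK w n m = addr_BMP w n m + (n div w + 2)"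

definition addr_CNT :: "nat \<Rightarrow> nat \<Rightarrow> nat \<Rightarrow> nat" where
  "addr_CNT w n m = addr_STK w n m + (n div w + 2)"

definition cells :: "nat \<Rightarrow> nat \<Rightarrow> nat \<Rightarrow> nat" where
  "cells w n m = addr_CNT w n m + ((n + m) div w + 2)"

locale packed = graph_input +
  assumes large: "large n" and k: "k = cells w n (card E)"
begin

abbreviation "M \<equiv> card E"
abbreviation "L \<equiv> bitlen n"
abbreviation "b \<equiv> beta n"
abbreviation "l \<equiv> ell n"
abbreviation "h \<equiv> chunk n"
abbreviation "om \<equiv> bitlen (n + M)"
abbreviation "cap \<equiv> 2 ^ beta n - Suc 0"
abbreviation "aS \<equiv> addr_S w n M"
abbreviation "aREL \<equiv> addr_REL w n M"
abbreviation "aABS \<equiv> addr_ABS w n M"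
abbreviation "aBMP \<equiv> addr_BMP w n M"
abbreviation "aSTK \<equiv> addr_STK w n M"
abbreviation "aCNT \<equiv> addr_CNT w n M"

lemma params:
  "20 \<le> L" "2 * b \<le> L" "h \<le> L" "0 < l" "l * b + l \<le> h" "l * L < 2 ^ b" "h + l < 2 ^ b"
  "L * (2 ^ b + l) \<le> 2 ^ (2 * b)" "2 ^ h * l * b \<le> n" "(n div l + 1) * (2 * b) \<le> n"
  "(n div l div L + 1) * (2 * L) \<le> n" "n div h < 2 ^ h"
  using large unfolding large_def by simp_all

lemma b_pos: "0 < b"
  using bitlen_pos[of L] params(1) by (simp add: beta_def)

lemma h_pos: "0 < h"
  using params(4,5) b_pos by (cases h) auto

lemma n_pos: "0 < n"
  using params(1) by (cases n) (auto simp: bitlen.simps)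

lemma nm_word: "n + M < 2 ^ w" "n < 2 ^ w"
  using size_bound n_pos by auto

lemma L_le_w: "L \<le> w"
  using nm_word by (intro bitlen_le) simp

lemma om_le_w: "om \<le> w"
  using nm_word by (intro bitlen_le)

lemma om_pos: "0 < om"
  using n_pos by (intro bitlen_pos) simp

lemma om_le_2L: "om \<le> 2 * L"
proof (rule bitlen_le)
  have "M \<le> n * n"
    using card_mono[of "{..<n} \<times> {..<n}" E] digraph unfolding digraph_on_def by simp
  then have "n + M \<le> n * Suc n" by simp
  also have "\<dots> < 2 ^ L * 2 ^ L"
    using less_bitlen[of n] by (intro mult_less_le_imp_less) auto
  finally show "n + M < 2 ^ (2 * L)" by (simp add: power_add mult_2)
qed

lemma w_ge: "20 \<le> w"
  using L_le_w params(1) by simp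

lemma w_large: "2 * w < 2 ^ w"
proof -
  have "2 * x < 2 ^ x" if "3 \<le> x" for x :: nat
    using that by (induction x rule: dec_induct) auto
  then show ?thesis using w_ge by simp
qed

lemma cells_le: "k \<le> n + M"
proof -
  define d where "d = (n + M) div w"
  have div: "x div w \<le> d" if "x \<le> n" for x using that unfolding d_def by (intro div_le_mono) simp
  have "(n div l + 1) * b \<le> n" using params(10) by simp
  moreover have "(n div l div L + 1) * om \<le> n"
    using om_le_2L params(11) by (meson le_trans mult_le_mono2)
  ultimately have "k \<le> 7 * d + 10"
    unfolding k cells_def addr_CNT_def addr_STK_def addr_BMP_def addr_ABS_def addr_REL_def addr_S_def
    using div[OF params(9)] div[OF params(10)] div[of "(n div l + 1) * b"]
      div[of "(n div l div L + 1) * om"] div[of n] d_def by simp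
  moreover have "20 * d \<le> n + M"
    using w_ge mult_le_mono1[of 20 w d] unfolding d_def by (meson le_trans times_div_less_eq_dividend)
  moreover have "20 \<le> n"
  proof -
    have "2 ^ (20 - 1) \<le> (2::nat) ^ (L - 1)" using params(1) by (intro power_increasing) auto
    also have "\<dots> \<le> n" using n_pos by (rule bitlen_ge)
    finally show ?thesis by simp
  qed
  ultimately show ?thesis by linarith
qed

sublocale bit_ram w k R
  using w_ge w_large cells_le nm_word by unfold_locales auto

lemma regions:
  "2 ^ h * l * b \<le> aS * w" "aS * w + (n div l + 1) * b \<le> aREL * w"
  "aREL * w + (n div l + 1) * (2 * b) \<le> aABS * w"
  "aABS * w + (n div l div L + 1) * om \<le> aBMP * w" "aBMP * w + n + w \<le> aSTK * w"
  "aSTK * w + n + w \<le> aCNT * w" "aCNT * w + n + M + w \<le> k * w"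
proof -
  have r: "x \<le> (x div w + 1) * w" for x
    by (metis add.commute less_imp_le mult.commute Suc_eq_plus1 dividend_less_times_div w_pos mult_Suc_right add_mult_distrib2 mult_1_right)
  have r2: "x + w \<le> (x div w + 2) * w" for x using r[of x] by (simp add: algebra_simps)
  note d = cells_def addr_CNT_def addr_STK_def addr_BMP_def addr_ABS_def addr_REL_def
  show "2 ^ h * l * b \<le> aS * w" unfolding addr_S_def by (rule r)
  show "aS * w + (n div l + 1) * b \<le> aREL * w"
    unfolding addr_REL_def using r[of "(n div l + 1) * b"] unfolding add_mult_distrib[of _ _ w] by linarith
  show "aREL * w + (n div l + 1) * (2 * b) \<le> aABS * w"
    unfolding addr_ABS_def using r[of "(n div l + 1) * (2 * b)"] unfolding add_mult_distrib[of _ _ w] by linarith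
  show "aABS * w + (n div l div L + 1) * om \<le> aBMP * w"
    unfolding addr_BMP_def using r[of "(n div l div L + 1) * om"] unfolding add_mult_distrib[of _ _ w] by linarith
  show "aBMP * w + n + w \<le> aSTK * w"
    unfolding addr_STK_def using r2[of n] unfolding add_mult_distrib[of _ _ w] by linarith
  show "aSTK * w + n + w \<le> aCNT * w"
    unfolding addr_CNT_def using r2[of n] unfolding add_mult_distrib[of _ _ w] by linarith
  show "aCNT * w + n + M + w \<le> k * w"
    unfolding k cells_def using r2[of "n + M"] unfolding add_mult_distrib[of _ _ w] by linarith
qed

definition bsum :: "nat \<Rightarrow> nat" where
  "bsum B = sum indeg {B * l..<B * l + l}"

definition ssat :: "nat \<Rightarrow> nat" where
  "ssat B = min (bsum B) cap"

definition start :: "nat \<Rightarrow> nat" where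
  "start B = (\<Sum>i<B. ssat i + l)"

definition light :: "nat \<Rightarrow> bool" where
  "light B \<longleftrightarrow> ssat B + l \<le> h"

definition width :: "nat \<Rightarrow> nat" where
  "width B = (if light B then ssat B + l else if ssat B < cap then b else L)"

definition vpos :: "nat \<Rightarrow> nat" where
  "vpos v = start (v div l) + (if light (v div l) then 0 else (v mod l) * width (v div l))"

lemma sum_bsum: "(\<Sum>i<B. bsum i) \<le> M"
proof -
  have "(\<Sum>i<B. bsum i) = sum indeg {..<B * l}"
    unfolding bsum_def by (rule sum.nat_group)
  also have "\<dots> \<le> M" unfolding sum_indeg[OF finite_lessThan] by (intro card_mono finite_E) auto
  finally show ?thesis .
qed

lemma start_le: "start B + ssat B \<le> M + B * l"
proof -
  have "start B + ssat B = (\<Sum>i<Suc B. ssat i) + B * l"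
    unfolding start_def by (simp add: sum.distrib)
  also have "(\<Sum>i<Suc B. ssat i) \<le> (\<Sum>i<Suc B. bsum i)" by (intro sum_mono) (simp add: ssat_def)
  also have "\<dots> \<le> M" by (rule sum_bsum)
  finally show ?thesis by simp
qed

lemma start_Suc: "start (Suc B) = start B + ssat B + l"
  by (simp add: start_def)

lemma start_mono: "B \<le> B' \<Longrightarrow> start B \<le> start B'"
  unfolding start_def by (intro sum_mono2) auto

lemma start_add_le: "start (B + d) \<le> start B + d * (2 ^ b + l)"
proof (induction d)
  case (Suc d)
  have "ssat (B + d) \<le> 2 ^ b" by (simp add: ssat_def min.coboundedI2)
  then show ?case using Suc by (simp add: start_Suc algebra_simps)
qed simp

lemma width_fits:
  "\<not> light B \<Longrightarrow> l * width B \<le> ssat B" "light B \<Longrightarrow> width B = ssat B + l"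
proof -
  assume B: "\<not> light B"
  show "l * width B \<le> ssat B"
  proof (cases "ssat B < cap")
    case True
    then show ?thesis using B params(5) by (simp add: width_def light_def)
  next
    case False
    then have "cap \<le> ssat B" by simp
    then show ?thesis using B params(6) by (simp add: width_def light_def)
  qed
qed (simp add: width_def)

lemma width_bounds: "0 < width B" "width B \<le> w"
  using params b_pos L_le_w by (auto simp: width_def light_def)

lemma block_bounds:
  assumes "v < n"
  shows "v div l < n div l + 1" "v mod l < l" "v div l * l + v mod l = v"
  using assms params(4) by (auto simp: div_le_mono less_Suc_eq_le)

lemma vpos_in_block:
  "start (v div l) \<le> vpos v" "vpos v + width (v div l) \<le> start (v div l) + ssat (v div l) + l"
  "vpos v \<le> start (v div l) + ssat (v div l)"
proof -
  have j: "Suc (v mod l) \<le> l" using params(4) by (simp add: Suc_le_eq)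
  have "v mod l * width (v div l) + width (v div l) \<le> l * width (v div l)"
    using mult_le_mono1[OF j, of "width (v div l)"] by simp
  then show "vpos v + width (v div l) \<le> start (v div l) + ssat (v div l) + l"
    "vpos v \<le> start (v div l) + ssat (v div l)"
    using width_fits[of "v div l"] \<open>v mod l * width (v div l) + width (v div l) \<le> l * width (v div l)\<close>
    unfolding vpos_def by (cases "light (v div l)"; simp)+
qed (simp add: vpos_def)

lemma vpos_bounds:
  assumes "v < n"
  shows "vpos v < n + M" "vpos v + width (v div l) \<le> n + M + w"
proof -
  have 1: "start (v div l) + ssat (v div l) \<le> M + v div l * l" by (rule start_le)
  have 2: "v div l * l \<le> v" by simp
  have 3: "l \<le> w" using params L_le_w by simp
  show "vpos v < n + M" using 1 2 vpos_in_block(3)[of v] assms by linarith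
  show "vpos v + width (v div l) \<le> n + M + w"
    using 1 2 3 vpos_in_block(2)[of v] assms by linarith
qed

definition blk :: "(nat \<Rightarrow> nat) \<Rightarrow> nat \<Rightarrow> nat list" where
  "blk c B = map (\<lambda>j. c (B * l + j)) [0..<l]"

text \<open>The field of a vertex in a light block is the code of the whole block.\<close>

definition cval :: "(nat \<Rightarrow> nat) \<Rightarrow> nat \<Rightarrow> nat" where
  "cval c v = (if light (v div l) then enc (blk c (v div l)) else c v)"

definition counters :: "(nat \<Rightarrow> nat) \<Rightarrow> (nat \<Rightarrow> nat) \<Rightarrow> bool" where
  "counters m c \<longleftrightarrow> (\<forall>v<n. fld w m (aCNT * w + vpos v) (width (v div l)) = cval c v) \<and> (\<forall>v. c v \<le> indeg v)"

lemma blk_simps: "length (blk c B) = l" "j < l \<Longrightarrow> blk c B ! j = c (B * l + j)"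
  by (simp_all add: blk_def)

lemma blk_upd: "blk (c(v := y)) B = (if v div l = B then (blk c B)[v mod l := y] else blk c B)"
proof (rule nth_equalityI)
  fix j assume "j < length (blk (c(v := y)) B)"
  then have j: "j < l" by (simp add: blk_simps)
  then have "B * l + j = v \<longleftrightarrow> v div l = B \<and> v mod l = j" by auto
  then show "blk (c(v := y)) B ! j = (if v div l = B then (blk c B)[v mod l := y] else blk c B) ! j"
    using j by (auto simp: blk_simps nth_list_update)
qed (simp add: blk_simps)

lemma sum_blk: "(\<And>v. c v \<le> indeg v) \<Longrightarrow> sum_list (blk c B) \<le> bsum B"
proof -
  assume c: "\<And>v. c v \<le> indeg v"
  have "sum_list (blk c B) = (\<Sum>j\<in>{0..<l}. c (B * l + j))"
    unfolding blk_def by (simp add: sum_list_distinct_conv_sum_set)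
  also have "\<dots> = sum c {B * l..<B * l + l}"
    using sum.shift_bounds_nat_ivl[of c 0 "B * l" l] by (simp add: add.commute)
  also have "\<dots> \<le> bsum B" unfolding bsum_def by (intro sum_mono c)
  finally show ?thesis .
qed

lemma light_ssat: "light B \<Longrightarrow> ssat B = bsum B"
  using params(4,7) by (auto simp: light_def ssat_def min_def split: if_splits)

lemma indeg_le_bsum: "indeg v \<le> bsum (v div l)"
proof -
  have "v \<in> {v div l * l..<v div l * l + l}" using dividend_less_div_times[OF params(4), of v]
    by (simp add: add.commute)
  then show ?thesis unfolding bsum_def by (intro member_le_sum) auto
qed

lemma cval_less:
  assumes "\<And>v. c v \<le> indeg v"
  shows "cval c v < 2 ^ width (v div l)"
proof (cases "light (v div l)")
  case True
  have "enc (blk c (v div l)) < 2 ^ (sum_list (blk c (v div l)) + l)"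
    using enc_less[of "blk c (v div l)"] by (simp add: blk_simps)
  also have "\<dots> \<le> 2 ^ width (v div l)"
    using sum_blk[OF assms, of "v div l"] light_ssat[OF True] True by (intro power_increasing) (auto simp: width_def)
  finally show ?thesis using True by (simp add: cval_def)
next
  case False
  show ?thesis
  proof (cases "ssat (v div l) < cap")
    case lt: True
    then have "c v < cap" using assms[of v] indeg_le_bsum[of v] by (simp add: ssat_def)
    then show ?thesis using False lt by (simp add: cval_def width_def)
  next
    case ge: False
    have "c v \<le> n" using assms[of v] indeg_le_n[of v] by simp
    then show ?thesis using False ge less_bitlen[of n] by (simp add: cval_def width_def)
  qed
qed

lemma counters_update:
  assumes c: "counters m c" and v: "v < n" and y: "y \<le> indeg v"
    and wr: "written w m m' (aCNT * w + vpos v) (width (v div l)) (cval (c(v := y)) v)"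
  shows "counters m' (c(v := y))"
proof -
  have le: "(c(v := y)) u \<le> indeg u" for u using c y by (simp add: counters_def)
  have "fld w m' (aCNT * w + vpos u) (width (u div l)) = cval (c(v := y)) u" if u: "u < n" for u
  proof (cases "u div l = v div l")
    case same: True
    show ?thesis
    proof (cases "light (v div l) \<or> u = v")
      case True
      then have "vpos u = vpos v" "cval (c(v := y)) u = cval (c(v := y)) v"
        using same by (auto simp: vpos_def cval_def)
      moreover have "fld w m' (aCNT * w + vpos v) (width (v div l)) = cval (c(v := y)) v"
        by (rule written_same[OF wr cval_less]) (rule le)
      ultimately show ?thesis using same by simp
    next
      case False
      then have ne: "u mod l \<noteq> v mod l" using same by (metis div_mult_mod_eq)
      have d: "i * x + x \<le> j * x" if "i < j" for i j x :: nat
        using mult_le_mono1[of "Suc i" j x] that by simp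
      have "aCNT * w + vpos u + width (u div l) \<le> aCNT * w + vpos v \<or>
          aCNT * w + vpos v + width (v div l) \<le> aCNT * w + vpos u"
        using ne d[of "u mod l" "v mod l" "width (v div l)"] d[of "v mod l" "u mod l" "width (v div l)"] False same
        unfolding vpos_def by (cases "u mod l < v mod l") auto
      then have "fld w m' (aCNT * w + vpos u) (width (u div l)) = fld w m (aCNT * w + vpos u) (width (u div l))"
        using written_other[OF wr] by blast
      then show ?thesis using c u False same by (auto simp: counters_def cval_def)
    qed
  next
    case False
    have "start (u div l) + ssat (u div l) + l \<le> start (v div l) \<or> start (v div l) + ssat (v div l) + l \<le> start (u div l)"
      using start_mono[of "Suc (u div l)" "v div l"] start_mono[of "Suc (v div l)" "u div l"] False
      by (simp add: start_Suc) linarith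
    then have "aCNT * w + vpos u + width (u div l) \<le> aCNT * w + vpos v \<or>
          aCNT * w + vpos v + width (v div l) \<le> aCNT * w + vpos u"
      using vpos_in_block(1,2)[of u] vpos_in_block(1,2)[of v] by linarith
    then have "fld w m' (aCNT * w + vpos u) (width (u div l)) = fld w m (aCNT * w + vpos u) (width (u div l))"
      using written_other[OF wr] by blast
    then show ?thesis using c u False by (auto simp: counters_def cval_def blk_upd)
  qed
  then show ?thesis using le by (simp add: counters_def)
qed

end

definition locate :: com where
  "locate =
     (10 \<leftarrow> V 30 \<oslash> V 54) ;; (11 \<leftarrow> V 30 \<ominus> V 10 \<otimes> V 54) ;;
     Get 12 (V 57) (V 10 \<otimes> V 53) (V 53) ;;
     Get 13 (V 59) ((V 10 \<oslash> V 52) \<otimes> V 56) (V 56) ;;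
     Get 14 (V 58) (V 10 \<otimes> V 66) (V 66) ;;
     (13 \<leftarrow> V 13 \<oplus> V 14) ;; (15 \<leftarrow> V 12 \<oplus> V 54) ;;
     IfE (V 55 \<prec> V 15)
       (IfE (V 12 \<prec> V 65) (15 \<leftarrow> V 53) (15 \<leftarrow> V 52) ;; (13 \<leftarrow> V 13 \<oplus> V 11 \<otimes> V 15) ;; (16 \<leftarrow> C 1))
       (16 \<leftarrow> C 0) ;;
     Get 17 (V 62) (V 13) (V 15)"

definition look_up :: com where
  "look_up = Get 18 (C 0) ((V 17 \<otimes> V 54 \<oplus> V 11) \<otimes> V 53) (V 53)"

definition cinc :: com where
  "cinc = locate ;;
     IfE (V 16) (17 \<leftarrow> V 17 \<oplus> C 1)
       (look_up ;; (17 \<leftarrow> V 17 \<oplus> Bin ShiftL (Bin ShiftR (V 17) (V 18) \<oplus> C 1) (V 18))) ;;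
     Put (V 62) (V 13) (V 15) (V 17)"

definition cdec :: com where
  "cdec = locate ;;
     IfE (V 16) (17 \<leftarrow> V 17 \<ominus> C 1)
       (look_up ;; (17 \<leftarrow> V 17 \<ominus> Bin ShiftL (Bin ShiftR (V 17) (V 18) \<oplus> C 1) (V 18 \<ominus> C 1))) ;;
     Put (V 62) (V 13) (V 15) (V 17)"

definition ctest :: com where
  "ctest = locate ;;
     IfE (V 16) (31 \<leftarrow> Bin Equal (V 17) (C 0))
       (look_up ;; (31 \<leftarrow> Bin Equal (Bin BitAnd (Bin ShiftR (V 17 \<oplus> V 17) (V 18)) (C 1)) (C 0)))"

definition cpush :: com where
  "cpush = (10 \<leftarrow> V 30 \<oslash> V 55) ;; Get 11 (V 60) (V 10 \<otimes> V 55) (V 55) ;;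
     IfE (V 11) Skip (Put (V 61) (V 32 \<otimes> V 55) (V 55) (V 10) ;; (32 \<leftarrow> V 32 \<oplus> C 1)) ;;
     Put (V 60) (V 30) (C 1) (C 1)"

definition cpop :: com where
  "cpop = IfE (V 32)
     ((10 \<leftarrow> V 32 \<ominus> C 1) ;; Get 11 (V 61) (V 10 \<otimes> V 55) (V 55) ;;
      Get 12 (V 60) (V 11 \<otimes> V 55) (V 55) ;;
      (12 \<leftarrow> Bin BitXor (V 12) (mask_ex (V 55))) ;;
      Get 13 (C 0) ((V 12 \<otimes> V 54) \<otimes> V 53) (V 53) ;;
      (30 \<leftarrow> V 11 \<otimes> V 55 \<oplus> V 13) ;;
      Put (V 60) (V 30) (C 1) (C 0) ;;
      Get 12 (V 60) (V 11 \<otimes> V 55) (V 55) ;;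
      IfE (V 12) Skip (32 \<leftarrow> V 10) ;; (31 \<leftarrow> C 1))
     (31 \<leftarrow> C 0)"

lemma shift_bound:
  assumes "x + Suc q * 2 ^ p < (N :: nat)"
  shows "q + Suc 0 < N"
proof -
  have "Suc q * 1 \<le> Suc q * 2 ^ p" by (intro mult_le_mono2) simp
  then have "q + Suc 0 \<le> x + Suc q * 2 ^ p" by (intro trans_le_add2) simp
  then show ?thesis using assms by (rule le_less_trans)
qed

context packed
begin

definition pregs :: "(reg \<Rightarrow> nat) \<Rightarrow> bool" where
  "pregs r \<longleftrightarrow> r 50 = n \<and> r 51 = M \<and> r 52 = L \<and> r 53 = b \<and> r 54 = l \<and> r 55 = h \<and> r 56 = om \<and> r 57 = aS \<and>
     r 58 = aREL \<and> r 59 = aABS \<and> r 60 = aBMP \<and> r 61 = aSTK \<and> r 62 = aCNT \<and> r 63 = k \<and> r 65 = cap \<and> r 66 = 2 * b"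

lemma pregs_keep: "pregs r \<Longrightarrow> keep 40 r r' \<Longrightarrow> pregs r'"
  by (simp add: pregs_def keep_def)

definition static :: "(nat \<Rightarrow> nat) \<Rightarrow> bool" where
  "static m \<longleftrightarrow>
     (\<forall>x<2 ^ h. \<forall>j<l. fld w m ((x * l + j) * b) b = sel x j) \<and>
     (\<forall>i\<le>n div l. fld w m (aS * w + i * b) b = ssat i \<and>
        fld w m (aABS * w + i div L * om) om = start (i div L * L) \<and>
        fld w m (aREL * w + i * (2 * b)) (2 * b) = start i - start (i div L * L))"

lemma L_less_w: "h < L" "h < w"
proof -
  have "4 \<le> bitlen L"
  proof (rule ccontr)
    assume "\<not> 4 \<le> bitlen L"
    then have "(2::nat) ^ bitlen L \<le> 2 ^ 3" by (intro power_increasing) auto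
    then show False using less_bitlen[of L] params(1) by simp
  qed
  then show "h < L" using params(1) by (simp add: chunk_def)
  then show "h < w" using L_le_w by simp
qed

lemma tab_index:
  assumes "x < 2 ^ h" "j < l"
  shows "(x * l + j) * b + b \<le> 2 ^ h * l * b"
proof -
  have "Suc x * l \<le> 2 ^ h * l" using assms by (intro mult_le_mono1) simp
  then have "Suc (x * l + j) \<le> 2 ^ h * l" using assms by simp
  then have "Suc (x * l + j) * b \<le> 2 ^ h * l * b" by (rule mult_le_mono1)
  then show ?thesis by simp
qed

lemma block_index:
  assumes "i \<le> n div l"
  shows "i * b + b \<le> (n div l + 1) * b" "i * (2 * b) + 2 * b \<le> (n div l + 1) * (2 * b)"
    "i div L * om + om \<le> (n div l div L + 1) * om"
proof -
  have 1: "Suc i * x \<le> (n div l + 1) * x" for x using assms by (intro mult_le_mono1) simp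
  show "i * b + b \<le> (n div l + 1) * b" "i * (2 * b) + 2 * b \<le> (n div l + 1) * (2 * b)"
    using 1[of b] 1[of "2 * b"] by simp_all
  have "Suc (i div L) * om \<le> (n div l div L + 1) * om"
    using assms by (intro mult_le_mono1) (simp add: div_le_mono)
  then show "i div L * om + om \<le> (n div l div L + 1) * om" by simp
qed

lemma small_bounds: "(n div l + 1) * b \<le> n" "(n div l div L + 1) * om \<le> n"
proof -
  show "(n div l + 1) * b \<le> n" using params(10) by simp
  show "(n div l div L + 1) * om \<le> n"
    using om_le_2L params(11) by (meson le_trans mult_le_mono2)
qed

lemma static_cong:
  assumes "static m" "\<And>P. P < aBMP * w \<Longrightarrow> bitat w m' P = bitat w m P"
  shows "static m'"
proof -
  have f: "fld w m' P x = fld w m P x" if "P + x \<le> aBMP * w" for P x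
    by (rule fld_cong) (use that assms(2) in auto)
  have ends: "2 ^ h * l * b \<le> aBMP * w" "aS * w + (n div l + 1) * b \<le> aBMP * w"
    "aREL * w + (n div l + 1) * (2 * b) \<le> aBMP * w" "aABS * w + (n div l div L + 1) * om \<le> aBMP * w"
    using regions by linarith+
  show ?thesis
    unfolding static_def
  proof (intro conjI allI impI)
    fix x j :: nat assume x: "x < 2 ^ h" "j < l"
    have "(x * l + j) * b + b \<le> aBMP * w" using ends tab_index[OF x] by linarith
    then show "fld w m' ((x * l + j) * b) b = sel x j"
      using assms(1) x by (simp add: f static_def)
  next
    fix i assume i: "i \<le> n div l"
    have "aS * w + i * b + b \<le> aBMP * w" using block_index[OF i] ends by linarith
    then show "fld w m' (aS * w + i * b) b = ssat i"
      using assms(1) i by (simp add: f static_def)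
    have "aABS * w + i div L * om + om \<le> aBMP * w" using block_index[OF i] ends by linarith
    then show "fld w m' (aABS * w + i div L * om) om = start (i div L * L)"
      using assms(1) i by (simp add: f static_def)
    have "aREL * w + i * (2 * b) + 2 * b \<le> aBMP * w" using block_index[OF i] ends by linarith
    then show "fld w m' (aREL * w + i * (2 * b)) (2 * b) = start i - start (i div L * L)"
      using assms(1) i by (simp add: f static_def)
  qed
qed

lemma wp_locate:
  assumes p: "pregs r" and st: "static m" and c: "counters m c" and v: "r 30 = v" "v < n" and wd: "words m"
    and Q: "\<And>\<tau>' r'. \<tau>' \<le> \<tau> + 450 \<Longrightarrow> keep 40 r r' \<Longrightarrow> pregs r' \<Longrightarrow> r' 32 = r 32 \<Longrightarrow> r' 30 = v \<Longrightarrow> r' 11 = v mod l \<Longrightarrow> r' 13 = vpos v \<Longrightarrow>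
       r' 15 = width (v div l) \<Longrightarrow> (r' 16 \<noteq> 0 \<longleftrightarrow> \<not> light (v div l)) \<Longrightarrow> r' 17 = cval c v \<Longrightarrow> Q \<tau>' r' m o'"
  shows "wp locate Q \<tau> r m o'"
proof -
  define i where "i = v div l"
  have i: "i \<le> n div l" using block_bounds[OF v(2)] by (simp add: i_def)
  have regs: "r 50 = n" "r 52 = L" "r 53 = b" "r 54 = l" "r 55 = h" "r 56 = om" "r 57 = aS"
    "r 58 = aREL" "r 59 = aABS" "r 62 = aCNT" "r 65 = cap" "r 66 = 2 * b" using p by (simp_all add: pregs_def)
  note bi = block_index[OF i]
  have vw: "v < 2 ^ w" using v nm_word by simp
  have il: "i * l \<le> v" by (simp add: i_def)
  have e1: "word_op w Times i l = i * l" using il vw by (intro word_op_Times) simp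
  have e2: "word_op w Minus v (i * l) = v mod l"
    using il vw by (subst word_op_Minus) (auto simp: i_def minus_div_mult_eq_mod le_less_trans[OF mod_less_eq_dividend])
  have e3: "word_op w Times i b = i * b" using bi small_bounds nm_word by (intro word_op_Times) linarith
  have e4: "word_op w Times i (2 * b) = i * (2 * b)" using bi params(10) nm_word by (intro word_op_Times) linarith
  have e5: "word_op w Times (i div L) om = i div L * om" using bi small_bounds nm_word by (intro word_op_Times) linarith
  have sl: "start (i div L * L) \<le> start i" by (intro start_mono) simp
  have sb: "start i < 2 ^ w" using start_le[of i] il v(2) nm_word by linarith
  have e6: "word_op w Plus (start (i div L * L)) (start i - start (i div L * L)) = start i"
    using sl sb by (subst word_op_Plus) auto
  have lw: "l + 2 ^ b \<le> 2 ^ w"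
  proof -
    have "l \<le> L" using params(3,5) by simp
    moreover have "2 ^ b * 2 \<le> (2 :: nat) ^ w"
      using params(2) L_le_w b_pos power_increasing[of "Suc b" w "2 :: nat"] by simp
    moreover have "L < 2 ^ b"
    proof -
      have "1 * L \<le> l * L" using params(4) by (intro mult_le_mono1) simp
      then show ?thesis using params(6) by linarith
    qed
    ultimately show ?thesis by linarith
  qed
  have sc: "ssat i < 2 ^ b" by (rule le_less_trans[of _ cap]) (simp_all add: ssat_def)
  have e7: "word_op w Plus (ssat i) l = ssat i + l" using lw sc by (intro word_op_Plus) linarith
  have fS: "fld w m (aS * w + i * b) b = ssat i" "fld w m (aABS * w + i div L * om) om = start (i div L * L)"
    "fld w m (aREL * w + i * (2 * b)) (2 * b) = start i - start (i div L * L)"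
    using st i by (simp_all add: static_def)
  have lt: "i * b < 2 ^ w" "i div L * om < 2 ^ w" "i * (2 * b) < 2 ^ w"
    using bi small_bounds params(10) nm_word by linarith+
  have kb: "aS * w + i * b + b \<le> k * w" "aABS * w + i div L * om + om \<le> k * w"
    "aREL * w + i * (2 * b) + 2 * b \<le> k * w"
    using bi regions by linarith+
  have vb: "vpos v < 2 ^ w" "aCNT * w + vpos v + width i \<le> k * w"
    using vpos_bounds[OF v(2)] nm_word regions(7) by (simp_all add: i_def)
  have e8: "word_op w Times (v mod l) (width i) = v mod l * width i"
    "word_op w Plus (start i) (v mod l * width i) = vpos v" if "\<not> light i"
    using that vb(1) by (auto simp: word_op_Times word_op_Plus vpos_def i_def[symmetric])
  have cv: "fld w m (aCNT * w + vpos v) (width i) = cval c v"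
    using c v by (simp add: counters_def i_def)
  note Q' = Q[folded i_def]
  have width_i: "\<not> light i \<Longrightarrow> width i = (if ssat i < cap then b else L)" by (simp add: width_def)
  show ?thesis
    unfolding locate_def
    apply (rule wp_seq, rule wp_assign, simp)
    apply (rule wp_seq, rule wp_assign, simp)
    apply (simp add: regs v i_def[symmetric] e1 e2)
    apply (rule wp_seq, rule wp_Get; (simp add: regs wd)?)
    subgoal using lt by (simp add: e3)
    subgoal using kb by (simp add: e3)
    subgoal by (rule b_pos)
    subgoal using params(2) L_le_w by simp
    apply (simp add: e3 fS)
    apply (rule wp_seq, rule wp_Get; (simp add: regs wd)?)
    subgoal using lt by (simp add: e5)
    subgoal using kb by (simp add: e5)
    subgoal by (rule om_pos)
    subgoal by (rule om_le_w)
    apply (simp add: e5 fS)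
    apply (rule wp_seq, rule wp_Get; (simp add: regs wd)?)
    subgoal using lt by (simp add: e4)
    subgoal using kb by (simp add: e4)
    subgoal by (rule b_pos)
    subgoal using params(2) L_le_w by simp
    apply (simp add: e4 fS)
    apply (rule wp_seq, rule wp_assign, simp)
    apply (simp add: e6)
    apply (rule wp_seq, rule wp_assign, simp)
    apply (simp add: e7 regs)
    apply (rule wp_seq, rule wp_if, simp)
    subgoal
    proof goal_cases
      case 1
      note t1 = 1
      have nl: "\<not> light i" using 1 by (simp add: word_op_Less regs light_def)
      show ?case
        apply (rule wp_seq, rule wp_if, simp)
        subgoal
        proof goal_cases
          case 1
          then have wi: "width i = b" using nl by (simp add: word_op_Less regs width_i)
          show ?case
            apply (rule wp_assign, simp)
            apply (rule wp_seq, rule wp_assign, simp)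
            apply (rule wp_assign, simp)
            apply (rule wp_Get; (simp add: regs wd)?)
            using t1 nl vb[unfolded wi] width_bounds[of i, unfolded wi] cv[unfolded wi]
            by (simp_all add: word_op_Less regs wi e8[OF nl, unfolded wi] take_bit_one v Q' pregs_keep[OF p])
        qed
        subgoal
        proof goal_cases
          case 1
          then have wi: "width i = L" using nl by (simp add: word_op_Less regs width_i)
          show ?case
            apply (rule wp_assign, simp)
            apply (rule wp_seq, rule wp_assign, simp)
            apply (rule wp_assign, simp)
            apply (rule wp_Get; (simp add: regs wd)?)
            using t1 nl vb[unfolded wi] width_bounds[of i, unfolded wi] cv[unfolded wi]
            by (simp_all add: word_op_Less regs wi e8[OF nl, unfolded wi] take_bit_one v Q' pregs_keep[OF p])
        qed
        done
    qed
    subgoal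
    proof goal_cases
      case 1
      then have li: "light i" by (simp add: word_op_Less regs light_def)
      then have vp: "vpos v = start i" by (simp add: vpos_def i_def)
      show ?case
        apply (rule wp_assign, simp)
        apply (rule wp_Get; (simp add: regs wd)?)
        using 1 li vb width_bounds[of i] cv
        by (simp_all add: word_op_Less regs width_def v vp Q' pregs_keep[OF p])
    qed
    done
qed

lemma counters_cong:
  assumes "counters m c" "\<And>P. aCNT * w \<le> P \<Longrightarrow> bitat w m' P = bitat w m P"
  shows "counters m' c"
proof -
  have "fld w m' (aCNT * w + x) y = fld w m (aCNT * w + x) y" for x y
    by (rule fld_cong) (use assms(2) in auto)
  then show ?thesis using assms(1) by (simp add: counters_def)
qed

definition ready :: "(nat \<Rightarrow> nat) \<Rightarrow> nat \<Rightarrow> nat set \<Rightarrow> bool" where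
  "ready m sp A \<longleftrightarrow> A \<subseteq> {..<n} \<and> (\<forall>v<n + w. bitat w m (aBMP * w + v) \<longleftrightarrow> v \<in> A) \<and>
     (\<exists>cs. distinct cs \<and> sp = length cs \<and> set cs = (\<lambda>v. v div h) ` A \<and>
        (\<forall>i<sp. fld w m (aSTK * w + i * h) h = cs ! i))"

lemma ready_cong:
  assumes "ready m sp A" "\<And>P. P < aCNT * w \<Longrightarrow> bitat w m' P = bitat w m P"
  shows "ready m' sp A"
proof -
  obtain cs where cs: "distinct cs" "sp = length cs" "set cs = (\<lambda>v. v div h) ` A"
    "\<And>i. i < sp \<Longrightarrow> fld w m (aSTK * w + i * h) h = cs ! i" and A: "A \<subseteq> {..<n}"
    "\<And>v. v < n + w \<Longrightarrow> bitat w m (aBMP * w + v) \<longleftrightarrow> v \<in> A"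
    using assms(1) unfolding ready_def by blast
  have "bitat w m' (aBMP * w + v) \<longleftrightarrow> v \<in> A" if "v < n + w" for v
    using that A(2)[OF that] assms(2)[of "aBMP * w + v"] regions by simp
  moreover have "fld w m' (aSTK * w + i * h) h = cs ! i" if "i < sp" for i
  proof -
    have "length cs \<le> Suc (n div h)"
    proof -
      have "set cs \<subseteq> {..n div h}" using cs(3) A(1) by (auto intro!: div_le_mono)
      from card_mono[OF _ this] show ?thesis using cs(1) by (simp add: distinct_card)
    qed
    then have "i * h \<le> n div h * h" using that cs(2) by (intro mult_le_mono1) simp
    then have "i * h \<le> n" by (meson le_trans div_times_less_eq_dividend)
    then have "fld w m (aSTK * w + i * h) h = fld w m' (aSTK * w + i * h) h"
    proof (intro fld_cong)
      fix P assume "aSTK * w + i * h \<le> P" "P < aSTK * w + i * h + h"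
      then have "P < aCNT * w" using \<open>i * h \<le> n\<close> regions(6) L_less_w(2) by linarith
      then show "bitat w m P = bitat w m' P" using assms(2) by simp
    qed
    then show ?thesis using cs(4)[OF that] by simp
  qed
  ultimately show ?thesis unfolding ready_def using A(1) cs by blast
qed

definition crep :: "(reg \<Rightarrow> nat) \<Rightarrow> (nat \<Rightarrow> nat) \<Rightarrow> (nat \<Rightarrow> nat) \<Rightarrow> nat set \<Rightarrow> nat set \<Rightarrow> bool" where
  "crep r m c A D \<longleftrightarrow> pregs r \<and> words m \<and> static m \<and> counters m c \<and> ready m (r 32) A"

lemma width_light: "light (v div l) \<Longrightarrow> width (v div l) \<le> h"
  by (simp add: width_def light_def)

lemma wp_look_up:
  assumes r: "r 17 = x" "r 54 = l" "r 11 = j" "r 53 = b" and x: "x < 2 ^ h" "j < l" and st: "static m" "words m"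
    and Q: "\<And>\<tau>' i. \<tau>' \<le> \<tau> + 90 \<Longrightarrow> Q \<tau>' (junk i (r(18 := sel x j))) m o'"
  shows "wp look_up Q \<tau> r m o'"
proof -
  have t: "(x * l + j) * b + b \<le> n" using tab_index[OF x] params(9) by linarith
  have le: "x * l + j \<le> (x * l + j) * b" using b_pos by (cases b) auto
  have e: "word_op w Times x l = x * l" using t le nm_word by (intro word_op_Times) linarith
  have e': "word_op w Plus (x * l) j = x * l + j" using t le nm_word by (intro word_op_Plus) linarith
  have e'': "word_op w Times (x * l + j) b = (x * l + j) * b" using t nm_word by (intro word_op_Times) linarith
  have z: "take_bit w 0 = (0::nat)" by simp
  have kb: "(x * l + j) * b + b \<le> k * w" using tab_index[OF x] regions by linarith
  have f: "fld w m ((x * l + j) * b) b = sel x j" using st x by (simp add: static_def)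
  show ?thesis
    unfolding look_up_def
    apply (rule wp_Get; (simp add: r e e' e'' st)?)
    subgoal using t nm_word by linarith
    subgoal using kb by simp
    subgoal by (rule b_pos)
    subgoal using params(2) L_le_w by simp
    subgoal by (rule Q[unfolded f[symmetric], simplified]) simp
    done
qed

lemma wp_write_counter:
  assumes p: "pregs r" "r 13 = vpos v" "r 15 = width (v div l)" "r 17 = cval (c(v := y)) v"
    and v: "v < n" and y: "y \<le> indeg v"
    and rep: "words m" "static m" "counters m c" "ready m (r 32) A"
    and Q: "\<And>\<tau>' i m'. \<tau>' \<le> \<tau> + 100 \<Longrightarrow> crep (junk i r) m' (c(v := y)) A D \<Longrightarrow> Q \<tau>' (junk i r) m' o'"
  shows "wp (Put (V 62) (V 13) (V 15) (V 17)) Q \<tau> r m o'"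
proof -
  have r62: "r 62 = aCNT" using p by (simp add: pregs_def)
  have le: "(c(v := y)) u \<le> indeg u" for u using rep(3) y by (simp add: counters_def)
  show ?thesis
    apply (rule wp_Put; (simp add: p r62 rep)?)
    subgoal using vpos_bounds[OF v] nm_word by linarith
    subgoal using vpos_bounds[OF v] regions by linarith
    subgoal by (rule width_bounds)
    subgoal by (rule width_bounds)
    subgoal by (rule cval_less) (rule le)
    subgoal for \<tau>' j m'
    proof (rule Q, simp, goal_cases)
      case 1
      have b: "bitat w m' P = bitat w m P" if "P < aCNT * w" for P
        using 1(3) that by (simp add: written_def)
      have "static m'" by (rule static_cong[OF rep(2)]) (use b regions in auto)
      moreover have "ready m' (r 32) A" by (rule ready_cong[OF rep(4)]) (use b in auto)
      moreover have "counters m' (c(v := y))" by (rule counters_update[OF rep(3) v y 1(3)])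
      ultimately show ?case using 1 p(1) unfolding crep_def by (auto simp: pregs_def)
    qed
    done
qed

lemma wp_cinc:
  assumes rep: "crep r m c A D" and v: "r 30 < n" and c: "c (r 30) < indeg (r 30)"
  shows "wp cinc (\<lambda>\<tau>' r' m' o'. \<tau>' \<le> \<tau> + 1000 \<and> keep 40 r r' \<and> o' = out0 \<and>
        crep r' m' (c(r 30 := Suc (c (r 30)))) A D) \<tau> r m out0"
proof -
  define v where "v = r 30"
  have R: "pregs r" "words m" "static m" "counters m c" "ready m (r 32) A" using rep by (simp_all add: crep_def)
  have vn: "v < n" and cv: "Suc (c v) \<le> indeg v" using assms by (simp_all add: v_def)
  let ?c = "c(v := Suc (c v))"
  have le: "?c u \<le> indeg u" for u using R(4) cv by (simp add: counters_def)
  have new: "cval ?c v < 2 ^ w" using cval_less[of ?c v, OF le] width_bounds(2)[of "v div l"]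
    by (meson less_le_trans power_increasing one_le_numeral)
  show ?thesis
    unfolding cinc_def
    apply (rule wp_seq, rule wp_locate[OF R(1,3,4) v_def[symmetric] vn R(2)])
    apply (rule wp_seq, rule wp_if, simp)
    subgoal for \<tau>1 r1
    proof goal_cases
      case 1
      have nl: "\<not> light (v div l)" using 1 by simp
      have e: "word_op w Plus (cval c v) (Suc 0) = cval ?c v"
        using nl new by (subst word_op_Plus) (auto simp: cval_def)
      show ?case
        apply (rule wp_assign, simp)
        apply (rule wp_write_counter[where v = v and c = c and y = "Suc (c v)" and A = A and D = D])
        using 1 R vn cv by (simp_all add: e take_bit_one v_def[symmetric] pregs_def)
    qed
    subgoal for \<tau>1 r1
    proof goal_cases
      case 1
      have li: "light (v div l)" using 1 by simp
      let ?x = "cval c v"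
      have x: "?x < 2 ^ h" using cval_less[of c v] R(4) width_light[OF li]
        unfolding counters_def by (meson less_le_trans power_increasing one_le_numeral)
      have len: "v mod l < length (blk c (v div l))" using block_bounds(2)[OF vn] by (simp add: blk_simps)
      have nth: "blk c (v div l) ! (v mod l) = c v" using block_bounds(2,3)[OF vn] by (simp add: blk_simps)
      let ?p = "sel ?x (v mod l)"
      have eq: "cval ?c v = ?x + Suc (?x div 2 ^ ?p) * 2 ^ ?p"
        using enc_inc[OF len] li by (simp add: cval_def blk_upd nth)
      have e1: "word_op w Plus (?x div 2 ^ ?p) (Suc 0) = Suc (?x div 2 ^ ?p)"
        using new unfolding eq by (subst word_op_Plus[OF shift_bound]) simp_all
      have e2: "word_op w ShiftL (Suc (?x div 2 ^ ?p)) ?p = Suc (?x div 2 ^ ?p) * 2 ^ ?p"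
        using new unfolding eq by (simp add: word_op.simps push_bit_eq_mult take_bit_small)
      have e3: "word_op w Plus ?x (Suc (?x div 2 ^ ?p) * 2 ^ ?p) = cval ?c v"
        using new unfolding eq by (rule word_op_Plus)
      show ?case
        apply (rule wp_seq, rule wp_look_up[where x = ?x and j = "v mod l"])
        using 1 R x block_bounds(2)[OF vn] apply (simp_all add: pregs_def)[8]
        apply (rule wp_assign, simp)
        apply (rule wp_write_counter[where v = v and c = c and y = "Suc (c v)" and A = A and D = D])
        using 1 R vn cv by (simp_all add: e1 e2 e3 drop_bit_eq_div take_bit_one v_def[symmetric] pregs_def del: mult_Suc)
    qed
    done
qed


lemma light_code:
  assumes "counters m c" "v < n" "light (v div l)"
  shows "cval c v < 2 ^ h" "v mod l < length (blk c (v div l))" "blk c (v div l) ! (v mod l) = c v"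
    "cval c v = enc (blk c (v div l))"
proof -
  show "cval c v < 2 ^ h" using cval_less[of c v] assms(1) width_light[OF assms(3)]
    unfolding counters_def by (meson less_le_trans power_increasing one_le_numeral)
  show "v mod l < length (blk c (v div l))" using block_bounds(2)[OF assms(2)] by (simp add: blk_simps)
  show "blk c (v div l) ! (v mod l) = c v" using block_bounds(2,3)[OF assms(2)] by (simp add: blk_simps)
  show "cval c v = enc (blk c (v div l))" using assms(3) by (simp add: cval_def)
qed

lemma cval_word:
  assumes "counters m c"
  shows "cval c v < 2 ^ w"
  using cval_less[of c v] assms width_bounds(2)[of "v div l"] unfolding counters_def
  by (meson less_le_trans power_increasing one_le_numeral)

lemma wp_cdec:
  assumes rep: "crep r m c A D" and v: "r 30 < n" and c: "0 < c (r 30)"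
  shows "wp cdec (\<lambda>\<tau>' r' m' o'. \<tau>' \<le> \<tau> + 1000 \<and> keep 40 r r' \<and> r' 30 = r 30 \<and> o' = out0 \<and>
        crep r' m' (c(r 30 := c (r 30) - 1)) A D) \<tau> r m out0"
proof -
  define v where "v = r 30"
  have R: "pregs r" "words m" "static m" "counters m c" "ready m (r 32) A" using rep by (simp_all add: crep_def)
  have vn: "v < n" and cv: "c v - 1 \<le> indeg v" using v R(4) by (auto simp: v_def counters_def intro: le_trans[OF diff_le_self])
  let ?c = "c(v := c v - 1)"
  show ?thesis
    unfolding cdec_def
    apply (rule wp_seq, rule wp_locate[OF R(1,3,4) v_def[symmetric] vn R(2)])
    apply (rule wp_seq, rule wp_if, simp)
    subgoal for \<tau>1 r1
    proof goal_cases
      case 1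
      have nl: "\<not> light (v div l)" using 1 by simp
      have e: "word_op w Minus (cval c v) (Suc 0) = cval ?c v"
        using nl cval_word[OF R(4), of v] c by (subst word_op_Minus) (auto simp: cval_def v_def)
      show ?case
        apply (rule wp_assign, simp)
        apply (rule wp_write_counter[where v = v and c = c and y = "c v - 1" and A = A and D = D])
        using 1 R vn cv by (simp_all add: e take_bit_one v_def[symmetric] pregs_def)
    qed
    subgoal for \<tau>1 r1
    proof goal_cases
      case 1
      have li: "light (v div l)" using 1 by simp
      note lc = light_code[OF R(4) vn li]
      let ?x = "cval c v"
      let ?p = "sel ?x (v mod l)"
      have eq: "0 < ?p" "?x = cval ?c v + Suc (?x div 2 ^ ?p) * 2 ^ (?p - 1)"
        using enc_dec[OF lc(2)] lc(3) c li by (simp_all add: cval_def blk_upd v_def del: mult_Suc)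
      have new: "cval ?c v + Suc (?x div 2 ^ ?p) * 2 ^ (?p - 1) < 2 ^ w"
        using cval_word[OF R(4), of v] eq(2) by simp
      have e1: "word_op w Plus (?x div 2 ^ ?p) (Suc 0) = Suc (?x div 2 ^ ?p)"
        by (subst word_op_Plus[OF shift_bound[OF new]]) simp
      have lt: "Suc (?x div 2 ^ ?p) * 2 ^ (?p - 1) < 2 ^ w" by (rule le_less_trans[OF le_add2 new])
      have e2: "word_op w ShiftL (Suc (?x div 2 ^ ?p)) (?p - 1) = Suc (?x div 2 ^ ?p) * 2 ^ (?p - 1)"
        using lt by (simp add: word_op.simps push_bit_eq_mult take_bit_small del: mult_Suc)
      have e3: "word_op w Minus ?x (Suc (?x div 2 ^ ?p) * 2 ^ (?p - 1)) = cval ?c v"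
      proof -
        have d: "?x - Suc (?x div 2 ^ ?p) * 2 ^ (?p - 1) = cval ?c v" using eq(2) by linarith
        have "Suc (?x div 2 ^ ?p) * 2 ^ (?p - 1) \<le> ?x" using eq(2) by linarith
        from word_op_Minus[OF this, of w] show ?thesis unfolding d using new by linarith
      qed
      have pw: "?p < 2 ^ w"
      proof -
        have "?p \<le> h + l" using sel_less[OF lc(1), of "v mod l"] block_bounds(2)[OF vn] by linarith
        also have "h + l < 2 ^ b" by (rule params(7))
        also have "(2::nat) ^ b \<le> 2 ^ w" using params(2) L_le_w by (intro power_increasing) auto
        finally show ?thesis .
      qed
      have e4: "word_op w Minus ?p (Suc 0) = ?p - 1"
        using eq(1) pw by (subst word_op_Minus) auto
      show ?case
        apply (rule wp_seq, rule wp_look_up[where x = ?x and j = "v mod l"])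
        using 1 R lc(1) block_bounds(2)[OF vn] apply (simp_all add: pregs_def)[8]
        apply (rule wp_assign, simp)
        apply (rule wp_write_counter[where v = v and c = c and y = "c v - 1" and A = A and D = D])
        using 1 R vn cv
        by (simp_all add: e1 e2[simplified] e3[simplified] e4[simplified] drop_bit_eq_div take_bit_one v_def[symmetric] pregs_def del: mult_Suc)
    qed
    done
qed

lemma wp_ctest:
  assumes rep: "crep r m c A D" and v: "r 30 < n"
  shows "wp ctest (\<lambda>\<tau>' r' m' o'. \<tau>' \<le> \<tau> + 1000 \<and> keep 40 r r' \<and> r' 30 = r 30 \<and> o' = out0 \<and>
        (r' 31 \<noteq> 0 \<longleftrightarrow> c (r 30) = 0) \<and> crep r' m' c A D) \<tau> r m out0"
proof -
  define v where "v = r 30"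
  have R: "pregs r" "words m" "static m" "counters m c" "ready m (r 32) A" using rep by (simp_all add: crep_def)
  have vn: "v < n" using v by (simp add: v_def)
  show ?thesis
    unfolding ctest_def
    apply (rule wp_seq, rule wp_locate[OF R(1,3,4) v_def[symmetric] vn R(2)])
    apply (rule wp_if, simp)
    subgoal for \<tau>1 r1
    proof goal_cases
      case 1
      have nl: "\<not> light (v div l)" using 1 by simp
      show ?case
        apply (rule wp_assign, simp)
        using 1 R nl by (simp add: crep_def word_op_Equal cval_def v_def[symmetric] pregs_def)
    qed
    subgoal for \<tau>1 r1
    proof goal_cases
      case 1
      have li: "light (v div l)" using 1 by simp
      note lc = light_code[OF R(4) vn li]
      let ?x = "cval c v"
      have "2 ^ Suc h \<le> (2 :: nat) ^ w" using L_less_w by (intro power_increasing) auto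
      then have "?x + ?x < 2 ^ w" using lc(1) by simp
      then have e: "word_op w Plus ?x ?x = 2 * ?x" by (subst word_op_Plus) auto
      have z: "(2 * ?x) div 2 ^ sel ?x (v mod l) mod 2 = 0 \<longleftrightarrow> c v = 0"
        using enc_zero[OF lc(2)] lc(3,4) by (simp add: even_iff_mod_2_eq_zero)
      show ?case
        apply (rule wp_seq, rule wp_look_up[where x = ?x and j = "v mod l"])
        using 1 R lc(1) block_bounds(2)[OF vn] apply (simp_all add: pregs_def)[8]
        apply (rule wp_assign, simp)
        using 1 R z by (simp add: crep_def word_op_Equal e drop_bit_eq_div and_one_eq take_bit_one v_def[symmetric] pregs_def)
    qed
    done
qed


lemma chunk_pos:
  assumes "v < n"
  shows "v div h * h \<le> v" "v div h * h + v mod h = v" "v mod h < h" "v div h < 2 ^ h" "v div h * h + h \<le> n + w"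
proof -
  show le: "v div h * h \<le> v" by simp
  show "v div h * h + v mod h = v" "v mod h < h" using h_pos by simp_all
  have "v div h \<le> n div h" using assms by (intro div_le_mono) simp
  then show "v div h < 2 ^ h" using params(12) by linarith
  show "v div h * h + h \<le> n + w" using le assms L_less_w by linarith
qed

lemma wp_cpush:
  assumes rep: "crep r m c A D" and v: "r 30 < n" and new: "r 30 \<notin> A"
  shows "wp cpush (\<lambda>\<tau>' r' m' o'. \<tau>' \<le> \<tau> + 1000 \<and> keep 40 r r' \<and> o' = out0 \<and>
        crep r' m' c (insert (r 30) A) D) \<tau> r m out0"
proof -
  define v where "v = r 30"
  define i where "i = v div h"
  have R: "pregs r" "words m" "static m" "counters m c" "ready m (r 32) A" using rep by (simp_all add: crep_def)
  have vn: "v < n" and vA: "v \<notin> A" using v new by (simp_all add: v_def)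
  note cp = chunk_pos[OF vn, folded i_def]
  obtain cs where cs: "distinct cs" "r 32 = length cs" "set cs = (\<lambda>v. v div h) ` A"
    "\<And>i. i < length cs \<Longrightarrow> fld w m (aSTK * w + i * h) h = cs ! i" and A: "A \<subseteq> {..<n}"
    "\<And>v. v < n + w \<Longrightarrow> bitat w m (aBMP * w + v) \<longleftrightarrow> v \<in> A"
    using R(5) unfolding ready_def by auto
  have regs: "r 55 = h" "r 60 = aBMP" "r 61 = aSTK" using R(1) by (simp_all add: pregs_def)
  let ?f = "fld w m (aBMP * w + i * h) h"
  have f0: "?f = 0 \<longleftrightarrow> i \<notin> set cs"
  proof -
    have bit: "bit ?f j \<longleftrightarrow> j < h \<and> i * h + j \<in> A" for j
      using A(2)[of "i * h + j"] cp(5) by (auto simp: bit_fld add.assoc)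
    have "?f = 0 \<longleftrightarrow> (\<forall>j<h. i * h + j \<notin> A)"
      by (metis bit bit_0_eq bit_eqI bot_apply bot_bool_def)
    also have "\<dots> \<longleftrightarrow> i \<notin> set cs"
    proof
      assume *: "\<forall>j<h. i * h + j \<notin> A"
      show "i \<notin> set cs"
      proof
        assume "i \<in> set cs"
        then obtain u where "u \<in> A" "i = u div h" using cs(3) by auto
        then show False using *[rule_format, of "u mod h"] h_pos by simp
      qed
    next
      assume i: "i \<notin> set cs"
      show "\<forall>j<h. i * h + j \<notin> A"
      proof (intro allI impI notI)
        fix j assume "j < h" "i * h + j \<in> A"
        then have "(i * h + j) div h \<in> set cs" using cs(3) by blast
        then show False using i \<open>j < h\<close> by simp
      qed
    qed
    finally show ?thesis .
  qed
  have ih: "i * h < 2 ^ w" using cp(1) vn nm_word by linarith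
  have e1: "word_op w Times i h = i * h" using ih by (rule word_op_Times)
  have len: "length cs * h \<le> n - 1" if "i \<notin> set cs"
  proof -
    have "set (i # cs) \<subseteq> {..(n - 1) div h}" using cs(3) A(1) vn unfolding i_def
      by (auto intro!: div_le_mono)
    from card_mono[OF _ this] have "length cs \<le> (n - 1) div h" using cs(1) that by (simp add: distinct_card)
    then have "length cs * h \<le> (n - 1) div h * h" by (rule mult_le_mono1)
    then show ?thesis by (meson le_trans div_times_less_eq_dividend)
  qed
  have push_rep: "crep (junk ja ra) mb c (insert v A) D"
    if t: "pregs ra" "words mb" "ra 32 = length ds" "written w ma mb (aBMP * w + v) (Suc 0) (Suc 0)"
      "\<And>P. P < aSTK * w \<or> aCNT * w \<le> P \<Longrightarrow> bitat w ma P = bitat w m P"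
      "distinct ds" "set ds = insert i (set cs)"
      "\<And>i. i < length ds \<Longrightarrow> fld w ma (aSTK * w + i * h) h = ds ! i" for ra ma mb ds ja
  proof -
    have b2: "bitat w mb P = bitat w m P" if P: "P < aBMP * w \<or> aCNT * w \<le> P" for P
    proof -
      have "bitat w mb P = bitat w ma P" using P t(4) vn regions unfolding written_def by auto
      then show ?thesis using t(5)[of P] P regions by auto
    qed
    have st: "static mb" by (rule static_cong[OF R(3)]) (use b2 in auto)
    have ct: "counters mb c" by (rule counters_cong[OF R(4)]) (use b2 in auto)
    have bm: "bitat w mb (aBMP * w + u) \<longleftrightarrow> u \<in> insert v A" if u: "u < n + w" for u
    proof -
      have "bitat w ma (aBMP * w + u) = bitat w m (aBMP * w + u)" using t(5) u regions by auto
      then show ?thesis using t(4) A(2)[OF u] by (auto simp: written_def bit_Suc_0_iff)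
    qed
    have "fld w mb (aSTK * w + x) y = fld w ma (aSTK * w + x) y" for x y
      by (rule written_other[OF t(4)]) (use vn regions in auto)
    then have "ready mb (ra 32) (insert v A)"
      unfolding ready_def using bm A(1) vn t cs(3) by (intro conjI exI[of _ ds]) (auto simp: i_def)
    then show ?thesis using t st ct by (simp add: crep_def pregs_def)
  qed
  have bk: "aBMP * w + v + 1 \<le> k * w" "aBMP * w + i * h + h \<le> k * w" using vn cp(5) regions by linarith+
  show ?thesis
    unfolding cpush_def
    apply (rule wp_seq, rule wp_assign, simp)
    apply (simp add: regs v_def[symmetric] i_def[symmetric])
    apply (rule wp_seq, rule wp_Get; (simp add: regs R)?)
    subgoal using ih by (simp add: e1)
    subgoal using bk by (simp add: e1)
    subgoal by (rule h_pos)
    subgoal using L_less_w by simp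
    apply (simp add: e1)
    apply (rule wp_seq, rule wp_if, simp)
    subgoal for \<tau>1 j1
    proof goal_cases
      case 1
      have i: "i \<in> set cs" using 1 f0 by auto
      show ?case
        apply (rule wp_skip)
        apply (rule wp_Put; (simp add: regs R take_bit_one)?)
        subgoal using vn nm_word by (simp add: v_def)
        subgoal using bk by (simp add: v_def)
        subgoal using w_ge by simp
        subgoal for \<tau>2 j2 m2
        proof goal_cases
          case w: 1
          have "crep (junk j2 (r(10 := i, 11 := ?f))) m2 c (insert v A) D"
          proof -
            let ?r = "r(10 := i, 11 := ?f)"
            have t1: "pregs ?r" using R(1) by (simp add: pregs_def)
            have t3: "?r 32 = length cs" using cs(2) by simp
            have t4: "written w m m2 (aBMP * w + v) (Suc 0) (Suc 0)" using w(3) by (simp add: v_def)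
            have t7: "set cs = insert i (set cs)" using i by auto
            show ?thesis by (rule push_rep[OF t1 w(2) t3 t4 refl cs(1) t7 cs(4)])
          qed
          then show ?case using w 1 by (simp add: v_def)
        qed
        done
    qed
    subgoal for \<tau>1 j1
    proof goal_cases
      case 1
      have i: "i \<notin> set cs" using 1 f0 by auto
      have lh: "length cs * h < 2 ^ w" "aSTK * w + length cs * h + h \<le> aCNT * w"
        using len[OF i] nm_word regions L_less_w by linarith+
      have lk: "aSTK * w + length cs * h + h \<le> k * w" using lh regions by linarith
      have e2: "word_op w Times (length cs) h = length cs * h" using lh(1) by (rule word_op_Times)
      have "length cs * 1 \<le> length cs * h" using h_pos by (intro mult_le_mono2) simp
      then have "length cs + Suc 0 < 2 ^ w" using len[OF i] nm_word n_pos by linarith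
      then have e3: "word_op w Plus (length cs) (Suc 0) = Suc (length cs)"
        by (subst word_op_Plus) auto
      have ii: "i < 2 ^ h" by (rule cp(4))
      show ?case
        apply (rule wp_seq, rule wp_Put; (simp add: regs R cs(2))?)
        subgoal using lh by (simp add: e2)
        subgoal using lk by (simp add: e2)
        subgoal by (rule h_pos)
        subgoal using L_less_w by simp
        subgoal by (rule ii)
        apply (simp add: e2)
        apply (rule wp_assign, simp)
        apply (simp add: cs(2) take_bit_one e3)
        subgoal for \<tau>2 j2 m2
        proof goal_cases
          case w: 1
          show ?case
          apply (rule wp_Put; (simp add: regs R take_bit_one w)?)
          subgoal using vn nm_word by (simp add: v_def)
          subgoal using bk by (simp add: v_def)
          subgoal using w_ge by simp
          subgoal for \<tau>3 j3 m3
          proof goal_cases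
            case 3: 1
            have st: "fld w m2 (aSTK * w + x * h) h = (cs @ [i]) ! x" if x: "x < length (cs @ [i])" for x
            proof (cases "x = length cs")
              case True
              then show ?thesis using written_same[OF w(3) ii] by simp
            next
              case False
              then have x: "x < length cs" using x by simp
              then have "Suc x * h \<le> length cs * h" by (intro mult_le_mono1) simp
              then have "fld w m2 (aSTK * w + x * h) h = fld w m (aSTK * w + x * h) h"
                by (intro written_other[OF w(3)]) simp
              then show ?thesis using cs(4)[OF x] x by (simp add: nth_append)
            qed
            have "crep (junk j3 (r(10 := i, 11 := 0, 32 := Suc (length cs)))) m3 c (insert v A) D"
            proof -
              let ?r = "r(10 := i, 11 := 0, 32 := Suc (length cs))"
              have t1: "pregs ?r" using R(1) by (simp add: pregs_def)
              have t3: "?r 32 = length (cs @ [i])" by simp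
              have t4: "written w m2 m3 (aBMP * w + v) (Suc 0) (Suc 0)" using 3 by (simp add: v_def)
              have t5: "bitat w m2 P = bitat w m P" if "P < aSTK * w \<or> aCNT * w \<le> P" for P
                using w(3) lh(2) that by (auto simp: written_def)
              have t6: "distinct (cs @ [i])" using cs(1) i by simp
              have t7: "set (cs @ [i]) = insert i (set cs)" by simp
              show ?thesis using 3 by (intro push_rep[OF t1 _ t3 t4 t5 t6 t7 st])
            qed
            then show ?case using w 1 3 by (simp add: v_def)
          qed
          done
        qed
        done
    qed
    done
qed


lemma wp_cpop:
  assumes rep: "crep r m c A D"
  shows "wp cpop (\<lambda>\<tau>' r' m' o'. \<tau>' \<le> \<tau> + 1000 \<and> keep 40 r r' \<and> o' = out0 \<and>
        (if r' 31 = 0 then A = {} else r' 30 \<in> A \<and> crep r' m' c (A - {r' 30}) (insert (r' 30) D))) \<tau> r m out0"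
proof -
  have R: "pregs r" "words m" "static m" "counters m c" "ready m (r 32) A" using rep by (simp_all add: crep_def)
  obtain cs where cs: "distinct cs" "r 32 = length cs" "set cs = (\<lambda>v. v div h) ` A"
    "\<And>i. i < length cs \<Longrightarrow> fld w m (aSTK * w + i * h) h = cs ! i" and A: "A \<subseteq> {..<n}"
    "\<And>v. v < n + w \<Longrightarrow> bitat w m (aBMP * w + v) \<longleftrightarrow> v \<in> A"
    using R(5) unfolding ready_def by auto
  have regs: "r 53 = b" "r 54 = l" "r 55 = h" "r 60 = aBMP" "r 61 = aSTK" using R(1) by (simp_all add: pregs_def)
  show ?thesis
    unfolding cpop_def
  proof (rule wp_if, simp, goal_cases)
    case 2
    then show ?case
      by (intro wp_assign) (use cs in auto)
  next
    case 1
    define q where "q = length cs - 1"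
    define i where "i = cs ! q"
    have q: "q < length cs" "length cs = Suc q" using 1 cs(2) by (simp_all add: q_def)
    have ics: "i \<in> set cs" using q(1) by (simp add: i_def)
    then obtain u where u: "u \<in> A" "i = u div h" using cs(3) by auto
    have un: "u < n" using u A by auto
    note cp = chunk_pos[OF un, folded u(2)]
    define f where "f = fld w m (aBMP * w + i * h) h"
    have bit: "bit f j \<longleftrightarrow> j < h \<and> i * h + j \<in> A" for j
      using A(2)[of "i * h + j"] cp(5) by (auto simp: f_def bit_fld add.assoc)
    define y where "y = xor f (2 ^ h - 1)"
    have bity: "bit y j \<longleftrightarrow> j < h \<and> i * h + j \<notin> A" for j
    proof -
      have "bit (2 ^ h - 1 :: nat) j \<longleftrightarrow> j < h" by (metis bit_mask_iff mask_eq_exp_minus_1 possible_bit_nat)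
      then show ?thesis unfolding y_def bit_xor_iff using bit by blast
    qed
    have y: "y < 2 ^ h"
    proof -
      have "take_bit h y = y" by (rule bit_eqI) (auto simp: bit_take_bit_iff bity)
      then show ?thesis by (metis take_bit_nat_less_exp)
    qed
    define p where "p = sel y 0"
    have "p \<le> u mod h" using sel_first_zero[of y] bity[of "u mod h"] u cp by (simp add: p_def)
    then have ph: "p < h" using cp(3) by linarith
    define v where "v = i * h + p"
    have vA: "v \<in> A" using sel_first_zero[of y] bity[of p] ph by (simp add: p_def v_def)
    have vn: "v < n" using vA A by auto
    have vi: "v div h = i" using ph by (simp add: v_def)
    have qh: "q * h \<le> n"
    proof -
      have "set cs \<subseteq> {..n div h}" using cs(3) A(1) by (auto intro!: div_le_mono)
      from card_mono[OF _ this] have "q \<le> n div h" using cs(1) q by (simp add: distinct_card)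
      then have "q * h \<le> n div h * h" by (rule mult_le_mono1)
      then show ?thesis by (meson le_trans div_times_less_eq_dividend)
    qed
    have e1: "word_op w Minus (Suc q) (Suc 0) = q"
    proof -
      have "q * 1 \<le> q * h" using h_pos by (intro mult_le_mono2) simp
      then have "q < 2 ^ w" using qh nm_word by linarith
      then show ?thesis by (subst word_op_Minus) auto
    qed
    have e2: "word_op w Times q h = q * h" using qh nm_word by (intro word_op_Times) linarith
    have e3: "word_op w Times i h = i * h" using cp(1) un nm_word by (intro word_op_Times) linarith
    have mk: "word_op w Minus (word_op w ShiftL (Suc 0) h) (Suc 0) = 2 ^ h - Suc 0"
      using mask_eval[of h] L_less_w by (simp add: word_op.simps(8) push_bit_eq_mult)
    have t: "y * l * b + b \<le> 2 ^ h * l * b" using tab_index[OF y params(4)] by (simp only: add_0_right)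
    have yb: "y * l \<le> y * l * b" using b_pos by (cases b) auto
    have e4: "word_op w Times y l = y * l" using t yb params(9) nm_word by (intro word_op_Times) linarith
    have e5: "word_op w Times (y * l) b = y * l * b" using t params(9) nm_word by (intro word_op_Times) linarith
    have e6: "word_op w Plus (i * h) p = v" using vn nm_word by (simp add: v_def word_op_Plus)
    have fT: "fld w m (y * l * b) b = p"
      using R(3) y params(4) unfolding static_def p_def by (metis add.right_neutral)
    have fS: "fld w m (aSTK * w + q * h) h = i" using cs(4)[OF q(1)] by (simp add: i_def)
    have lt: "q * h < 2 ^ w" "i * h < 2 ^ w" "y * l * b < 2 ^ w" "v < 2 ^ w"
      using qh nm_word cp(1) un t params(9) vn by linarith+
    have kb: "aSTK * w + q * h + h \<le> k * w" "aBMP * w + i * h + h \<le> k * w" "y * l * b + b \<le> k * w"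
      "aBMP * w + v + 1 \<le> k * w"
      using qh regions L_less_w cp(5) t vn by linarith+
    have bw: "b \<le> w" "h \<le> w" "Suc 0 \<le> w" using params(2) L_le_w L_less_w w_ge by auto
    have pop_rep: "crep (junk ja ra) mb c (A - {v}) D'"
      if t: "pregs ra" "words mb" "written w m mb (aBMP * w + v) (Suc 0) 0"
        "ra 32 = (if fld w mb (aBMP * w + i * h) h = 0 then q else Suc q)" for ra mb ja D'
    proof -
      have b2: "bitat w mb P = bitat w m P" if "P \<noteq> aBMP * w + v" for P
        using t(3) that by (auto simp: written_def)
      have st: "static mb" by (rule static_cong[OF R(3)]) (use b2 in auto)
      have ct: "counters mb c" by (rule counters_cong[OF R(4)]) (use b2 regions vn in auto)
      have bm: "bitat w mb (aBMP * w + u) \<longleftrightarrow> u \<in> A - {v}" if u: "u < n + w" for u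
        using t(3) A(2)[OF u] by (auto simp: written_def)
      have other: "fld w mb (aSTK * w + x) y = fld w m (aSTK * w + x) y" for x y
        by (rule written_other[OF t(3)]) (use vn regions in auto)
      have f0: "fld w mb (aBMP * w + i * h) h = 0 \<longleftrightarrow> i \<notin> (\<lambda>v. v div h) ` (A - {v})"
      proof -
        have bit: "bit (fld w mb (aBMP * w + i * h) h) j \<longleftrightarrow> j < h \<and> i * h + j \<in> A - {v}" for j
          using bm[of "i * h + j"] cp(5) by (auto simp: bit_fld add.assoc)
        have "fld w mb (aBMP * w + i * h) h = 0 \<longleftrightarrow> (\<forall>j<h. i * h + j \<notin> A - {v})"
          by (metis bit bit_0_eq bit_eqI bot_apply bot_bool_def)
        also have "\<dots> \<longleftrightarrow> i \<notin> (\<lambda>v. v div h) ` (A - {v})"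
        proof
          assume *: "\<forall>j<h. i * h + j \<notin> A - {v}"
          show "i \<notin> (\<lambda>v. v div h) ` (A - {v})"
          proof
            assume "i \<in> (\<lambda>v. v div h) ` (A - {v})"
            then obtain x where "x \<in> A - {v}" "i = x div h" by auto
            then show False using *[rule_format, of "x mod h"] h_pos by simp
          qed
        next
          assume i: "i \<notin> (\<lambda>v. v div h) ` (A - {v})"
          show "\<forall>j<h. i * h + j \<notin> A - {v}"
          proof (intro allI impI notI)
            fix j assume "j < h" "i * h + j \<in> A - {v}"
            then have "(i * h + j) div h \<in> (\<lambda>v. v div h) ` (A - {v})" by blast
            then show False using i \<open>j < h\<close> by simp
          qed
        qed
        finally show ?thesis .
      qed
      have img: "(\<lambda>v. v div h) ` A = insert i ((\<lambda>v. v div h) ` (A - {v}))" using vA vi by auto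
      have "\<exists>ds. distinct ds \<and> ra 32 = length ds \<and> set ds = (\<lambda>v. v div h) ` (A - {v}) \<and>
        (\<forall>i<ra 32. fld w mb (aSTK * w + i * h) h = ds ! i)"
      proof (cases "fld w mb (aBMP * w + i * h) h = 0")
        case False
        then show ?thesis using t(4) q f0 img cs by (intro exI[of _ cs]) (auto simp: other insert_absorb)
      next
        case True
        have spl: "cs = take q cs @ [i]" using q by (metis i_def take_Suc_conv_app_nth take_all_iff order_refl)
        then have "distinct (take q cs @ [i])" "set (take q cs @ [i]) = (\<lambda>v. v div h) ` A" using cs by simp_all
        then have "set (take q cs) = (\<lambda>v. v div h) ` (A - {v})" using img f0 True by auto
        then show ?thesis using t(4) True q cs by (intro exI[of _ "take q cs"]) (auto simp: other)
      qed
      then have "ready mb (ra 32) (A - {v})"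
        unfolding ready_def using bm A(1) by auto
      then show ?thesis using t st ct by (simp add: crep_def pregs_def)
    qed
    show ?case
      apply (rule wp_seq, rule wp_assign, simp)
      apply (simp add: cs(2) q(2) take_bit_one e1)
      apply (rule wp_seq, rule wp_Get; (simp add: regs R e2 lt kb bw h_pos b_pos)?)
      apply (simp add: fS)
      apply (rule wp_seq, rule wp_Get; (simp add: regs R e3 lt kb bw h_pos b_pos)?)
      apply (simp add: f_def[symmetric])
      apply (rule wp_seq, rule wp_assign, simp)
      apply (simp add: regs take_bit_one mk y_def[simplified, symmetric])
      apply (rule wp_seq, rule wp_Get; (simp add: regs R e4 e5 lt kb bw h_pos b_pos)?)
      apply (simp add: fT)
      apply (rule wp_seq, rule wp_assign, simp)
      apply (simp add: regs e3 e6)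
      apply (rule wp_seq, rule wp_Put; (simp add: regs R take_bit_one lt kb bw kb(4)[simplified])?)
      apply (rule wp_seq, rule wp_Get; (simp add: regs R e3 lt kb bw h_pos b_pos)?)
      apply (rule wp_seq, rule wp_if, simp)
      subgoal
      proof goal_cases
        case w: 1
        show ?case
          apply (rule wp_skip, rule wp_assign, simp)
          using w vA R(1) by (simp add: take_bit_one pop_rep pregs_def cs(2) q)
      qed
      subgoal
      proof goal_cases
        case w: 1
        show ?case
          apply (rule wp_assign, simp, rule wp_assign, simp)
          using w vA R(1) by (simp add: take_bit_one pop_rep pregs_def cs(2) q)
      qed
      done
  qed
qed

lemma packed_ops: "kahn_ops w k R n E cinc cdec ctest cpush cpop 1000 crep"
  apply unfold_locales
  subgoal by simp
  subgoal by (simp add: crep_def pregs_def)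
  subgoal by (rule wp_cinc)
  subgoal by (rule wp_cdec)
  subgoal by (rule wp_ctest)
  subgoal by (rule wp_cpush)
  subgoal by (rule wp_cpop)
  done

end

section \<open>Building the compressed counters\<close>

definition bit_length :: "reg \<Rightarrow> expr \<Rightarrow> com" where
  "bit_length x e = (10 \<leftarrow> e) ;; (x \<leftarrow> C 0) ;; WhileE (V 10) ((10 \<leftarrow> V 10 \<oslash> C 2) ;; (x \<leftarrow> V x \<oplus> C 1))"

definition count_edges :: com where
  "count_edges = (51 \<leftarrow> C 0) ;; for_edges (51 \<leftarrow> V 51 \<oplus> C 1)"

definition set_params :: com where
  "set_params = bit_length 52 (V 50) ;; bit_length 12 (V 52) ;; (53 \<leftarrow> C 4 \<otimes> V 12) ;;
     (54 \<leftarrow> V 52 \<oslash> (V 53 \<otimes> V 53)) ;; (55 \<leftarrow> V 52 \<oplus> C 3 \<ominus> V 12) ;; bit_length 56 (V 50 \<oplus> V 51) ;;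
     (66 \<leftarrow> C 2 \<otimes> V 53) ;; (65 \<leftarrow> mask_ex (V 53))"

definition set_addresses :: com where
  "set_addresses =
     (57 \<leftarrow> Bin ShiftL (C 1) (V 55) \<otimes> V 54 \<otimes> V 53 \<oslash> WL \<oplus> C 1) ;;
     (10 \<leftarrow> V 50 \<oslash> V 54 \<oplus> C 1) ;;
     (58 \<leftarrow> V 57 \<oplus> (V 10 \<otimes> V 53 \<oslash> WL \<oplus> C 1)) ;;
     (59 \<leftarrow> V 58 \<oplus> (V 10 \<otimes> V 66 \<oslash> WL \<oplus> C 1)) ;;
     (10 \<leftarrow> V 50 \<oslash> V 54 \<oslash> V 52 \<oplus> C 1) ;;
     (60 \<leftarrow> V 59 \<oplus> (V 10 \<otimes> V 56 \<oslash> WL \<oplus> C 1)) ;;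
     (61 \<leftarrow> V 60 \<oplus> (V 50 \<oslash> WL \<oplus> C 2)) ;;
     (62 \<leftarrow> V 61 \<oplus> (V 50 \<oslash> WL \<oplus> C 2)) ;;
     (63 \<leftarrow> V 62 \<oplus> ((V 50 \<oplus> V 51) \<oslash> WL \<oplus> C 2)) ;;
     (32 \<leftarrow> C 0)"

definition clear_cells :: com where
  "clear_cells = (10 \<leftarrow> C 0) ;; WhileE (V 10 \<prec> V 63) (StoreE (V 10) (C 0) ;; (10 \<leftarrow> V 10 \<oplus> C 1))"

definition fill_table :: com where
  "fill_table = (20 \<leftarrow> C 0) ;; (21 \<leftarrow> Bin ShiftL (C 1) (V 55) \<otimes> V 54) ;;
     WhileE (V 20 \<prec> V 21)
       ((22 \<leftarrow> V 20 \<oslash> V 54) ;; (23 \<leftarrow> V 20 \<ominus> V 22 \<otimes> V 54) ;; (24 \<leftarrow> V 22 \<oslash> C 2) ;;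
        IfE (Bin BitAnd (V 22) (C 1))
          (Get 26 (C 0) ((V 24 \<otimes> V 54 \<oplus> V 23) \<otimes> V 53) (V 53) ;; (26 \<leftarrow> V 26 \<oplus> C 1))
          (IfE (V 23)
            ((23 \<leftarrow> V 23 \<ominus> C 1) ;; Get 26 (C 0) ((V 24 \<otimes> V 54 \<oplus> V 23) \<otimes> V 53) (V 53) ;; (26 \<leftarrow> V 26 \<oplus> C 1))
            (26 \<leftarrow> C 0)) ;;
        Put (C 0) (V 20 \<otimes> V 53) (V 53) (V 26) ;; (20 \<leftarrow> V 20 \<oplus> C 1))"

definition fill_sums :: com where
  "fill_sums = for_edges ((10 \<leftarrow> V 30 \<oslash> V 54) ;; Get 11 (V 57) (V 10 \<otimes> V 53) (V 53) ;;
     IfE (V 11 \<prec> V 65) (Put (V 57) (V 10 \<otimes> V 53) (V 53) (V 11 \<oplus> C 1)) Skip)"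

definition fill_offsets :: com where
  "fill_offsets = (20 \<leftarrow> C 0) ;; (21 \<leftarrow> C 0) ;; (24 \<leftarrow> V 50 \<oslash> V 54 \<oplus> C 1) ;;
     WhileE (V 20 \<prec> V 24)
       ((22 \<leftarrow> V 20 \<oslash> V 52) ;;
        IfE (V 20 \<ominus> V 22 \<otimes> V 52) Skip (Put (V 59) (V 22 \<otimes> V 56) (V 56) (V 21) ;; (23 \<leftarrow> V 21)) ;;
        Put (V 58) (V 20 \<otimes> V 66) (V 66) (V 21 \<ominus> V 23) ;;
        Get 25 (V 57) (V 20 \<otimes> V 53) (V 53) ;; (21 \<leftarrow> V 21 \<oplus> V 25 \<oplus> V 54) ;; (20 \<leftarrow> V 20 \<oplus> C 1))"

lemma bitlen_le_self: "bitlen x \<le> x"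
  by (rule bitlen_le) simp

context packed
begin

lemma const_word: "x < 1048576 \<Longrightarrow> take_bit w x = (x :: nat)"
proof -
  have "(2 :: nat) ^ 20 \<le> 2 ^ w" using w_ge by (intro power_increasing) auto
  then show "x < 1048576 \<Longrightarrow> take_bit w x = x" by (intro take_bit_small) simp
qed

lemma w_two: "2 \<le> w"
  using w_ge by simp

lemma wp_assign_val:
  assumes "visible e" "ev r e = v" "Q (\<tau> + (cost e + 1)) (r(x := v)) m o'"
  shows "wp (x \<leftarrow> e) Q \<tau> r m o'"
  using wp_assign[of e Q \<tau> r x m o'] assms by simp

lemma wp_bit_length:
  assumes x: "10 < x" "x < 100" and e: "visible e" "ev r e < 2 ^ w"
    and Q: "\<And>\<tau>'. \<tau>' \<le> \<tau> + (cost e + 10 * bitlen (ev r e) + 6) \<Longrightarrow> Q \<tau>' (r(10 := 0, x := bitlen (ev r e))) m o'"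
  shows "wp (bit_length x e) Q \<tau> r m o'"
proof -
  define a where "a = ev r e"
  have aw: "bitlen a \<le> w" using e(2) unfolding a_def by (rule bitlen_le)
  show ?thesis
    unfolding bit_length_def
    apply (rule wp_seq, rule wp_assign, rule e)
    apply (rule wp_seq, rule wp_assign, simp)
    apply (rule wp_while[where p = "10 * bitlen a" and
      I = "\<lambda>p r' m' o1. \<exists>y. r' = r(10 := y, x := bitlen a - bitlen y) \<and> bitlen y \<le> bitlen a \<and> m' = m \<and> o1 = o' \<and> p = 10 * bitlen y"])
    subgoal by simp
    subgoal using x by (intro exI[of _ a]) (auto simp: a_def)
    subgoal for p r1 m1 o1 \<tau>1
    proof goal_cases
      case 1
      then obtain y where y: "r1 = r(10 := y, x := bitlen a - bitlen y)" "bitlen y \<le> bitlen a" "m1 = m" "o1 = o'"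
        "p = 10 * bitlen y" "y \<noteq> 0" using x by auto
      have s: "bitlen y = Suc (bitlen (y div 2))" using y(6) by (subst bitlen.simps) simp
      have e: "word_op w Plus (bitlen a - Suc (bitlen (y div 2))) (Suc 0) = bitlen a - bitlen (y div 2)"
        using s y(2) aw w_large by (subst word_op_Plus) auto
      show ?case
        apply (rule wp_seq, rule wp_assign, simp)
        apply (rule wp_assign, simp add: x)
        apply (rule exI[of _ "10 * bitlen (y div 2)"])
        using x y s by (auto simp: const_word take_bit_one e w_two intro!: exI[of _ "y div 2"])
    qed
    subgoal for p r1 m1 o1 \<tau>1
      using x by (auto simp: a_def[symmetric] bitlen.simps[of 0] intro!: Q[folded a_def])
    done
qed

lemma wp_count_edges:
  assumes n: "r 50 = n"
    and Q: "\<And>\<tau>' r'. \<tau>' \<le> \<tau> + (12 * M + 14 * n + 8) \<Longrightarrow> r' 50 = n \<Longrightarrow> r' 51 = M \<Longrightarrow> Q \<tau>' r' m o'"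
  shows "wp count_edges Q \<tau> r m o'"
  unfolding count_edges_def
  apply (rule wp_seq, rule wp_assign, simp)
  apply (rule wp_for_edges[where T = 4 and P = "\<lambda>ys r' m' o1. r' 51 = length ys \<and> m' = m \<and> o1 = o'"])
  subgoal using n by simp
  subgoal by simp
  subgoal by simp
  subgoal by (auto simp: keep_loopD)
  subgoal for ys v zs r1 m1 o1 \<tau>1
  proof goal_cases
    case 1
    have "length ys < M" using 1(1) length_targets by (metis add_Suc_right length_Cons length_append less_add_Suc1)
    then have "word_op w Plus (length ys) (Suc 0) = Suc (length ys)" using nm_word by (subst word_op_Plus) auto
    then show ?case using 1 by (intro wp_assign) (auto simp: take_bit_one)
  qed
  subgoal by (auto simp: length_targets intro!: Q)
  done

lemma wp_set_params:
  assumes r: "r 50 = n" "r 51 = M"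
    and Q: "\<And>\<tau>' r'. \<tau>' \<le> \<tau> + (30 * (n + M) + 100) \<Longrightarrow> r' 50 = n \<Longrightarrow> r' 51 = M \<Longrightarrow> r' 52 = L \<Longrightarrow> r' 53 = b \<Longrightarrow>
      r' 54 = l \<Longrightarrow> r' 55 = h \<Longrightarrow> r' 56 = om \<Longrightarrow> r' 65 = cap \<Longrightarrow> r' 66 = 2 * b \<Longrightarrow> Q \<tau>' r' m o'"
  shows "wp set_params Q \<tau> r m o'"
proof -
  have Lw: "L + 3 < 2 ^ w" using L_le_w w_ge w_large by linarith
  have LL: "bitlen L \<le> L" by (rule bitlen_le_self)
  have bb: "b * b \<le> L"
  proof (rule ccontr)
    assume "\<not> b * b \<le> L"
    then show False using params(4) by (simp add: ell_def)
  qed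
  have e1: "word_op w Times 4 (bitlen L) = b" using params(2) Lw by (subst word_op_Times) (auto simp: beta_def)
  have e2: "word_op w Times b b = b * b" using bb Lw by (intro word_op_Times) linarith
  have e3: "word_op w Plus L 3 = L + 3" using Lw by (rule word_op_Plus)
  have e4: "word_op w Minus (L + 3) (bitlen L) = h" using LL Lw by (subst word_op_Minus) (auto simp: chunk_def)
  have e5: "word_op w Plus n M = n + M" using nm_word by (intro word_op_Plus)
  have e6: "word_op w Times 2 b = 2 * b" using params(2) Lw by (intro word_op_Times) linarith
  have e7: "word_op w Minus (word_op w ShiftL (Suc 0) b) (Suc 0) = cap"
    using mask_eval[of b] params(2) L_le_w by (simp add: word_op.simps(8) push_bit_eq_mult)
  have b1: "L \<le> n + M" "bitlen L \<le> n + M" "om \<le> n + M"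
    using bitlen_le_self[of n] bitlen_le_self[of "n + M"] LL by linarith+
  show ?thesis
    unfolding set_params_def
    apply (rule wp_seq, rule wp_bit_length; (simp add: r nm_word)?)
    apply (rule wp_seq, rule wp_bit_length; (simp add: r nm_word)?)
    subgoal using Lw by simp
    apply (rule wp_seq, rule wp_assign, simp)
    apply (rule wp_seq, rule wp_assign, simp)
    apply (rule wp_seq, rule wp_assign, simp)
    apply (rule wp_seq, rule wp_bit_length; (simp add: r nm_word e5)?)
    apply (rule wp_seq, rule wp_assign, simp)
    apply (rule wp_assign, simp)
    using b1 r by (intro Q) (simp_all add: const_word take_bit_one w_two e1 e2 e3 e4 e6 e7 ell_def)
qed

lemma wp_set_addresses:
  assumes r: "r 50 = n" "r 51 = M" "r 52 = L" "r 53 = b" "r 54 = l" "r 55 = h" "r 56 = om" "r 65 = cap" "r 66 = 2 * b"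
    and Q: "\<And>\<tau>' r'. \<tau>' \<le> \<tau> + 200 \<Longrightarrow> pregs r' \<Longrightarrow> r' 32 = 0 \<Longrightarrow> Q \<tau>' r' m o'"
  shows "wp set_addresses Q \<tau> r m o'"
proof -
  have kw: "k < 2 ^ w" using cells_le nm_word by linarith
  note defs = addr_S_def addr_REL_def addr_ABS_def addr_BMP_def addr_STK_def addr_CNT_def cells_def k
  have ord: "aS \<le> aREL" "aREL \<le> aABS" "aABS \<le> aBMP" "aBMP \<le> aSTK" "aSTK \<le> aCNT" "aCNT \<le> k"
    unfolding addr_REL_def addr_ABS_def addr_BMP_def addr_STK_def addr_CNT_def cells_def k by simp_all
  have hl: "2 ^ h * l \<le> 2 ^ h * l * b" "2 ^ h \<le> 2 ^ h * l" using b_pos params(4) by simp_all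
  have hw: "(2::nat) ^ h < 2 ^ w" using hl params(9) nm_word by linarith
  have e0: "word_op w ShiftL (Suc 0) h = 2 ^ h"
    using hw by (simp add: word_op.simps push_bit_eq_mult take_bit_small)
  have e1: "word_op w Times (2 ^ h) l = 2 ^ h * l" "word_op w Times (2 ^ h * l) b = 2 ^ h * l * b"
    using hl params(9) nm_word by (intro word_op_Times; linarith)+
  define nb where "nb = n div l + 1"
  define ns where "ns = n div l div L + 1"
  have e2: "word_op w Plus (2 ^ h * l * b div w) (Suc 0) = aS"
    using ord kw by (subst word_op_Plus) (auto simp: addr_S_def)
  have e3: "word_op w Plus (n div l) (Suc 0) = nb"
  proof -
    have "nb * 1 \<le> nb * (2 * b)" using b_pos by (intro mult_le_mono2) simp
    then show ?thesis using params(10)[folded nb_def] nm_word by (subst word_op_Plus) (auto simp: nb_def)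
  qed
  have e4: "word_op w Times nb b = nb * b" "word_op w Times nb (2 * b) = nb * (2 * b)"
    using small_bounds[folded nb_def] params(10)[folded nb_def] nm_word by (intro word_op_Times; linarith)+
  have e5: "word_op w Plus (nb * b div w) (Suc 0) = Suc (nb * b div w)"
    using ord kw by (subst word_op_Plus) (auto simp: addr_REL_def nb_def)
  have e6: "word_op w Plus aS (Suc (nb * b div w)) = aREL"
    using ord kw by (subst word_op_Plus) (auto simp: addr_REL_def nb_def)
  have e7: "word_op w Plus (nb * (2 * b) div w) (Suc 0) = Suc (nb * (2 * b) div w)"
    using ord kw by (subst word_op_Plus) (auto simp: addr_ABS_def nb_def)
  have e8: "word_op w Plus aREL (Suc (nb * (2 * b) div w)) = aABS"
    using ord kw by (subst word_op_Plus) (auto simp: addr_ABS_def nb_def)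
  have e9: "word_op w Plus (n div l div L) (Suc 0) = ns"
  proof -
    have "ns * 1 \<le> ns * om" using om_pos by (intro mult_le_mono2) simp
    then show ?thesis using small_bounds[folded ns_def] nm_word by (subst word_op_Plus) (auto simp: ns_def)
  qed
  have e10: "word_op w Times ns om = ns * om"
    using small_bounds[folded ns_def] nm_word by (intro word_op_Times) linarith
  have e11: "word_op w Plus (ns * om div w) (Suc 0) = Suc (ns * om div w)"
    using ord kw by (subst word_op_Plus) (auto simp: addr_BMP_def ns_def)
  have e12: "word_op w Plus aABS (Suc (ns * om div w)) = aBMP"
    using ord kw by (subst word_op_Plus) (auto simp: addr_BMP_def ns_def)
  have e13: "word_op w Plus (n div w) 2 = Suc (Suc (n div w))" "word_op w Plus aBMP (Suc (Suc (n div w))) = aSTK"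
    "word_op w Plus aSTK (Suc (Suc (n div w))) = aCNT"
    using ord kw by (subst word_op_Plus, auto simp: addr_STK_def addr_CNT_def)+
  have e14: "word_op w Plus n M = n + M" using nm_word by (intro word_op_Plus)
  have e15: "word_op w Plus ((n + M) div w) 2 = Suc (Suc ((n + M) div w))" "word_op w Plus aCNT (Suc (Suc ((n + M) div w))) = k"
    using ord kw by (subst word_op_Plus, auto simp: cells_def k)+
  note ee = e0 e1 e2 e3 e4 e5 e6 e7 e8 e9 e10 e11 e12 e13 e14 e15
  show ?thesis
    unfolding set_addresses_def
    apply (rule wp_seq, rule wp_assign_val[where v = "aS"], simp)
    subgoal by (simp add: r ee const_word take_bit_one w_two)
    apply (rule wp_seq, rule wp_assign_val[where v = "nb"], simp)
    subgoal by (simp add: r ee const_word take_bit_one w_two)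
    apply (rule wp_seq, rule wp_assign_val[where v = "aREL"], simp)
    subgoal by (simp add: r ee const_word take_bit_one w_two)
    apply (rule wp_seq, rule wp_assign_val[where v = "aABS"], simp)
    subgoal by (simp add: r ee const_word take_bit_one w_two)
    apply (rule wp_seq, rule wp_assign_val[where v = "ns"], simp)
    subgoal by (simp add: r ee const_word take_bit_one w_two)
    apply (rule wp_seq, rule wp_assign_val[where v = "aBMP"], simp)
    subgoal by (simp add: r ee const_word take_bit_one w_two)
    apply (rule wp_seq, rule wp_assign_val[where v = "aSTK"], simp)
    subgoal by (simp add: r ee const_word take_bit_one w_two)
    apply (rule wp_seq, rule wp_assign_val[where v = "aCNT"], simp)
    subgoal by (simp add: r ee const_word take_bit_one w_two)
    apply (rule wp_seq, rule wp_assign_val[where v = "k"], simp)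
    subgoal by (simp add: r ee const_word take_bit_one w_two)
    apply (rule wp_assign, simp)
    apply (rule Q)
    subgoal by simp
    subgoal by (simp add: pregs_def r)
    subgoal by simp
    done
qed


lemma pregs_keep30: "pregs r \<Longrightarrow> keep 30 r r' \<Longrightarrow> pregs r' \<and> r' 32 = r 32"
  by (auto simp: pregs_keep keep_mono keepD)

definition zero_from :: "(nat \<Rightarrow> nat) \<Rightarrow> nat \<Rightarrow> bool" where
  "zero_from m a \<longleftrightarrow> (\<forall>P. a \<le> P \<and> P < k * w \<longrightarrow> \<not> bitat w m P)"

lemma zero_from_mono: "zero_from m a \<Longrightarrow> a \<le> a' \<Longrightarrow> zero_from m a'"
  by (auto simp: zero_from_def)

lemma zero_from_written: "zero_from m a \<Longrightarrow> written w m m' P x v \<Longrightarrow> P + x \<le> a \<Longrightarrow> zero_from m' a"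
  by (auto simp: zero_from_def written_def)

lemma fld_zero: "zero_from m a \<Longrightarrow> a \<le> P \<Longrightarrow> P + x \<le> k * w \<Longrightarrow> fld w m P x = 0"
  by (rule bit_eqI) (auto simp: bit_fld zero_from_def)

lemma wp_clear_cells:
  assumes p: "pregs r" and wd: "words m"
    and Q: "\<And>\<tau>' r' m'. \<tau>' \<le> \<tau> + (11 * k + 6) \<Longrightarrow> keep 30 r r' \<Longrightarrow> words m' \<Longrightarrow> zero_from m' 0 \<Longrightarrow> Q \<tau>' r' m' o'"
  shows "wp clear_cells Q \<tau> r m o'"
proof -
  have k63: "r 63 = k" using p by (simp add: pregs_def)
  have kw: "k < 2 ^ w" using cells_le nm_word by linarith
  show ?thesis
    unfolding clear_cells_def
    apply (rule wp_seq, rule wp_assign, simp)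
    apply (rule wp_while[where p = "11 * k" and I = "\<lambda>p r' m' o1. keep 30 r r' \<and> r' 63 = k \<and> r' 10 \<le> k \<and> words m' \<and> o1 = o' \<and>
      (\<forall>a<r' 10. m' a = 0) \<and> p = 11 * (k - r' 10)"])
    subgoal by simp
    subgoal using k63 wd by simp
    subgoal for p r1 m1 o1 \<tau>1
    proof goal_cases
      case 1
      then have lt: "r1 10 < k" by (simp add: word_op_Less)
      have e: "word_op w Plus (r1 10) (Suc 0) = Suc (r1 10)" using lt kw by (subst word_op_Plus) auto
      show ?case
        apply (rule wp_seq, rule wp_store, simp, simp)
        subgoal using lt by simp
        apply (rule wp_assign, simp)
        using 1 lt by (intro exI[of _ "11 * (k - Suc (r1 10))"]) (auto simp: take_bit_one e less_Suc_eq)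
    qed
    subgoal for p r1 m1 o1 \<tau>1
    proof goal_cases
      case 1
      then have "r1 10 = k" by (auto simp: word_op_Less)
      then have "zero_from m1 0" using 1
        by (auto simp: zero_from_def bitat_def less_mult_imp_div_less)
      then have "Q \<tau>1 r1 m1 o'" using 1 by (intro Q) auto
      then show ?case using 1 by auto
    qed
    done
qed

definition table_upto :: "(nat \<Rightarrow> nat) \<Rightarrow> nat \<Rightarrow> bool" where
  "table_upto m t \<longleftrightarrow> (\<forall>i<t. fld w m (i * b) b = sel (i div l) (i mod l))"

lemma table_index: "t < 2 ^ h * l \<Longrightarrow> t * b + b \<le> 2 ^ h * l * b"
  using mult_le_mono1[of "Suc t" "2 ^ h * l" b] by simp

lemma wp_fill_table:
  assumes p: "pregs r" and wd: "words m" and z: "zero_from m 0"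
    and Q: "\<And>\<tau>' r' m'. \<tau>' \<le> \<tau> + (400 * n + 20) \<Longrightarrow> keep 30 r r' \<Longrightarrow> words m' \<Longrightarrow> zero_from m' (aS * w) \<Longrightarrow>
       table_upto m' (2 ^ h * l) \<Longrightarrow> Q \<tau>' r' m' o'"
  shows "wp fill_table Q \<tau> r m o'"
proof -
  have hl: "2 ^ h * l * 1 \<le> 2 ^ h * l * b" "2 ^ h * 1 \<le> 2 ^ h * l"
    using b_pos params(4) by (intro mult_le_mono2; simp)+
  have hw: "(2::nat) ^ h < 2 ^ w" using hl params(9) nm_word by linarith
  have e0: "word_op w ShiftL (Suc 0) h = 2 ^ h"
    using hw by (simp add: word_op.simps push_bit_eq_mult take_bit_small)
  have e1: "word_op w Times (2 ^ h) l = 2 ^ h * l"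
    using hl params(9) nm_word by (intro word_op_Times) linarith
  have rr: "r 53 = b" "r 54 = l" "r 55 = h" using p by (simp_all add: pregs_def)
  define N where "N = 2 ^ h * l"
  have Nn: "N \<le> n" using hl params(9) unfolding N_def by linarith
  have step: "wp
       ((22 \<leftarrow> V 20 \<oslash> V 54) ;; (23 \<leftarrow> V 20 \<ominus> V 22 \<otimes> V 54) ;; (24 \<leftarrow> V 22 \<oslash> C 2) ;;
        IfE (Bin BitAnd (V 22) (C 1))
          (Get 26 (C 0) ((V 24 \<otimes> V 54 \<oplus> V 23) \<otimes> V 53) (V 53) ;; (26 \<leftarrow> V 26 \<oplus> C 1))
          (IfE (V 23)
            ((23 \<leftarrow> V 23 \<ominus> C 1) ;; Get 26 (C 0) ((V 24 \<otimes> V 54 \<oplus> V 23) \<otimes> V 53) (V 53) ;; (26 \<leftarrow> V 26 \<oplus> C 1))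
            (26 \<leftarrow> C 0)) ;;
        Put (C 0) (V 20 \<otimes> V 53) (V 53) (V 26) ;; (20 \<leftarrow> V 20 \<oplus> C 1))
       (\<lambda>\<tau>' r' m' o1. o1 = o' \<and> keep 30 r r' \<and> r' 20 = Suc t \<and> r' 21 = N \<and> words m' \<and> zero_from m' (aS * w) \<and>
          table_upto m' (Suc t) \<and> \<tau>' \<le> \<tau>1 + 390) \<tau>1 r1 m1 o'"
    if t: "keep 30 r r1" "r1 20 = t" "t < N" "r1 21 = N" "words m1" "zero_from m1 (aS * w)" "table_upto m1 t"
    for r1 m1 t \<tau>1
  proof -
    define x where "x = t div l"
    define j where "j = t mod l"
    have tx: "t = x * l + j" by (simp add: x_def j_def)
    have jl: "j < l" using params(4) by (simp add: j_def)
    have xh: "x < 2 ^ h" using t(3) unfolding x_def N_def by (rule less_mult_imp_div_less)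
    have tw: "t + 1 < 2 ^ w" using t(3) Nn nm_word n_pos by linarith
    have r1: "r1 53 = b" "r1 54 = l" using rr t(1) by (simp_all add: keepD)
    have f1: "word_op w Times x l = x * l" using tw tx by (intro word_op_Times) linarith
    have f2: "word_op w Minus t (x * l) = j" using tw tx by (subst word_op_Minus) auto
    have idx: "i * b < 2 ^ w" "i * b + b \<le> k * w" "word_op w Times i b = i * b" if "i \<le> t" for i
    proof -
      have "i * b + b \<le> 2 ^ h * l * b" using that t(3) by (intro table_index) (simp add: N_def)
      then show "i * b < 2 ^ w" "i * b + b \<le> k * w"
        using params(9) nm_word regions b_pos by linarith+
      then show "word_op w Times i b = i * b" by (intro word_op_Times)
    qed
    have fT: "fld w m1 (i * b) b = sel (i div l) (i mod l)" if "i < t" for i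
      using t(7) that by (simp add: table_upto_def)
    have look: "word_op w Times (x div 2) l = x div 2 * l" "word_op w Plus (x div 2 * l) j' = x div 2 * l + j'"
      "fld w m1 ((x div 2 * l + j') * b) b = sel (x div 2) j'" "x div 2 * l + j' \<le> t"
      "word_op w Plus (sel (x div 2) j') (Suc 0) = Suc (sel (x div 2) j')"
      if j': "x div 2 * l + j' < t" "j' < l" for j'
    proof -
      show "word_op w Times (x div 2) l = x div 2 * l" using j'(1) tw by (intro word_op_Times) linarith
      show "word_op w Plus (x div 2 * l) j' = x div 2 * l + j'" using j'(1) tw by (intro word_op_Plus) linarith
      show "fld w m1 ((x div 2 * l + j') * b) b = sel (x div 2) j'" using fT[OF j'(1)] j'(2) by simp
      show "x div 2 * l + j' \<le> t" using j'(1) by simp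
      have "x div 2 < 2 ^ h" using xh by (meson div_le_dividend le_less_trans)
      then have "sel (x div 2) j' < 2 ^ b" using sel_less[of "x div 2" h j'] j'(2) params(7) by linarith
      moreover have "(2::nat) ^ Suc b \<le> 2 ^ w" using params(2) L_le_w b_pos by (intro power_increasing) auto
      ultimately show "word_op w Plus (sel (x div 2) j') (Suc 0) = Suc (sel (x div 2) j')"
        by (subst word_op_Plus) auto
    qed
    have odd_lt: "x div 2 * l + j < t" if "odd x"
    proof -
      have "Suc (x div 2) \<le> x" using that by presburger
      then have "Suc (x div 2) * l \<le> x * l" by (rule mult_le_mono1)
      then have "x div 2 * l + l \<le> x * l" by simp
      then show ?thesis using params(4) tx by linarith
    qed
    have even_lt: "x div 2 * l + (j - 1) < t" if "0 < j"
    proof -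
      have "x div 2 * l \<le> x * l" by (intro mult_le_mono1) simp
      then show ?thesis using that tx by linarith
    qed
    have sb: "sel x j < 2 ^ b" using sel_less[OF xh, of j] jl params(7) by linarith
    have fin: "wp (Put (C 0) (V 20 \<otimes> V 53) (V 53) (V 26) ;; (20 \<leftarrow> V 20 \<oplus> C 1))
       (\<lambda>\<tau>' r' m' o1. o1 = o' \<and> keep 30 r r' \<and> r' 20 = Suc t \<and> r' 21 = N \<and> words m' \<and> zero_from m' (aS * w) \<and>
          table_upto m' (Suc t) \<and> \<tau>' \<le> \<tau>1 + 390) \<tau>2 r2 m1 o'"
      if q: "keep 30 r r2" "r2 20 = t" "r2 21 = N" "r2 26 = sel x j" "\<tau>2 \<le> \<tau>1 + 220" for \<tau>2 r2
    proof -
      have r2: "r2 53 = b" using rr q(1) by (simp add: keepD)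
      have bw: "b \<le> w" using params(2) L_le_w by simp
      have s: "word_op w Plus t (Suc 0) = Suc t" using tw by (subst word_op_Plus) auto
      show ?thesis
        apply (rule wp_seq, rule wp_Put; (simp add: q r2 idx t b_pos bw sb)?)
        subgoal for \<tau>3 j3 m3
        proof goal_cases
          case 1
          have T: "table_upto m3 (Suc t)"
            unfolding table_upto_def
          proof (intro allI impI)
            fix i assume i: "i < Suc t"
            show "fld w m3 (i * b) b = sel (i div l) (i mod l)"
            proof (cases "i = t")
              case True
              then show ?thesis using written_same[OF 1(3) sb] by (simp add: x_def j_def)
            next
              case False
              then have "i < t" using i by simp
              then have "Suc i * b \<le> t * b" by (intro mult_le_mono1) simp
              then have "fld w m3 (i * b) b = fld w m1 (i * b) b" by (intro written_other[OF 1(3)]) simp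
              then show ?thesis using fT[OF \<open>i < t\<close>] by simp
            qed
          qed
          have Z: "zero_from m3 (aS * w)"
            using table_index[of t] t(3) regions(1) by (intro zero_from_written[OF t(6) 1(3)]) (simp add: N_def)
          show ?case
            apply (rule wp_assign, simp)
            using 1 q T Z by (simp add: take_bit_one s)
        qed
        done
    qed
    have bw: "b \<le> w" using params(2) L_le_w by simp
    show ?thesis
      apply (rule wp_seq, rule wp_assign_val[where v = x], simp)
      subgoal by (simp add: t r1 x_def)
      apply (rule wp_seq, rule wp_assign_val[where v = j], simp)
      subgoal by (simp add: t r1 f1 f2)
      apply (rule wp_seq, rule wp_assign_val[where v = "x div 2"], simp)
      subgoal by (simp add: const_word w_two)
      apply (rule wp_seq, rule wp_if, simp)
      subgoal
      proof goal_cases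
        case 1
        then have "odd x" by (simp add: take_bit_one and_one_eq odd_iff_mod_2_eq_one)
        note lk = look[OF odd_lt[OF this] jl]
        have sx: "Suc (sel (x div 2) j) = sel x j" using \<open>odd x\<close> by (subst (2) sel.simps) simp
        show ?case
          apply (rule wp_seq, rule wp_Get; (simp add: r1 t lk idx[OF lk(4)] b_pos bw)?)
          apply (rule wp_assign, simp)
          apply (rule fin[unfolded One_nat_def])
          using t by (simp_all add: lk sx take_bit_one)
      qed
      subgoal
      proof goal_cases
        case 1
        then have ev: "even x" by (simp add: take_bit_one and_one_eq even_iff_mod_2_eq_zero)
        show ?case
        proof (rule wp_if, simp, goal_cases)
          case 1
          then have j0: "0 < j" by simp
          note lk = look[OF even_lt[OF j0], OF less_imp_diff_less[OF jl]]
          have sx: "Suc (sel (x div 2) (j - 1)) = sel x j" using ev j0 by (subst (2) sel.simps) simp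
          have je: "word_op w Minus j (Suc 0) = j - 1" using j0 tw tx by (subst word_op_Minus) auto
          show ?case
            apply (rule wp_seq, rule wp_assign_val[where v = "j - 1"], simp)
            subgoal using je by (simp add: take_bit_one)
            apply (rule wp_seq, rule wp_Get; (simp add: r1 t lk[simplified] idx[OF lk(4), simplified] b_pos bw)?)
            apply (rule wp_assign, simp)
            apply (rule fin[unfolded One_nat_def])
            using t by (simp_all add: lk[simplified] sx[simplified] take_bit_one)
        next
          case 2
          then have j0: "j = 0" by simp
          have sx: "sel x j = 0" using ev j0 by (subst sel.simps) simp
          show ?case
            apply (rule wp_assign, simp)
            apply (rule fin)
            using t by (simp_all add: sx)
        qed
      qed
      done
  qed
  show ?thesis
    unfolding fill_table_def
    apply (rule wp_seq, rule wp_assign, simp)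
    apply (rule wp_seq, rule wp_assign_val[where v = N], simp)
    subgoal by (simp add: rr e0 e1 N_def take_bit_one)
    apply (rule wp_while[where p = "400 * N" and I = "\<lambda>p r' m' o1. o1 = o' \<and> keep 30 r r' \<and> r' 20 \<le> N \<and> r' 21 = N \<and>
       words m' \<and> zero_from m' (aS * w) \<and> table_upto m' (r' 20) \<and> p = 400 * (N - r' 20)"])
    subgoal by simp
    subgoal using wd zero_from_mono[OF z] by (simp add: table_upto_def)
    subgoal for p r1 m1 o1 \<tau>1
    proof goal_cases
      case 1
      then have lt: "r1 20 < N" by (simp add: word_op_Less)
      have o1: "o1 = o'" using 1 by simp
      show ?case
        unfolding o1
        apply (rule wp_conseq, rule step[OF _ refl])
        using 1 lt apply simp_all[6]
        subgoal for \<tau>2 r2 m2 o2 using 1 lt by (intro exI[of _ "400 * (N - r2 20)"]) auto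
        done
    qed
    subgoal for p r1 m1 o1 \<tau>1
    proof goal_cases
      case 1
      then have "r1 20 = N" by (simp add: word_op_Less)
      then have "Q \<tau>1 r1 m1 o'" using 1 Nn by (intro Q) (auto simp: N_def)
      then show ?case using 1 by auto
    qed
    done
qed

end

definition setup_packed :: com where
  "setup_packed = count_edges ;; set_params ;; set_addresses ;; clear_cells ;; fill_table ;; fill_sums ;; fill_offsets"

definition packed_kahn :: com where
  "packed_kahn = setup_packed ;; kahn cinc cdec ctest cpush cpop"

lemma sum_count_list: "finite X \<Longrightarrow> (\<Sum>v\<in>X. count_list ys v) = length (filter (\<lambda>v. v \<in> X) ys)"
proof (induction ys)
  case (Cons y ys)
  have "(\<Sum>v\<in>X. count_list (y # ys) v) = (\<Sum>v\<in>X. (if v = y then 1 else 0) + count_list ys v)"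
    by (intro sum.cong) auto
  also have "\<dots> = of_bool (y \<in> X) + (\<Sum>v\<in>X. count_list ys v)"
    using Cons.prems by (simp add: sum.distrib sum.delta)
  finally show ?case using Cons by simp
qed simp

context packed
begin

lemma block_iff: "v div l = i \<longleftrightarrow> v \<in> {i * l..<i * l + l}"
proof
  assume "v div l = i"
  then show "v \<in> {i * l..<i * l + l}" using dividend_less_div_times[OF params(4), of v] by (auto simp: add.commute)
next
  assume "v \<in> {i * l..<i * l + l}"
  then show "v div l = i" by (intro div_nat_eqI) (auto simp: algebra_simps)
qed

lemma filter_targets: "length (filter (\<lambda>v. v div l = i) (targets n)) = bsum i"
  using sum_count_list[of "{i * l..<i * l + l}" "targets n"] unfolding block_iff bsum_def
  by (simp add: count_targets_n)

lemma wp_fill_sums: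
  assumes p: "pregs r" and wd: "words m" and z: "zero_from m (aS * w)" and tab: "table_upto m (2 ^ h * l)"
    and Q: "\<And>\<tau>' r' m'. \<tau>' \<le> \<tau> + (400 * M + 14 * n + 6) \<Longrightarrow> pregs r' \<Longrightarrow> r' 32 = r 32 \<Longrightarrow> words m' \<Longrightarrow> zero_from m' (aREL * w) \<Longrightarrow>
       table_upto m' (2 ^ h * l) \<Longrightarrow> (\<forall>i\<le>n div l. fld w m' (aS * w + i * b) b = ssat i) \<Longrightarrow> Q \<tau>' r' m' o'"
  shows "wp fill_sums Q \<tau> r m o'"
proof -
  define inv where "inv ys r' m' o1 \<longleftrightarrow> pregs r' \<and> r' 32 = r 32 \<and> words m' \<and> zero_from m' (aREL * w) \<and>
     table_upto m' (2 ^ h * l) \<and> o1 = o' \<and>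
     (\<forall>i\<le>n div l. fld w m' (aS * w + i * b) b = min (length (filter (\<lambda>v. v div l = i) ys)) cap)" for ys r' m' o1
  show ?thesis
    unfolding fill_sums_def
  proof (rule wp_for_edges[where T = 300 and P = inv], goal_cases)
    case 1
    show ?case using p by (simp add: pregs_def)
  next
    case 2
    show ?case by simp
  next
    case 3
    have "fld w m (aS * w + i * b) b = 0" if i: "i \<le> n div l" for i
      using block_index(1)[OF i] regions by (intro fld_zero[OF z]) linarith+
    moreover have "aS * w \<le> aREL * w" using regions by linarith
    ultimately show ?case using p wd tab zero_from_mono[OF z] by (auto simp: inv_def)
  next
    case (4 ys r r' m o')
    then show ?case by (auto simp: inv_def pregs_def keep_loopD)
  next
    case (5 ys v zs r1 m1 o1 \<tau>1)
    have vn: "v < n"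
    proof -
      have "v \<in> set (targets n)" using 5(1) by simp
      then show ?thesis using adj(3) E_bound by (auto simp: targets_def)
    qed
    define i where "i = v div l"
    have i: "i \<le> n div l" using vn unfolding i_def by (intro div_le_mono) simp
    have I: "pregs r1" "r1 32 = r 32" "words m1" "zero_from m1 (aREL * w)" "table_upto m1 (2 ^ h * l)" "o1 = o'"
      "\<And>i. i \<le> n div l \<Longrightarrow> fld w m1 (aS * w + i * b) b = min (length (filter (\<lambda>v. v div l = i) ys)) cap"
      using 5(2) by (auto simp: inv_def)
    define s where "s = min (length (filter (\<lambda>v. v div l = i) ys)) cap"
    have regs: "r1 53 = b" "r1 54 = l" "r1 57 = aS" "r1 65 = cap" using I(1) by (simp_all add: pregs_def)
    have bi: "i * b + b \<le> n" using block_index(1)[OF i] small_bounds by linarith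
    have ib: "i * b < 2 ^ w" using bi nm_word by linarith
    have e1: "word_op w Times i b = i * b" using ib by (rule word_op_Times)
    have kb: "aS * w + i * b + b \<le> k * w" "aS * w + i * b + b \<le> aREL * w"
      using block_index(1)[OF i] regions by linarith+
    have bw: "b \<le> w" using params(2) L_le_w by simp
    have f: "fld w m1 (aS * w + i * b) b = s" using I(7)[OF i] by (simp add: s_def)
    have keep: "inv (ys @ [v]) (junk j r2) m2 o'"
      if q: "pregs r2" "r2 32 = r 32" "words m2" "\<And>P. P < aS * w \<or> aREL * w \<le> P \<Longrightarrow> bitat w m2 P = bitat w m1 P"
       "fld w m2 (aS * w + i * b) b = min (Suc (length (filter (\<lambda>v. v div l = i) ys))) cap"
       "\<And>i'. i' \<noteq> i \<Longrightarrow> fld w m2 (aS * w + i' * b) b = fld w m1 (aS * w + i' * b) b"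
       for j r2 m2
    proof -
      have "table_upto m2 (2 ^ h * l)"
        unfolding table_upto_def
      proof (intro allI impI)
        fix i assume "i < 2 ^ h * l"
        moreover from this have "fld w m2 (i * b) b = fld w m1 (i * b) b"
          using table_index regions(1) q(4) by (intro fld_cong) (meson le_trans less_le_trans)
        ultimately show "fld w m2 (i * b) b = sel (i div l) (i mod l)" using I(5) by (simp add: table_upto_def)
      qed
      moreover have "zero_from m2 (aREL * w)" using I(4) q(4) by (simp add: zero_from_def)
      moreover have "fld w m2 (aS * w + i' * b) b = min (length (filter (\<lambda>v. v div l = i') (ys @ [v]))) cap"
        if "i' \<le> n div l" for i'
        using q(5) q(6)[of i'] I(7)[OF that] by (cases "i' = i") (auto simp: i_def)
      ultimately show ?thesis using q by (auto simp: inv_def pregs_def)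
    qed
    show ?case
      unfolding I(6)
      apply (rule wp_seq, rule wp_assign_val[where v = i], simp)
      subgoal using 5 regs by (simp add: i_def)
      apply (rule wp_seq, rule wp_Get; (simp add: regs e1 ib kb bw b_pos I(3))?)
      apply (simp add: f)
      apply (rule wp_if, simp)
      subgoal
      proof goal_cases
        case 1
        then have lt: "s < cap" by (simp add: regs word_op_Less)
        have s1: "word_op w Plus s (Suc 0) = Suc s"
        proof -
          have "(2::nat) ^ b \<le> 2 ^ w" using bw by (intro power_increasing) auto
          moreover have "Suc s < 2 ^ b" using lt by linarith
          ultimately have "s + Suc 0 < 2 ^ w" by linarith
          then show ?thesis by (subst word_op_Plus) auto
        qed
        have sb: "Suc s < 2 ^ b" using lt by linarith
        show ?case
          apply (rule wp_Put; (simp add: regs e1 ib kb bw b_pos I(3) take_bit_one s1 sb)?)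
          subgoal for \<tau>2 j2 m2
          proof goal_cases
            case w: 1
            have "inv (ys @ [v]) (junk j2 (r1(10 := i, 11 := s))) m2 o'"
            proof (rule keep)
              show "pregs (r1(10 := i, 11 := s))" "(r1(10 := i, 11 := s)) 32 = r 32" "words m2"
                using I w by (simp_all add: pregs_def)
              show "bitat w m2 P = bitat w m1 P" if "P < aS * w \<or> aREL * w \<le> P" for P
                using w(3) that kb by (auto simp: written_def)
              show "fld w m2 (aS * w + i * b) b = min (Suc (length (filter (\<lambda>v. v div l = i) ys))) cap"
                using written_same[OF w(3) sb] lt by (simp add: s_def)
              show "fld w m2 (aS * w + i' * b) b = fld w m1 (aS * w + i' * b) b" if "i' \<noteq> i" for i'
              proof (rule written_other[OF w(3)])
                show "aS * w + i' * b + b \<le> aS * w + i * b \<or> aS * w + i * b + b \<le> aS * w + i' * b"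
                  using mult_le_mono1[of "Suc i'" i b] mult_le_mono1[of "Suc i" i' b] that
                  by (cases "i' < i") auto
              qed
            qed
            then show ?case using 1 w 5 by simp
          qed
          done
      qed
      subgoal
      proof goal_cases
        case 1
        then have "\<not> s < cap" by (simp add: regs word_op_Less)
        then have "min (Suc (length (filter (\<lambda>v. v div l = i) ys))) cap = s" by (auto simp: s_def)
        then have "inv (ys @ [v]) (junk j (r1(10 := i, 11 := s))) m1 o'" for j
          using I f by (intro keep) (simp_all add: pregs_def)
        then show ?case using 1 5 by (intro wp_skip) simp
      qed
      done
  next
    case (6 \<tau>1 r1 m1 o1)
    then have o1: "o1 = o'" by (simp add: inv_def)
    show ?case unfolding o1 using 6 by (intro Q) (auto simp: inv_def filter_targets ssat_def)
  qed
qed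

lemma counters_zero:
  assumes "zero_from m (aCNT * w)"
  shows "counters m (\<lambda>_. 0)"
proof -
  have "fld w m (aCNT * w + vpos v) (width (v div l)) = 0" if "v < n" for v
    using vpos_bounds(2)[OF that] regions(7) by (intro fld_zero[OF assms]) linarith+
  moreover have "enc (map (\<lambda>_. 0) xs) = 0" for xs :: "nat list" by (induction xs) auto
  ultimately show ?thesis by (simp add: counters_def cval_def blk_def)
qed

lemma start_bound: "i \<le> n div l \<Longrightarrow> start i \<le> n + M"
proof -
  assume "i \<le> n div l"
  then have "i * l \<le> n" using mult_le_mono1[of i "n div l" l] by (meson le_trans div_times_less_eq_dividend)
  then show "start i \<le> n + M" using start_le[of i] by linarith
qed

lemma block_sep: "i \<noteq> i' \<Longrightarrow> a + i * x + x \<le> a + i' * x \<or> a + i' * x + x \<le> a + i * (x :: nat)"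
  using mult_le_mono1[of "Suc i'" i x] mult_le_mono1[of "Suc i" i' x] by (cases "i' < i") auto

definition offsets_upto :: "(nat \<Rightarrow> nat) \<Rightarrow> nat \<Rightarrow> bool" where
  "offsets_upto m t \<longleftrightarrow> (\<forall>i<t. fld w m (aABS * w + i div L * om) om = start (i div L * L) \<and>
        fld w m (aREL * w + i * (2 * b)) (2 * b) = start i - start (i div L * L))"

lemma wp_fill_offsets:
  assumes p: "pregs r" and wd: "words m" and z: "zero_from m (aREL * w)" and tab: "table_upto m (2 ^ h * l)"
    and S: "\<forall>i\<le>n div l. fld w m (aS * w + i * b) b = ssat i" and r32: "r 32 = 0"
    and Q: "\<And>\<tau>' r' m'. \<tau>' \<le> \<tau> + (600 * n + 630) \<Longrightarrow> crep r' m' (\<lambda>_. 0) {} {} \<Longrightarrow> Q \<tau>' r' m' o'"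
  shows "wp fill_offsets Q \<tau> r m o'"
proof -
  define inv where "inv r' m' t \<longleftrightarrow> keep 30 r r' \<and> r' 20 = t \<and> r' 24 = n div l + 1 \<and> words m' \<and> t \<le> n div l + 1 \<and>
     (\<forall>P. P < aREL * w \<or> aBMP * w \<le> P \<longrightarrow> bitat w m' P = bitat w m P) \<and>
     (t \<le> n div l \<longrightarrow> r' 21 = start t) \<and> (0 < t \<longrightarrow> r' 23 = start ((t - 1) div L * L)) \<and> offsets_upto m' t" for r' m' t
  have rr: "r 50 = n" "r 52 = L" "r 53 = b" "r 54 = l" "r 56 = om" "r 57 = aS" "r 58 = aREL" "r 59 = aABS" "r 66 = 2 * b"
    using p by (simp_all add: pregs_def)
  have Lp: "0 < L" using params(1) by simp
  have nbn: "n div l + 1 \<le> n"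
  proof -
    have "(n div l + 1) * 1 \<le> (n div l + 1) * (2 * b)" using b_pos by (intro mult_le_mono2) simp
    then have "n div l + 1 \<le> (n div l + 1) * (2 * b)" by simp
    then show ?thesis using params(10) by (rule le_trans)
  qed
  have final: "crep r' m' (\<lambda>_. 0) {} {}" if i: "inv r' m' (n div l + 1)" for r' m'
  proof -
    have low: "fld w m' P x = fld w m P x" if "P + x \<le> aREL * w" for P x
      using i that by (intro fld_cong) (auto simp: inv_def)
    have zb: "zero_from m' (aBMP * w)"
    proof -
      have "aREL * w \<le> aBMP * w" using regions by linarith
      then have "zero_from m (aBMP * w)" by (rule zero_from_mono[OF z])
      then show ?thesis using i by (auto simp: zero_from_def inv_def)
    qed
    have "static m'"
      unfolding static_def
    proof (intro conjI allI impI)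
      fix x j :: nat assume x: "x < 2 ^ h" "j < l"
      have "Suc x * l \<le> 2 ^ h * l" using x(1) by (intro mult_le_mono1) simp
      then have lt: "x * l + j < 2 ^ h * l" using x(2) by simp
      have "(x * l + j) * b + b \<le> aREL * w" using tab_index[OF x] regions by linarith
      then show "fld w m' ((x * l + j) * b) b = sel x j"
        using tab lt x by (simp add: low table_upto_def)
    next
      fix i' assume i': "i' \<le> n div l"
      have "aS * w + i' * b + b \<le> aREL * w" using block_index(1)[OF i'] regions by linarith
      then show "fld w m' (aS * w + i' * b) b = ssat i'" using S i' by (simp add: low)
      show "fld w m' (aABS * w + i' div L * om) om = start (i' div L * L)"
        "fld w m' (aREL * w + i' * (2 * b)) (2 * b) = start i' - start (i' div L * L)"
        using i i' by (auto simp: inv_def offsets_upto_def)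
    qed
    moreover have "counters m' (\<lambda>_. 0)"
    proof (intro counters_zero zero_from_mono[OF zb])
      show "aBMP * w \<le> aCNT * w" using regions by linarith
    qed
    moreover have "ready m' 0 {}"
      unfolding ready_def using zb regions by (auto simp: zero_from_def)
    moreover have "pregs r'" "r' 32 = 0" using i pregs_keep30[OF p, of r'] r32 by (simp_all add: inv_def)
    ultimately show ?thesis using i by (simp add: crep_def inv_def)
  qed
  have rest: "wp (Put (V 58) (V 20 \<otimes> V 66) (V 66) (V 21 \<ominus> V 23) ;;
        Get 25 (V 57) (V 20 \<otimes> V 53) (V 53) ;; (21 \<leftarrow> V 21 \<oplus> V 25 \<oplus> V 54) ;; (20 \<leftarrow> V 20 \<oplus> C 1))
      (\<lambda>\<tau>' r' m' o1. o1 = o' \<and> inv r' m' (Suc t) \<and> \<tau>' \<le> \<tau>1 + 300) \<tau>1 r1 m1 o'"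
    if q: "keep 30 r r1" "r1 20 = t" "r1 24 = n div l + 1" "words m1" "t \<le> n div l"
     "\<And>P. P < aREL * w \<or> aBMP * w \<le> P \<Longrightarrow> bitat w m1 P = bitat w m P"
     "r1 21 = start t" "r1 23 = start (t div L * L)" "offsets_upto m1 t"
     "fld w m1 (aABS * w + t div L * om) om = start (t div L * L)" for r1 m1 t \<tau>1
  proof -
    have r1: "r1 53 = b" "r1 54 = l" "r1 57 = aS" "r1 58 = aREL" "r1 66 = 2 * b" using rr q(1) by (simp_all add: keepD)
    note bi = block_index[OF q(5)]
    have tb: "t * (2 * b) < 2 ^ w" "t * b < 2 ^ w" using bi params(10) small_bounds nm_word by linarith+
    have e1: "word_op w Times t (2 * b) = t * (2 * b)" "word_op w Times t b = t * b"
      using tb by (auto intro: word_op_Times)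
    have kb: "aREL * w + t * (2 * b) + 2 * b \<le> aABS * w" "aABS * w \<le> k * w" "aABS * w \<le> aBMP * w"
      "aS * w + t * b + b \<le> aREL * w"
      using bi regions by linarith+
    have kb': "aREL * w + t * (2 * b) + 2 * b \<le> k * w" "aS * w + t * b + b \<le> k * w" using kb regions by linarith+
    have st: "start (t div L * L) \<le> start t" by (intro start_mono) simp
    have stw: "start t < 2 ^ w" using start_bound[OF q(5)] nm_word by linarith
    have e2: "word_op w Minus (start t) (start (t div L * L)) = start t - start (t div L * L)"
      using st stw by (subst word_op_Minus) auto
    have d: "start t - start (t div L * L) < 2 ^ (2 * b)"
    proof -
      define x where "x = t mod L * (2 ^ b + l)"
      define y where "y = L * (2 ^ b + l)"
      have "start t \<le> start (t div L * L) + x"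
        using start_add_le[of "t div L * L" "t mod L"] by (simp add: x_def)
      moreover have "Suc (t mod L) * (2 ^ b + l) \<le> L * (2 ^ b + l)"
        using Lp by (intro mult_le_mono1) (simp add: Suc_le_eq)
      then have "x + (2 ^ b + l) \<le> y" by (simp add: x_def y_def)
      moreover have "y \<le> 2 ^ (2 * b)" using params(8) by (simp add: y_def)
      ultimately show ?thesis using params(4) by linarith
    qed
    have bw: "b \<le> w" "2 * b \<le> w" using params(2) L_le_w by auto
    have f: "fld w m1 (aS * w + t * b) b = ssat t"
    proof -
      have "fld w m1 (aS * w + t * b) b = fld w m (aS * w + t * b) b"
        using q(6) kb(4) by (intro fld_cong) (meson less_le_trans)
      then show ?thesis using S q(5) by simp
    qed
    have tw: "word_op w Plus t (Suc 0) = Suc t" using q(5) nbn nm_word by (subst word_op_Plus) auto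
    show ?thesis
      apply (rule wp_seq, rule wp_Put; (simp add: q r1 e1 e2 tb kb' bw b_pos d)?)
      subgoal for \<tau>2 j2 m2
      proof goal_cases
        case w: 1
        have f2: "fld w m2 (aS * w + t * b) b = ssat t"
          using written_other[OF w(3), of "aS * w + t * b" b] kb f by simp
        have O: "offsets_upto m2 (Suc t)"
          unfolding offsets_upto_def
        proof (intro allI impI)
          fix i assume i: "i < Suc t"
          have a: "fld w m2 (aABS * w + i div L * om) om = fld w m1 (aABS * w + i div L * om) om"
            using kb by (intro written_other[OF w(3)]) simp
          show "fld w m2 (aABS * w + i div L * om) om = start (i div L * L) \<and>
              fld w m2 (aREL * w + i * (2 * b)) (2 * b) = start i - start (i div L * L)"
          proof (cases "i = t")
            case True
            then show ?thesis using a q(10) written_same[OF w(3) d] by simp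
          next
            case False
            then have "fld w m2 (aREL * w + i * (2 * b)) (2 * b) = fld w m1 (aREL * w + i * (2 * b)) (2 * b)"
              by (intro written_other[OF w(3)] block_sep)
            then show ?thesis using a i False q(9) by (simp add: offsets_upto_def)
          qed
        qed
        have F: "bitat w m2 P = bitat w m P" if "P < aREL * w \<or> aBMP * w \<le> P" for P
        proof -
          have "\<not> (aREL * w + t * (2 * b) \<le> P \<and> P < aREL * w + t * (2 * b) + 2 * b)" using that kb by linarith
          then have "bitat w m2 P = bitat w m1 P" using w(3) unfolding written_def by metis
          then show ?thesis using q(6)[OF that] by simp
        qed
        have nxt: "word_op w Plus (word_op w Plus (start t) (ssat t)) l = start (Suc t)" if "t < n div l"
        proof -
          have "start (Suc t) < 2 ^ w" using start_bound[of "Suc t"] that nm_word by simp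
          then show ?thesis by (simp add: start_Suc word_op_Plus)
        qed
        show ?case
          apply (rule wp_seq, rule wp_Get; (simp add: q r1 e1 tb kb' bw b_pos w)?)
          apply (simp add: f2)
          apply (rule wp_seq, rule wp_assign, simp)
          apply (rule wp_assign, simp)
          using w q F O tw nxt by (simp add: inv_def r1 take_bit_one)
      qed
      done
  qed
  have step: "wp
       ((22 \<leftarrow> V 20 \<oslash> V 52) ;;
        IfE (V 20 \<ominus> V 22 \<otimes> V 52) Skip (Put (V 59) (V 22 \<otimes> V 56) (V 56) (V 21) ;; (23 \<leftarrow> V 21)) ;;
        Put (V 58) (V 20 \<otimes> V 66) (V 66) (V 21 \<ominus> V 23) ;;
        Get 25 (V 57) (V 20 \<otimes> V 53) (V 53) ;; (21 \<leftarrow> V 21 \<oplus> V 25 \<oplus> V 54) ;; (20 \<leftarrow> V 20 \<oplus> C 1))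
      (\<lambda>\<tau>' r' m' o1. o1 = o' \<and> inv r' m' (Suc t) \<and> \<tau>' \<le> \<tau>1 + 500) \<tau>1 r1 m1 o'"
    if i: "inv r1 m1 t" and t: "t \<le> n div l" for r1 m1 t \<tau>1
  proof -
    have I: "keep 30 r r1" "r1 20 = t" "r1 24 = n div l + 1" "words m1"
     "\<And>P. P < aREL * w \<or> aBMP * w \<le> P \<Longrightarrow> bitat w m1 P = bitat w m P"
     "r1 21 = start t" "0 < t \<Longrightarrow> r1 23 = start ((t - 1) div L * L)" "offsets_upto m1 t"
      using i t by (auto simp: inv_def)
    have r1: "r1 52 = L" "r1 56 = om" "r1 59 = aABS" using rr I(1) by (simp_all add: keepD)
    have tw: "t < 2 ^ w" using t nbn nm_word by linarith
    have le: "t div L * L \<le> t" by simp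
    have e1: "word_op w Times (t div L) L = t div L * L" using le tw by (intro word_op_Times) linarith
    have e2: "word_op w Minus t (t div L * L) = t mod L"
      using le tw by (subst word_op_Minus) (auto simp: minus_div_mult_eq_mod le_less_trans[OF mod_less_eq_dividend])
    have bi: "t div L * om + om \<le> n" "aABS * w + t div L * om + om \<le> aBMP * w"
      using block_index(3)[OF t] small_bounds regions by linarith+
    have kb: "t div L * om < 2 ^ w" "aABS * w + t div L * om + om \<le> k * w" using bi nm_word regions om_pos by linarith+
    have e3: "word_op w Times (t div L) om = t div L * om" using kb(1) by (rule word_op_Times)
    have sb: "start t < 2 ^ om" using start_bound[OF t] less_bitlen[of "n + M"] by simp
    show ?thesis
      apply (rule wp_seq, rule wp_assign_val[where v = "t div L"], simp)
      subgoal by (simp add: I r1)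
      apply (rule wp_seq, rule wp_if, simp)
      subgoal
      proof goal_cases
        case 1
        then have tm: "t mod L \<noteq> 0" by (simp add: I r1 e1 e2)
        then have t0: "0 < t" by (cases t) auto
        have dv: "(t - 1) div L = t div L"
        proof -
          have "t - 1 = t div L * L + (t mod L - 1)" using tm by simp
          moreover have "t mod L - 1 < L" using Lp by (simp add: less_imp_diff_less)
          ultimately show ?thesis by (metis add_cancel_left_right div_less div_mult_self3 Lp less_irrefl)
        qed
        have "fld w m1 (aABS * w + (t - 1) div L * om) om = start ((t - 1) div L * L)"
          using I(8) t0 by (simp add: offsets_upto_def)
        then have A: "fld w m1 (aABS * w + t div L * om) om = start (t div L * L)" unfolding dv .
        show ?case
          apply (rule wp_skip, rule wp_conseq, rule rest[OF _ _ _ _ t])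
          using I A t0 by (simp_all add: dv[simplified])
      qed
      subgoal
      proof goal_cases
        case 1
        then have "t mod L = 0" by (simp add: I r1 e1 e2)
        then have tt: "t div L * L = t" by (metis add.right_neutral div_mult_mod_eq)
        show ?case
          apply (rule wp_seq, rule wp_Put; (simp add: I r1 e3 kb sb om_pos om_le_w)?)
          subgoal for \<tau>2 j2 m2
          proof goal_cases
            case w: 1
            have A: "fld w m2 (aABS * w + t div L * om) om = start (t div L * L)"
              using written_same[OF w(3) sb] tt by simp
            have F: "bitat w m2 P = bitat w m P" if "P < aREL * w \<or> aBMP * w \<le> P" for P
            proof -
              have "aREL * w \<le> aABS * w" using regions by linarith
              then have "\<not> (aABS * w + t div L * om \<le> P \<and> P < aABS * w + t div L * om + om)" using that bi by linarith
              then have "bitat w m2 P = bitat w m1 P" using w(3) unfolding written_def by metis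
              then show ?thesis using I(5)[OF that] by simp
            qed
            have O: "offsets_upto m2 t"
              unfolding offsets_upto_def
            proof (intro allI impI)
              fix i assume i: "i < t"
              have "i div L \<noteq> t div L"
              proof
                assume "i div L = t div L"
                then have "t \<le> i" using tt by (metis div_times_less_eq_dividend)
                then show False using i by simp
              qed
              then have 1: "fld w m2 (aABS * w + i div L * om) om = fld w m1 (aABS * w + i div L * om) om"
                by (intro written_other[OF w(3)] block_sep)
              have "aREL * w + i * (2 * b) + 2 * b \<le> aABS * w"
                using block_index(2)[of i] i t regions by linarith
              then have 2: "fld w m2 (aREL * w + i * (2 * b)) (2 * b) = fld w m1 (aREL * w + i * (2 * b)) (2 * b)"
                by (intro written_other[OF w(3)]) simp
              show "fld w m2 (aABS * w + i div L * om) om = start (i div L * L) \<and>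
                  fld w m2 (aREL * w + i * (2 * b)) (2 * b) = start i - start (i div L * L)"
                using 1 2 I(8) i by (simp add: offsets_upto_def)
            qed
            show ?case
              apply (rule wp_assign, simp)
              apply (rule wp_conseq, rule rest[OF _ _ _ _ t, unfolded One_nat_def])
              using I w A F O 1 by (simp_all add: tt)
          qed
          done
      qed
      done
  qed
  have nw: "word_op w Plus (n div l) (Suc 0) = n div l + 1" using nbn nm_word by (subst word_op_Plus) auto
  show ?thesis
    unfolding fill_offsets_def
    apply (rule wp_seq, rule wp_assign, simp)
    apply (rule wp_seq, rule wp_assign, simp)
    apply (rule wp_seq, rule wp_assign_val[where v = "n div l + 1"], simp)
    subgoal by (simp add: rr take_bit_one nw)
    apply (rule wp_while[where p = "600 * (n div l + 1)" and I = "\<lambda>p r' m' o1. o1 = o' \<and> inv r' m' (r' 20) \<and>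
       p = 600 * (n div l + 1 - r' 20)"])
    subgoal by simp
    subgoal using wd by (simp add: inv_def offsets_upto_def start_def)
    subgoal for p r1 m1 o1 \<tau>1
    proof goal_cases
      case 1
      then have le: "r1 20 \<le> n div l" by (auto simp: word_op_Less inv_def)
      have o1: "o1 = o'" using 1 by simp
      have i: "inv r1 m1 (r1 20)" using 1 by simp
      show ?case
        unfolding o1
        apply (rule wp_conseq, rule step[OF i le])
        subgoal for \<tau>2 r2 m2 o2
        proof goal_cases
          case q: 1
          have "r2 20 = Suc (r1 20)" using q by (simp add: inv_def)
          then show ?case using q le 1 by (intro exI[of _ "600 * (n div l + 1 - r2 20)"]) auto
        qed
        done
    qed
    subgoal for p r1 m1 o1 \<tau>1
    proof goal_cases
      case 1
      then have eq: "r1 20 = n div l + 1" by (auto simp: word_op_Less inv_def)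
      have "Q \<tau>1 r1 m1 o'"
      proof (rule Q)
        show "crep r1 m1 (\<lambda>_. 0) {} {}" using 1 eq by (intro final) simp
        show "\<tau>1 \<le> \<tau> + (600 * n + 630)" using 1 nbn by simp
      qed
      then show ?case using 1 by simp
    qed
    done
qed

theorem wp_packed_kahn:
  assumes n: "r 50 = n" and wd: "words m"
  shows "wp packed_kahn (\<lambda>\<tau>' r' m' o'. \<tau>' \<le> \<tau> + 7000 * (n + M + 1) \<and>
        (acyclic E \<longrightarrow> r' 0 = 0 \<and> topological_ordering n E o') \<and> (\<not> acyclic E \<longrightarrow> r' 0 \<noteq> 0)) \<tau> r m []"
proof -
  interpret kahn_ops w k R n E cinc cdec ctest cpush cpop 1000 crep by (rule packed_ops)
  have "wp setup_packed (\<lambda>\<tau>' r' m' o'. \<tau>' \<le> \<tau> + 2000 * (n + M + 1) \<and> crep r' m' (\<lambda>_. 0) {} {} \<and> o' = []) \<tau> r m []"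
    unfolding setup_packed_def
    apply (rule wp_seq, rule wp_count_edges, rule n)
    apply (rule wp_seq, rule wp_set_params, assumption, assumption)
    apply (rule wp_seq, rule wp_set_addresses, assumption+)
    apply (rule wp_seq, rule wp_clear_cells, assumption, rule wd)
    apply (rule wp_seq, rule wp_fill_table, erule (1) pregs_keep30[THEN conjunct1], assumption, assumption)
    subgoal for \<tau>1 r1 \<tau>2 r2 \<tau>3 r3 \<tau>4 r4 m4 \<tau>5 r5 m5
    proof goal_cases
      case 1
      have k4: "keep 30 r3 r5" using keep_trans 1 by blast
      have p5: "pregs r5" "r5 32 = 0" using pregs_keep30[OF _ k4] 1 by simp_all
      show ?case
        apply (rule wp_seq, rule wp_fill_sums, rule p5)
        using 1 apply simp_all[3]
        apply (rule wp_fill_offsets)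
        using p5 1 cells_le by simp_all
    qed
    done
  then show ?thesis
    unfolding packed_kahn_def
    apply (intro wp_seq)
    apply (erule wp_conseq)
    subgoal for \<tau>1 r1 m1 o1
    proof goal_cases
      case 1
      then have o1: "o1 = []" and c: "crep r1 m1 (\<lambda>_. 0) {} {}" and t: "\<tau>1 \<le> \<tau> + 2000 * (n + M + 1)" by auto
      have n1: "r1 50 = n" using c by (simp add: crep_def pregs_def)
      show ?case unfolding o1
        by (rule wp_conseq, rule wp_kahn[OF c n1]) (use t in auto)
    qed
    done
qed

end

section \<open>Asymptotics\<close>

definition overhead :: "nat \<Rightarrow> nat" where
  "overhead n = 2 ^ chunk n * ell n * beta n + (n div ell n + 1) * (3 * beta n) +
     (n div ell n div bitlen n + 1) * (2 * bitlen n)"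

lemma cells_bound:
  assumes "0 < w" "bitlen (n + m) \<le> 2 * bitlen n"
  shows "w * cells w n m \<le> m + 3 * n + overhead n + 10 * w"
proof -
  have r: "w * (x div w + c) \<le> x + c * w" for x c
    by (simp add: algebra_simps)
  define x1 where "x1 = 2 ^ chunk n * ell n * beta n"
  define x2 where "x2 = (n div ell n + 1) * beta n"
  define x3 where "x3 = (n div ell n + 1) * (2 * beta n)"
  define x4 where "x4 = (n div ell n div bitlen n + 1) * bitlen (n + m)"
  have "cells w n m = (x1 div w + 1) + (x2 div w + 1) + (x3 div w + 1) + (x4 div w + 1) +
      (n div w + 2) + (n div w + 2) + ((n + m) div w + 2)"
    unfolding cells_def addr_CNT_def addr_STK_def addr_BMP_def addr_ABS_def addr_REL_def addr_S_def
      x1_def x2_def x3_def x4_def by simp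
  then have "w * cells w n m = w * (x1 div w + 1) + w * (x2 div w + 1) + w * (x3 div w + 1) + w * (x4 div w + 1) +
      w * (n div w + 2) + w * (n div w + 2) + w * ((n + m) div w + 2)"
    by (simp only: distrib_left)
  also have "\<dots> \<le> (x1 + 1 * w) + (x2 + 1 * w) + (x3 + 1 * w) + (x4 + 1 * w) + (n + 2 * w) + (n + 2 * w) + (n + m + 2 * w)"
    by (intro add_mono r)
  finally have "w * cells w n m \<le> m + 3 * n + (x1 + x2 + x3 + x4) + 10 * w" by simp
  moreover have "x2 + x3 = (n div ell n + 1) * (3 * beta n)" by (simp add: x2_def x3_def algebra_simps)
  moreover have "x4 \<le> (n div ell n div bitlen n + 1) * (2 * bitlen n)"
    unfolding x4_def using assms(2) by (intro mult_le_mono2)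
  ultimately show ?thesis unfolding overhead_def x1_def by linarith
qed

lemma square_le_power: "7 \<le> x \<Longrightarrow> x * x \<le> 2 ^ (x - 1)" for x :: nat
proof (induction x rule: dec_induct)
  case (step x)
  have "Suc x * Suc x \<le> 2 * (x * x)"
  proof -
    have "3 * x \<le> x * x" using step.hyps by (intro mult_le_mono1) simp
    moreover have "Suc x * Suc x = x * x + 2 * x + 1" by simp
    ultimately show ?thesis using step.hyps(1) by linarith
  qed
  also have "\<dots> \<le> 2 * 2 ^ (x - 1)" using step.IH by simp
  also have "\<dots> = 2 ^ (Suc x - 1)" using step.hyps by (cases x) auto
  finally show ?case .
qed simp

lemma param_bounds:
  assumes q: "40 \<le> q" "q * beta n ^ 3 \<le> bitlen n" "q \<le> beta n"
  shows "large n" "q * overhead n \<le> 31 * n"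
proof -
  define x where "x = bitlen n"
  define u where "u = bitlen x"
  define b where "b = beta n"
  define l where "l = ell n"
  define h where "h = chunk n"
  have b: "b = 4 * u" by (simp add: b_def beta_def u_def x_def)
  have bq: "q \<le> b" "q * b ^ 3 \<le> x" using q by (simp_all add: b_def x_def)
  have b40: "40 \<le> b" using bq q by simp
  have b3: "40 * b ^ 3 \<le> x" using q(1) bq(2) by (meson le_trans mult_le_mono1)
  have bp: "b \<le> b * b" "b * b \<le> b ^ 3" using b40 by (simp_all add: power3_eq_cube)
  have bx: "40 * b \<le> x" "40 * (b * b) \<le> x" using b3 bp by linarith+
  have n0: "0 < n" using bx b40 by (cases n) (auto simp: x_def bitlen.simps)
  have x0: "0 < x" using bx b40 by linarith
  have nx: "n < 2 ^ x" "2 ^ (x - 1) \<le> n" using less_bitlen[of n] bitlen_ge[OF n0] by (simp_all add: x_def)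
  have xu: "x < 2 ^ u" "2 ^ (u - 1) \<le> x" using less_bitlen[of x] bitlen_ge[OF x0] by (simp_all add: u_def)
  have u10: "10 \<le> u" using b40 b by simp
  have ux: "2 ^ u \<le> 2 * x"
  proof -
    have "(2::nat) ^ u = 2 * 2 ^ (u - 1)" using u10 by (cases u) auto
    then show ?thesis using xu by simp
  qed
  have xx: "x * x \<le> n" using square_le_power[of x] nx bx b40 by linarith
  have xn: "x \<le> n" using bitlen_le_self[of n] by (simp add: x_def)
  have ldef: "l = x div (b * b)" by (simp add: l_def ell_def x_def b_def)
  have lb: "l * (b * b) \<le> x" unfolding ldef by simp
  have l2: "x \<le> 2 * (l * (b * b))"
  proof -
    have "x < b * b + l * (b * b)" unfolding ldef using b40 by (intro dividend_less_div_times) simp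
    moreover have "1 \<le> l" unfolding ldef using bx b40 by (simp add: div_greater_zero_iff Suc_le_eq)
    then have "1 * (b * b) \<le> l * (b * b)" by (rule mult_le_mono1)
    ultimately show ?thesis by linarith
  qed
  have l0: "0 < l" using l2 x0 by (cases l) auto
  have qb: "q * b \<le> 2 * l"
  proof -
    have "(q * b) * (b * b) = q * b ^ 3" "(2 * l) * (b * b) = 2 * (l * (b * b))"
      by (simp_all add: power3_eq_cube)
    then have "(q * b) * (b * b) \<le> (2 * l) * (b * b)" using bq(2) l2 by linarith
    moreover have "0 < b * b" using b40 by simp
    ultimately show ?thesis by (metis mult_le_cancel2)
  qed
  have q2l: "q \<le> 2 * l"
  proof -
    have "q * 1 \<le> q * b" using b40 by (intro mult_le_mono2) simp
    then show ?thesis using qb by linarith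
  qed
  have lbx: "l * b * 40 \<le> x"
  proof -
    have "l * b * 40 \<le> l * b * b" using b40 by (intro mult_le_mono2)
    then show ?thesis using lb by (simp only: mult.assoc)
  qed
  have lx: "l * 1 \<le> l * b" using b40 by (intro mult_le_mono2) simp
  have hx: "h = x + 3 - u" by (simp add: h_def chunk_def x_def u_def)
  have uh: "4 * u * 40 \<le> x" using bx b by simp
  have hh: "h \<le> x" "x \<le> 2 * h" "h + u = x + 3" using hx u10 uh by linarith+
  have pow: "(2::nat) ^ b = 2 ^ u * 2 ^ u * 2 ^ u * 2 ^ u" unfolding b by (simp add: power_add[symmetric])
  have u1: "(1::nat) \<le> 2 ^ u" by simp
  have big: "x * x < 2 ^ b"
  proof -
    have "x * x < 2 ^ u * 2 ^ u" using xu by (intro mult_strict_mono) auto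
    also have "\<dots> * 1 \<le> 2 ^ u * 2 ^ u * (2 ^ u * 2 ^ u)" by (intro mult_le_mono2) simp
    finally show ?thesis unfolding pow by (simp add: mult_ac)
  qed
  have x2: "2 * x \<le> x * x" using x0 bx b40 by (intro mult_le_mono1) linarith
  have c6: "l * x < 2 ^ b"
  proof -
    have "l * x \<le> x * x" using lbx lx by (intro mult_le_mono1) linarith
    then show ?thesis using big by linarith
  qed
  have c7: "h + l < 2 ^ b" using hh lbx lx x2 big by linarith
  have c8: "x * (2 ^ b + l) \<le> 2 ^ (2 * b)"
  proof -
    have "l \<le> 2 ^ b" using c7 by simp
    then have "x * (2 ^ b + l) \<le> x * (2 * 2 ^ b)" by (intro mult_le_mono2) simp
    also have "\<dots> = (2 * x) * 2 ^ b" by simp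
    also have "\<dots> \<le> 2 ^ b * 2 ^ b" using x2 big by (intro mult_le_mono1) linarith
    finally show ?thesis by (simp add: mult_2 power_add)
  qed
  have hn: "2 ^ h * x \<le> 16 * n"
  proof -
    have "2 ^ h * x \<le> 2 ^ h * 2 ^ u" using xu by (intro mult_le_mono2) simp
    also have "\<dots> = 2 ^ (x + 3)" using hh(3) by (simp add: power_add[symmetric])
    also have "\<dots> = 16 * 2 ^ (x - 1)" using x0 by (cases x) (auto simp: power_add)
    also have "\<dots> \<le> 16 * n" using nx by simp
    finally show ?thesis .
  qed
  have t1: "q * (2 ^ h * l * b) \<le> 16 * n"
  proof -
    have "q * (2 ^ h * l * b) \<le> b * (2 ^ h * l * b)" using bq by (intro mult_le_mono1)
    also have "\<dots> = 2 ^ h * (l * (b * b))" by (simp add: mult_ac)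
    also have "\<dots> \<le> 2 ^ h * x" using lb by (intro mult_le_mono2)
    finally show ?thesis using hn by linarith
  qed
  have nl: "n div l * l \<le> n" by simp
  have qx: "q \<le> x"
  proof -
    have "q * 1 \<le> q * b ^ 3" using b40 by (intro mult_le_mono2) simp
    then show ?thesis using bq(2) by linarith
  qed
  have t2: "q * ((n div l + 1) * (3 * b)) \<le> 9 * n"
  proof -
    have "q * ((n div l + 1) * (3 * b)) = 3 * (n div l * (q * b)) + 3 * (q * b)" by (simp add: algebra_simps)
    also have "n div l * (q * b) \<le> n div l * (2 * l)" using qb by (intro mult_le_mono2)
    also have "\<dots> \<le> 2 * n" using nl by simp
    finally have "q * ((n div l + 1) * (3 * b)) \<le> 6 * n + 3 * (q * b)" by simp
    moreover have "q * b \<le> q * b ^ 3" using bp by (intro mult_le_mono2) linarith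
    ultimately show ?thesis using bq(2) xn by linarith
  qed
  have t3: "q * ((n div l div x + 1) * (2 * x)) \<le> 6 * n"
  proof -
    have "q * ((n div l div x + 1) * (2 * x)) = 2 * (q * (n div l div x * x)) + 2 * (q * x)" by (simp add: algebra_simps)
    also have "q * (n div l div x * x) \<le> (2 * l) * (n div l)" using q2l by (intro mult_le_mono) simp_all
    also have "\<dots> \<le> 2 * n" using nl by (simp add: mult_ac)
    also have "q * x \<le> x * x" using qx by (intro mult_le_mono1)
    finally show ?thesis using xx by simp
  qed
  have q40: "40 * y \<le> q * y" for y using q(1) by (intro mult_le_mono1)
  show "q * overhead n \<le> 31 * n"
    using t1 t2 t3 unfolding overhead_def x_def b_def l_def h_def by (simp add: distrib_left)
  have c9: "2 ^ h * l * b \<le> n" using t1 q40[of "2 ^ h * l * b"] by linarith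
  have c10: "(n div l + 1) * (2 * b) \<le> n"
  proof -
    have "(n div l + 1) * (2 * b) \<le> (n div l + 1) * (3 * b)" by (intro mult_le_mono2) simp
    then show ?thesis using t2 q40[of "(n div l + 1) * (3 * b)"] by linarith
  qed
  have c11: "(n div l div x + 1) * (2 * x) \<le> n" using t3 q40[of "(n div l div x + 1) * (2 * x)"] by linarith
  have c12: "n div h < 2 ^ h"
  proof -
    have "n < 2 ^ h * h"
    proof -
      have "2 ^ (x + 3) = 2 ^ h * (2::nat) ^ u" using hh(3) by (simp add: power_add[symmetric])
      also have "\<dots> \<le> 2 ^ h * (4 * h)" using ux hh(2) by (intro mult_le_mono2) linarith
      finally have "8 * 2 ^ x \<le> 4 * (2 ^ h * h)" by (simp add: power_add mult_ac)
      then show ?thesis using nx by linarith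
    qed
    then show ?thesis by (rule less_mult_imp_div_less)
  qed
  have c5: "l * b + l \<le> h" using lbx lx hh(2) by linarith
  show "large n"
    unfolding large_def using bx b40 hh l0 c5 c6 c7 c8 c9 c10 c11 c12
    unfolding x_def b_def l_def h_def by linarith
qed

lemma bitlen_large: "2 ^ N \<le> n \<Longrightarrow> N < bitlen n"
proof (rule ccontr)
  assume "2 ^ N \<le> n" "\<not> N < bitlen n"
  then have "(2::nat) ^ bitlen n \<le> 2 ^ N" by (intro power_increasing) auto
  then show False using less_bitlen[of n] \<open>2 ^ N \<le> n\<close> by linarith
qed

lemma cube_le_power: "\<exists>N. \<forall>u\<ge>N. q * u ^ 3 \<le> (2::nat) ^ (u - 1)"
proof (intro exI allI impI)
  fix u assume u: "4 * (64 * q) + 4 \<le> u"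
  define j where "j = (u - 1) div 4"
  have j0: "4 * j \<le> u - 1" "u - 1 < 4 * Suc j"
    unfolding j_def using dividend_less_times_div[of 4 "u - 1"] by simp_all
  then have j: "64 * q \<le> j" "u \<le> 4 * Suc j" "4 * j \<le> u - 1" using u by presburger+
  have "q * u ^ 3 \<le> q * (4 * Suc j) ^ 3" using j by (intro mult_le_mono2 power_mono) auto
  also have "\<dots> = (64 * q) * Suc j ^ 3" by (simp add: power_mult_distrib del: mult_Suc_right)
  also have "\<dots> \<le> Suc j * Suc j ^ 3" using j by (intro mult_le_mono1) simp
  also have "\<dots> = Suc j ^ 4" by (simp add: eval_nat_numeral)
  also have "\<dots> \<le> (2 ^ j) ^ 4" using less_exp[of j] by (intro power_mono Suc_leI) auto
  also have "\<dots> = 2 ^ (4 * j)" by (simp add: power_mult[symmetric] mult.commute)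
  also have "\<dots> \<le> 2 ^ (u - 1)" using j by (intro power_increasing) auto
  finally show "q * u ^ 3 \<le> 2 ^ (u - 1)" .
qed

lemma eventually_params: "\<exists>N. \<forall>n\<ge>N. q * beta n ^ 3 \<le> bitlen n \<and> q \<le> beta n"
proof -
  obtain N where N: "\<And>u. N \<le> u \<Longrightarrow> (q * 64) * u ^ 3 \<le> (2::nat) ^ (u - 1)" using cube_le_power[of "q * 64"] by blast
  show ?thesis
  proof (intro exI allI impI)
    fix n :: nat assume "2 ^ 2 ^ (N + q) \<le> n"
    then have "2 ^ (N + q) < bitlen n" by (rule bitlen_large)
    then have u: "N + q < bitlen (bitlen n)" and L: "0 < bitlen n" by (auto intro: bitlen_large)
    have "q * beta n ^ 3 = (q * 64) * bitlen (bitlen n) ^ 3" by (simp add: beta_def power_mult_distrib)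
    also have "\<dots> \<le> 2 ^ (bitlen (bitlen n) - 1)" using u by (intro N) simp
    also have "\<dots> \<le> bitlen n" by (rule bitlen_ge[OF L])
    finally show "q * beta n ^ 3 \<le> bitlen n \<and> q \<le> beta n" using u by (simp add: beta_def)
  qed
qed

lemma overhead_smallo: "(\<lambda>n. real (overhead n)) \<in> o(\<lambda>n. real n)"
proof (rule landau_o.smallI)
  fix c :: real assume c: "0 < c"
  obtain q :: nat where q: "31 / c < real q" using reals_Archimedean2 by blast
  obtain N where N: "\<And>n. N \<le> n \<Longrightarrow> (q + 40) * beta n ^ 3 \<le> bitlen n \<and> q + 40 \<le> beta n"
    using eventually_params[of "q + 40"] by blast
  have "real (overhead n) \<le> c * real n" if "N \<le> n" for n
  proof -
    have "(q + 40) * overhead n \<le> 31 * n" using N[OF that] by (intro param_bounds(2)) auto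
    then have "real ((q + 40) * overhead n) \<le> real (31 * n)" by (simp only: of_nat_le_iff)
    then have 1: "(real q + 40) * real (overhead n) \<le> 31 * real n" by simp
    have "31 \<le> c * (real q + 40)" using q c by (simp add: field_simps)
    then have "31 * real n \<le> c * (real q + 40) * real n" by (intro mult_right_mono) auto
    with 1 have "(real q + 40) * real (overhead n) \<le> c * (real q + 40) * real n" by linarith
    then have "(real q + 40) * real (overhead n) \<le> (real q + 40) * (c * real n)" by (simp only: mult_ac)
    then show ?thesis by (rule mult_left_le_imp_le) simp
  qed
  then show "\<forall>\<^sub>F n in at_top. norm (real (overhead n)) \<le> c * norm (real n)"
    by (auto simp: eventually_at_top_linorder)
qed

lemma smallo_graph_size:
  fixes G :: "nat \<Rightarrow> real"
  assumes "G \<in> o(\<lambda>n. real n)"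
  shows "(\<lambda>(n, m). G n) \<in> o[graph_size_at_top](\<lambda>(n, m). real (n + m))"
proof (rule landau_o.smallI)
  fix c :: real assume c: "0 < c"
  obtain N where N: "\<And>n. N \<le> n \<Longrightarrow> norm (G n) \<le> c * norm (real n)"
    using landau_o.smallD[OF assms c] by (auto simp: eventually_at_top_linorder)
  define K where "K = (\<Sum>n<N. norm (G n))"
  obtain B :: nat where B: "K / c < real B" using reals_Archimedean2 by blast
  have "norm (G n) \<le> c * real (n + m)" if "B \<le> n + m" for n m
  proof (cases "N \<le> n")
    case True
    then have "norm (G n) \<le> c * real n" using N by simp
    also have "\<dots> \<le> c * real (n + m)" using c by simp
    finally show ?thesis .
  next
    case False
    then have "norm (G n) \<le> K" unfolding K_def by (intro member_le_sum) auto
    also have "K \<le> c * real B" using B c by (simp add: field_simps)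
    also have "\<dots> \<le> c * real (n + m)" using that c by (intro mult_left_mono) auto
    finally show ?thesis .
  qed
  then show "\<forall>\<^sub>F x in graph_size_at_top. norm (case x of (n, m) \<Rightarrow> G n) \<le> c * norm (case x of (n, m) \<Rightarrow> real (n + m))"
    unfolding graph_size_at_top_def eventually_filtercomap
    by (intro exI[of _ "\<lambda>k. B \<le> k"]) (auto simp: eventually_at_top_linorder)
qed

text \<open>
  If the word length is at most \<open>e\<close>, then the constant \<open>2 ^ e - 1\<close> is truncated to the largest word
  and the second test fails, as it should.
\<close>

definition topological_sort :: "nat \<Rightarrow> com" where
  "topological_sort e = InputE 50 (C 0) ;; (0 \<leftarrow> C 0) ;;
     IfE (V 50) (IfE (C (2 ^ e - 1) \<prec> V 50) packed_kahn naive_kahn) Skip"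

definition time_factor :: "nat \<Rightarrow> nat" where
  "time_factor e = 7000 + 4 * (20 * 2 ^ e + 20) + 100"

lemma topological_sort_correct:
  assumes e: "\<And>n. 2 ^ e \<le> n \<Longrightarrow> large n"
    and g: "digraph_on n E" "adjacency_list n E R" "fits_in_words w R"
    and s: "initial_state w s"
    and k: "k = (if 2 ^ e \<le> n then cells w n (card E) else n)"
  shows "\<exists>t s'. exec w k R (topological_sort e) s t s' \<and> t \<le> time_factor e * (n + card E + 1) \<and>
     (acyclic E \<longrightarrow> regs s' 0 = 0 \<and> topological_ordering n E (out s')) \<and> (\<not> acyclic E \<longrightarrow> regs s' 0 \<noteq> 0)"
proof -
  interpret graph_input w k R n E
    using g by unfold_locales (auto simp: fits_in_words_def)
  have R0: "R ! 0 = n" "0 < length R" using g(2) by (auto simp: adjacency_list_def)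
  have nw: "n < 2 ^ w" using size_bound by simp
  have words: "\<forall>a. mem s a < 2 ^ w" and out: "out s = []" using s by (auto simp: initial_state_def)
  have "wp (topological_sort e) (\<lambda>\<tau>' r' m' o'. \<tau>' \<le> 0 + time_factor e * (n + card E + 1) \<and>
     (acyclic E \<longrightarrow> r' 0 = 0 \<and> topological_ordering n E o') \<and> (\<not> acyclic E \<longrightarrow> r' 0 \<noteq> 0)) 0 (regs s) (mem s) []"
    unfolding topological_sort_def
    apply (rule wp_seq, rule wp_input, simp)
    subgoal using R0 by simp
    apply (rule wp_seq, rule wp_assign, simp)
    apply (rule wp_if, simp)
    subgoal
    proof goal_cases
      case 1
      then have n0: "0 < n" by (simp add: R0)
      have w0: "0 < w" using nw n0 by (cases w) auto
      have less: "take_bit w (2 ^ e - 1) < n \<longleftrightarrow> 2 ^ e \<le> n"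
      proof (cases "w \<le> e")
        case True
        have "take_bit w (2 ^ e - 1) = (2 ^ w - 1 :: nat)"
          by (rule bit_eqI) (metis (no_types, lifting) True bit_mask_iff bit_take_bit_iff less_le_trans mask_eq_exp_minus_1)
        moreover have "(2::nat) ^ w \<le> 2 ^ e" using True by (intro power_increasing) auto
        ultimately show ?thesis using nw by linarith
      next
        case False
        then have "(2::nat) ^ e \<le> 2 ^ w" by (intro power_increasing) auto
        then have "(2::nat) ^ e - 1 < 2 ^ w" by (rule less_le_trans[rotated]) simp
        then have "take_bit w (2 ^ e - 1) = (2 ^ e - 1 :: nat)" by (rule take_bit_small)
        then show ?thesis by (simp add: Suc_le_eq[symmetric])
      qed
      show ?case
      proof (rule wp_if, simp, goal_cases)
        case 1
        then have big: "2 ^ e \<le> n" using less w0 by (simp add: word_op_Less R0)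
        interpret packed w k R n E
          by unfold_locales (use e[OF big] k big in auto)
        show ?case
          apply (rule wp_conseq, rule wp_packed_kahn)
          subgoal using R0 by simp
          subgoal by (rule words)
          subgoal for \<tau>1 r1 m1 o1
            using mult_le_mono1[of 7010 "time_factor e" "n + M + 1"] by (auto simp: time_factor_def[of e])
          done
      next
        case 2
        then have small: "n < 2 ^ e" using less w0 by (simp add: word_op_Less R0)
        interpret naive w k R n E
          by unfold_locales (use n0 k small in auto)
        have b: "(4 * (20 * n + 20) + 60) * (n + card E + 1) \<le> (4 * (20 * 2 ^ e + 20) + 60) * (n + card E + 1)"
          using small by (intro mult_le_mono1) simp
        show ?case
          apply (rule wp_conseq, rule wp_naive_kahn)
          subgoal using R0 by simp
          subgoal using b by (auto simp: time_factor_def add_mult_distrib)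
          done
      qed
    qed
    subgoal
    proof goal_cases
      case 1
      then have n0: "n = 0" by (simp add: R0)
      then have E0: "E = {}" using E_bound by auto
      show ?case
        by (rule wp_skip) (auto simp: n0 E0 topological_ordering_def time_factor_def acyclic_def)
    qed
    done
  from wpE[OF this refl refl out] obtain t s' r' where t: "exec w k R (topological_sort e) s t s'"
    "\<And>x. x < 100 \<Longrightarrow> regs s' x = r' x"
    "0 + t \<le> 0 + time_factor e * (n + card E + 1) \<and>
     (acyclic E \<longrightarrow> r' 0 = 0 \<and> topological_ordering n E (out s')) \<and> (\<not> acyclic E \<longrightarrow> r' 0 \<noteq> 0)"
    by blast
  have "regs s' 0 = r' 0" by (rule t(2)) simp
  then show ?thesis using t(1,3) by (intro exI[of _ t] exI[of _ s']) simp
qed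

theorem theorem12:
  shows "\<exists>(c :: com) (T :: nat \<times> nat \<Rightarrow> nat).
    (\<lambda>(n, m). real (T (n, m))) \<in> O[graph_size_at_top](\<lambda>(n, m). real (m + n)) \<and>
    (\<forall>W :: nat \<Rightarrow> nat.
      (\<lambda>n. real (W n)) \<in> \<Omega>(\<lambda>n. log 2 (real n)) \<and> (\<lambda>n. real (W n)) \<in> o(\<lambda>n. real n) \<longrightarrow>
      (\<exists>g :: nat \<times> nat \<Rightarrow> real.
        g \<in> o[graph_size_at_top](\<lambda>(n, m). real (n + m)) \<and>
        (\<forall>n m E R s.
          digraph_on n E \<and> card E = m \<and> adjacency_list n E R \<and> fits_in_words (W n) R \<and>
          initial_state (W n) s \<longrightarrow>
          (\<exists>k t s'.
            exec (W n) k R c s t s' \<and>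
            t \<le> T (n, m) \<and>
            real (workspace_bits (W n) k c) \<le> real m + 3 * real n + g (n, m) \<and>
            (acyclic E \<longrightarrow> regs s' 0 = 0 \<and> topological_ordering n E (out s')) \<and>
            (\<not> acyclic E \<longrightarrow> regs s' 0 \<noteq> 0)))))"
proof -
  obtain e where e0: "\<And>n. e \<le> n \<Longrightarrow> 40 * beta n ^ 3 \<le> bitlen n \<and> 40 \<le> beta n"
    using eventually_params[of 40] by blast
  have e: "large n" if "2 ^ e \<le> n" for n
  proof -
    have "e \<le> n" using that less_exp[of e] by linarith
    then show ?thesis using e0 by (intro param_bounds(1)[of 40]) auto
  qed
  define c where "c = topological_sort e"
  define T where "T = (\<lambda>(n, m). time_factor e * (n + m + 1))"
  have T: "(\<lambda>(n, m). real (T (n, m))) \<in> O[graph_size_at_top](\<lambda>(n, m). real (m + n))"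
  proof (rule bigoI[of _ "2 * real (time_factor e)"])
    have "real (T (n, m)) \<le> 2 * real (time_factor e) * real (m + n)" if "1 \<le> n + m" for n m
    proof -
      have "T (n, m) \<le> 2 * time_factor e * (m + n)"
        using mult_le_mono2[of "n + m + 1" "2 * (m + n)" "time_factor e"] that by (simp add: T_def mult_ac)
      then have "real (T (n, m)) \<le> real (2 * time_factor e * (m + n))" by (simp only: of_nat_le_iff)
      then show ?thesis by simp
    qed
    then show "\<forall>\<^sub>F x in graph_size_at_top. norm (case x of (n, m) \<Rightarrow> real (T (n, m))) \<le>
        2 * real (time_factor e) * norm (case x of (n, m) \<Rightarrow> real (m + n))"
      unfolding graph_size_at_top_def eventually_filtercomap
      by (intro exI[of _ "\<lambda>k. 1 \<le> k"]) (auto simp: eventually_at_top_linorder)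
  qed
  show ?thesis
  proof (rule exI[of _ c], rule exI[of _ T], rule conjI[OF T], intro allI impI)
    fix W :: "nat \<Rightarrow> nat"
    assume W: "(\<lambda>n. real (W n)) \<in> \<Omega>(\<lambda>n. log 2 (real n)) \<and> (\<lambda>n. real (W n)) \<in> o(\<lambda>n. real n)"
    define G where "G n = real (card (registers c) + 10) * real (W n) +
      (real (overhead n) + (if n < 2 ^ e then real (W n * n) else 0))" for n
    have "(\<lambda>n. if n < 2 ^ e then real (W n * n) else 0) \<in> o(\<lambda>n. real n)"
      by (rule landau_o.smallI, rule eventually_at_top_linorderI[of "2 ^ e"]) auto
    then have "G \<in> o(\<lambda>n. real n)"
      unfolding G_def using W overhead_smallo by (intro sum_in_smallo landau_o.small.cmult_in_iff') auto
    then have g: "(\<lambda>(n, m). G n) \<in> o[graph_size_at_top](\<lambda>(n, m). real (n + m))"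
      by (rule smallo_graph_size)
    show "\<exists>g. g \<in> o[graph_size_at_top](\<lambda>(n, m). real (n + m)) \<and>
        (\<forall>n m E R s.
          digraph_on n E \<and> card E = m \<and> adjacency_list n E R \<and> fits_in_words (W n) R \<and>
          initial_state (W n) s \<longrightarrow>
          (\<exists>k t s'.
            exec (W n) k R c s t s' \<and>
            t \<le> T (n, m) \<and>
            real (workspace_bits (W n) k c) \<le> real m + 3 * real n + g (n, m) \<and>
            (acyclic E \<longrightarrow> regs s' 0 = 0 \<and> topological_ordering n E (out s')) \<and>
            (\<not> acyclic E \<longrightarrow> regs s' 0 \<noteq> 0)))"
    proof (rule exI, rule conjI[OF g], intro allI impI, elim conjE)
      fix n m E R s
      assume a: "digraph_on n E" "card E = m" "adjacency_list n E R" "fits_in_words (W n) R"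
        "initial_state (W n) s"
      define k where "k = (if 2 ^ e \<le> n then cells (W n) n (card E) else n)"
      obtain t s' where ts: "exec (W n) k R c s t s'" "t \<le> T (n, m)"
        "acyclic E \<longrightarrow> regs s' 0 = 0 \<and> topological_ordering n E (out s')" "\<not> acyclic E \<longrightarrow> regs s' 0 \<noteq> 0"
        using topological_sort_correct[OF e a(1,3,4,5) k_def] a(2) unfolding c_def T_def by auto
      have "W n * k \<le> m + 3 * n + (10 * W n + overhead n + (if n < 2 ^ e then W n * n else 0))"
      proof (cases "2 ^ e \<le> n")
        case True
        interpret packed "W n" k R n E
          using a e[OF True] True by unfold_locales (auto simp: fits_in_words_def k_def)
        show ?thesis using cells_bound[OF w_pos om_le_2L] True a(2) by (simp add: k_def)
      next
        case False
        then show ?thesis by (simp add: k_def)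
      qed
      then have "real (W n * k) \<le> real (m + 3 * n + (10 * W n + overhead n + (if n < 2 ^ e then W n * n else 0)))"
        by (simp only: of_nat_le_iff)
      then have "real (workspace_bits (W n) k c) \<le> real m + 3 * real n + G n"
        unfolding workspace_bits_def G_def by (auto simp: algebra_simps split: if_splits)
      then show "\<exists>k t s'.
            exec (W n) k R c s t s' \<and>
            t \<le> T (n, m) \<and>
            real (workspace_bits (W n) k c) \<le> real m + 3 * real n + (case (n, m) of (n, m) \<Rightarrow> G n) \<and>
            (acyclic E \<longrightarrow> regs s' 0 = 0 \<and> topological_ordering n E (out s')) \<and>
            (\<not> acyclic E \<longrightarrow> regs s' 0 \<noteq> 0)"
        using ts by (intro exI[of _ k] exI[of _ t] exI[of _ s']) simp
    qed
  qed
qed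

end
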